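(* (Horizon Comparison Theorem) Let $0<T_1<T_2$. For $i=1,2$ let $\xi_i\in L^2(\mathcal{F}_{T_i})$, let $g^{T_i}:\Omega\times[0,T_i]\times\mathbb{R}\times\mathbb{R}^d\to\mathbb{R}$ be a driver satisfying the standard assumptions, and let $(Y^{T_i}_t,Z^{T_i}_t)_{t\in[0,T_i]}$ be the solution of the BSDE $$Y_t^{T_i}=\xi_i+\int_t^{T_i}g^{T_i}(s,Y_s^{T_i},Z_s^{T_i})\,ds-\int_t^{T_i}Z_s^{T_i}\,dB_s .$$ If $g^{T_2}(s,y,z)\ge g^{T_1}(s,y,z)$ for any $s\in[0,T_1]$, $y\in\mathbb{R}$, $z\in\mathbb{R}^d$, if $g^{T_2}(s,y,z)\ge0$ for any $s\in[T_1,T_2]$, $y\in\mathbb{R}$, $z\in\mathbb{R}^d$, and if $\xi_2\ge\xi_1$, then $Y_t^{T_2}\ge Y_t^{T_1}$ for any $t\in[0,T_1]$ and $Y_t^{T_2}\ge\xi_1$ for any $t\in[T_1,T_2]$.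
   Context: $(\Omega,\mathcal{F},P)$ is a probability space carrying a $d$-dimensional Brownian motion $B$, and $(\mathcal{F}_t)$ is its $P$-augmented natural filtration. Standard assumptions on a driver $g$ on $[0,S]$: $g(\cdot,y,z)$ is adapted; there is $C>0$ such that, $dP\times dt$-a.e., $|g(t,y_1,z_1)-g(t,y_2,z_2)|\le C(|y_1-y_2|+|z_1-z_2|)$ for all $y_1,y_2\in\mathbb{R}$, $z_1,z_2\in\mathbb{R}^d$; and $E[\int_0^{S}|g(s,0,0)|^2ds]<\infty$. Under these assumptions the BSDE on $[0,S]$ with terminal condition in $L^2(\mathcal{F}_S)$ has a unique solution $(Y,Z)$ of adapted processes with $E[\int_0^S|Y_s|^2ds]<\infty$ and $E[\int_0^S|Z_s|^2ds]<\infty$. Inequalities between random variables are $P$-a.s. *)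

theory Defs
  imports "HOL-Probability.Probability"
begin

text \<open>A process is a function of time and sample point. It is a total function on the reals, but
  only its values on the time interval under consideration are constrained.\<close>

type_synonym ('w, 'b) process = "real \<Rightarrow> 'w \<Rightarrow> 'b"

definition natural_filtration ::
    "'w measure \<Rightarrow> ('w, 'b::topological_space) process \<Rightarrow> real \<Rightarrow> 'w measure" where
  "natural_filtration M X t =
     sigma (space M) (\<Union>u\<in>{0..t}. {X u -` A \<inter> space M | A. A \<in> sets borel})"

text \<open>\<open>null_sets M\<close> consists of the measurable null sets. On a complete space these are all the
  subsets of null sets, so the usual augmentation is obtained; completeness of \<open>M\<close> is not imposed,
  and in every case the augmented \<open>\<sigma>\<close>-algebras are contained in \<open>sets M\<close>.\<close>

definition augmented_filtration ::
    "'w measure \<Rightarrow> ('w, 'b::topological_space) process \<Rightarrow> real \<Rightarrow> 'w measure" where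
  "augmented_filtration M X t =
     sigma (space M) (sets (natural_filtration M X t) \<union> null_sets M)"

definition brownian_motion :: "'w measure \<Rightarrow> ('w, real ^ 'd) process \<Rightarrow> bool" where
  "brownian_motion M B \<longleftrightarrow>
     (\<forall>t\<ge>0. B t \<in> borel_measurable M) \<and>
     (AE \<omega> in M. B 0 \<omega> = 0) \<and>
     (AE \<omega> in M. continuous_on {0..} (\<lambda>t. B t \<omega>)) \<and>
     (\<forall>s t. 0 \<le> s \<and> s < t \<longrightarrow>
        prob_space.indep_set M (sets (natural_filtration M B s))
          (sets (vimage_algebra (space M) (\<lambda>\<omega>. B t \<omega> - B s \<omega>) borel)) \<and>
        prob_space.indep_vars M (\<lambda>_. borel) (\<lambda>i \<omega>. (B t \<omega> - B s \<omega>) $ i) UNIV \<and>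
        (\<forall>i. distributed M lborel (\<lambda>\<omega>. (B t \<omega> - B s \<omega>) $ i) (normal_density 0 (sqrt (t - s)))))"

text \<open>Adapted processes are understood to be jointly measurable in time and sample point as well.
  Progressive measurability is not required.\<close>

definition measurable_adapted ::
    "'w measure \<Rightarrow> (real \<Rightarrow> 'w measure) \<Rightarrow> real \<Rightarrow> ('w, 'b::topological_space) process \<Rightarrow> bool" where
  "measurable_adapted M F T X \<longleftrightarrow>
     (\<lambda>(\<omega>, s). X s \<omega>) \<in> borel_measurable (M \<Otimes>\<^sub>M restrict_space lborel {0..T}) \<and>
     (\<forall>t\<in>{0..T}. X t \<in> borel_measurable (F t))"

definition sq_norm_on ::
    "'w measure \<Rightarrow> real \<Rightarrow> real \<Rightarrow> ('w, 'b::real_normed_vector) process \<Rightarrow> ennreal" where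
  "sq_norm_on M a b X = (\<integral>\<^sup>+ \<omega>. (\<integral>\<^sup>+ s\<in>{a..b}. ennreal ((norm (X s \<omega>))\<^sup>2) \<partial>lborel) \<partial>M)"

definition L2_rv :: "'w measure \<Rightarrow> 'w measure \<Rightarrow> ('w \<Rightarrow> real) \<Rightarrow> bool" where
  "L2_rv M G \<xi> \<longleftrightarrow> \<xi> \<in> borel_measurable G \<and> integrable M (\<lambda>\<omega>. (\<xi> \<omega>)\<^sup>2)"

text \<open>The Ito integral of \<open>Z\<close> over \<open>[a, b]\<close> is the \<open>L\<^sup>2\<close>-limit of the elementary integrals of simple
  integrands that converge to \<open>Z\<close> in \<open>L\<^sup>2(dP \<times> dt)\<close>. It is a relation, since the limit is
  determined only up to null sets.\<close>

definition simple_integrand ::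
    "(real \<Rightarrow> 'w measure) \<Rightarrow> real \<Rightarrow> real \<Rightarrow> nat \<Rightarrow> (nat \<Rightarrow> real) \<Rightarrow> (nat \<Rightarrow> 'w \<Rightarrow> real ^ 'd) \<Rightarrow> bool" where
  "simple_integrand F a b n \<tau> h \<longleftrightarrow>
     a \<le> \<tau> 0 \<and> (\<forall>i<n. \<tau> i \<le> \<tau> (Suc i)) \<and> \<tau> n \<le> b \<and>
     (\<forall>i<n. h i \<in> borel_measurable (F (\<tau> i)) \<and> (\<exists>K. \<forall>\<omega>\<in>space (F (\<tau> i)). norm (h i \<omega>) \<le> K))"

definition simple_process ::
    "nat \<Rightarrow> (nat \<Rightarrow> real) \<Rightarrow> (nat \<Rightarrow> 'w \<Rightarrow> real ^ 'd) \<Rightarrow> ('w, real ^ 'd) process" where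
  "simple_process n \<tau> h s \<omega> = (\<Sum>i<n. indicator {\<tau> i<..\<tau> (Suc i)} s *\<^sub>R h i \<omega>)"

definition simple_integral ::
    "('w, real ^ 'd) process \<Rightarrow> nat \<Rightarrow> (nat \<Rightarrow> real) \<Rightarrow> (nat \<Rightarrow> 'w \<Rightarrow> real ^ 'd) \<Rightarrow> 'w \<Rightarrow> real" where
  "simple_integral B n \<tau> h \<omega> = (\<Sum>i<n. h i \<omega> \<bullet> (B (\<tau> (Suc i)) \<omega> - B (\<tau> i) \<omega>))"

definition has_ito_integral ::
    "'w measure \<Rightarrow> (real \<Rightarrow> 'w measure) \<Rightarrow> ('w, real ^ 'd) process \<Rightarrow> ('w, real ^ 'd) process \<Rightarrow>
     real \<Rightarrow> real \<Rightarrow> ('w \<Rightarrow> real) \<Rightarrow> bool" where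
  "has_ito_integral M F B Z a b J \<longleftrightarrow>
     J \<in> borel_measurable M \<and>
     (\<exists>n \<tau> h.
        (\<forall>k. simple_integrand F a b (n k) (\<tau> k) (h k)) \<and>
        (\<lambda>k. sq_norm_on M a b (\<lambda>s \<omega>. simple_process (n k) (\<tau> k) (h k) s \<omega> - Z s \<omega>))
          \<longlonglongrightarrow> 0 \<and>
        (\<lambda>k. \<integral>\<^sup>+ \<omega>. ennreal ((simple_integral B (n k) (\<tau> k) (h k) \<omega> - J \<omega>)\<^sup>2) \<partial>M)
          \<longlonglongrightarrow> 0)"

type_synonym ('w, 'd) driver = "real \<Rightarrow> 'w \<Rightarrow> real \<Rightarrow> real ^ 'd \<Rightarrow> real"

definition standard_driver ::
    "'w measure \<Rightarrow> (real \<Rightarrow> 'w measure) \<Rightarrow> real \<Rightarrow> ('w, 'd::finite) driver \<Rightarrow> bool" where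
  "standard_driver M F T g \<longleftrightarrow>
     (\<forall>y z. measurable_adapted M F T (\<lambda>s \<omega>. g s \<omega> y z)) \<and>
     (\<exists>C>0. AE (\<omega>, s) in M \<Otimes>\<^sub>M restrict_space lborel {0..T}. \<forall>y\<^sub>1 y\<^sub>2 z\<^sub>1 z\<^sub>2.
        \<bar>g s \<omega> y\<^sub>1 z\<^sub>1 - g s \<omega> y\<^sub>2 z\<^sub>2\<bar> \<le> C * (\<bar>y\<^sub>1 - y\<^sub>2\<bar> + norm (z\<^sub>1 - z\<^sub>2))) \<and>
     sq_norm_on M 0 T (\<lambda>s \<omega>. g s \<omega> 0 0) < \<infinity>"

text \<open>The time integral is taken with respect to \<open>lebesgue\<close> rather than \<open>lborel\<close>: a driver is only
  almost everywhere continuous in \<open>(y, z)\<close>, so along \<open>(Y, Z)\<close> it is Lebesgue measurable in time, but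
  possibly not Borel measurable. It is then integrable on \<open>[0, T]\<close> for almost all sample points, by
  the Lipschitz condition and square integrability.\<close>

definition bsde_solution ::
    "'w measure \<Rightarrow> (real \<Rightarrow> 'w measure) \<Rightarrow> ('w, real ^ 'd) process \<Rightarrow> real \<Rightarrow> ('w \<Rightarrow> real) \<Rightarrow>
     ('w, 'd::finite) driver \<Rightarrow> ('w, real) process \<Rightarrow> ('w, real ^ 'd) process \<Rightarrow> bool" where
  "bsde_solution M F B T \<xi> g Y Z \<longleftrightarrow>
     measurable_adapted M F T Y \<and> sq_norm_on M 0 T Y < \<infinity> \<and>
     measurable_adapted M F T Z \<and> sq_norm_on M 0 T Z < \<infinity> \<and>
     (\<forall>t\<in>{0..T}. \<exists>J. has_ito_integral M F B Z t T J \<and>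
        (AE \<omega> in M. Y t \<omega> = \<xi> \<omega> + (LINT s:{t..T}|lebesgue. g s \<omega> (Y s \<omega>) (Z s \<omega>)) - J \<omega>))"

end

theory Submission
  imports Defs
begin

text \<open>On \<open>[T\<^sub>1, T\<^sub>2]\<close> compare \<open>Y\<^sub>2\<close> with the constant process \<open>\<xi>\<^sub>1\<close>, then on \<open>[0, T\<^sub>1]\<close> compare \<open>Y\<^sub>2\<close> with
  \<open>Y\<^sub>1\<close>. In both cases the difference \<open>U\<close> satisfies \<open>U\<^sub>p = U\<^sub>q + \<integral> f ds - \<integral> V dB\<close> (integrals over \<open>[p, q]\<close>)
  with \<open>f \<ge> - C (\<bar>U\<bar> + \<bar>V\<bar>)\<close> and \<open>U \<ge> 0\<close> at the right end, and the claim is \<open>U \<ge> 0\<close>. Neither the Ito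
  formula nor Girsanov's theorem is needed: over a short interval \<open>(p, q]\<close> one tests the equation with
  \<open>W = U\<^sub>p\<^sup>-\<close> and with \<open>C W u \<bullet> (B\<^sub>q - B\<^sub>p)\<close>, where the \<open>F\<^sub>p\<close>-measurable unit vector \<open>u\<close> approximates
  \<open>V / \<bar>V\<bar>\<close>. By the Ito isometry the second test produces \<open>C W u \<bullet> V\<close>, which absorbs the term
  \<open>C W \<bar>V\<bar>\<close>. This gives \<open>(1 - K (q - p)) E (U\<^sub>p\<^sup>-)\<^sup>2 \<le> E (U\<^sub>q\<^sup>-)\<^sup>2\<close> up to errors that sum to something
  arbitrarily small over a fine partition.\<close>

section \<open>Square integrable functions\<close>

text \<open>A solution carries no path regularity: \<open>Y\<close> is only measurable and adapted,
  the equation holds a.s. at each fixed time, and the integrals for different starting times are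
  separate L2 limits. So the argument uses second moments at deterministic times only. The weight 1
  - x, with x = C u . (B_q - B_p), acts as a Girsanov density but may be negative. That hurts only
  where x > 1 and U_q >= 0; there x - 1 <= x^2, and since E x^4 is of order (q - p)^2, Young's
  inequality with weight q - p leaves errors of order (q - p) E W^2 and (q - p) E (U_q - U_p)^2. The
  remaining errors are summable because each is additive in the interval, or is q - p times
  something additive: the L2 distance of V from its step approximation, and the energy of U. A
  separate obstacle is that the driver inequalities hold off null sets depending on (s, y, z);
  Fubini and Lipschitz continuity make them hold for all (y, z) at almost every (omega, s), so that
  Y and Z may be inserted.\<close>

definition sq_integrable :: "'a measure \<Rightarrow> ('a \<Rightarrow> 'b::euclidean_space) \<Rightarrow> bool" where
  "sq_integrable N X \<longleftrightarrow> X \<in> borel_measurable N \<and> integrable N (\<lambda>x. (norm (X x))\<^sup>2)"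

lemma sq_integrableI:
  "X \<in> borel_measurable N \<Longrightarrow> integrable N (\<lambda>x. (norm (X x))\<^sup>2) \<Longrightarrow> sq_integrable N X"
  by (simp add: sq_integrable_def)

lemma sq_integrable_measurable[measurable_dest]:
  "sq_integrable N X \<Longrightarrow> X \<in> borel_measurable N"
  by (simp add: sq_integrable_def)

lemma sq_integrable_norm_sq: "sq_integrable N X \<Longrightarrow> integrable N (\<lambda>x. (norm (X x))\<^sup>2)"
  by (simp add: sq_integrable_def)

lemma sq_integrable_sq:
  fixes X :: "'a \<Rightarrow> real"
  shows "sq_integrable N X \<Longrightarrow> integrable N (\<lambda>x. (X x)\<^sup>2)"
  by (simp add: sq_integrable_def)

lemma sq_integrable_bound:
  assumes "sq_integrable N Y" "X \<in> borel_measurable N" "AE x in N. norm (X x) \<le> c * norm (Y x)"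
  shows "sq_integrable N X"
proof (rule sq_integrableI)
  have [measurable]: "X \<in> borel_measurable N" by fact
  show "integrable N (\<lambda>x. (norm (X x))\<^sup>2)"
  proof (rule Bochner_Integration.integrable_bound)
    show "integrable N (\<lambda>x. c\<^sup>2 * (norm (Y x))\<^sup>2)"
      using sq_integrable_norm_sq[OF assms(1)] by simp
    show "AE x in N. norm ((norm (X x))\<^sup>2) \<le> norm (c\<^sup>2 * (norm (Y x))\<^sup>2)"
      using assms(3)
    proof eventually_elim
      fix x assume "norm (X x) \<le> c * norm (Y x)"
      then have "(norm (X x))\<^sup>2 \<le> (c * norm (Y x))\<^sup>2" by (intro power_mono) auto
      then show "norm ((norm (X x))\<^sup>2) \<le> norm (c\<^sup>2 * (norm (Y x))\<^sup>2)"
        by (simp add: power_mult_distrib)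
    qed
  qed measurable
qed fact

lemma sq_integrable_norm:
  "sq_integrable N X \<Longrightarrow> sq_integrable N (\<lambda>x. norm (X x))"
  by (auto simp: sq_integrable_def)

lemma sq_integrable_scaleR:
  "sq_integrable N X \<Longrightarrow> sq_integrable N (\<lambda>x. c *\<^sub>R X x)"
  by (rule sq_integrable_bound[where Y=X and c="\<bar>c\<bar>"]) (auto dest: sq_integrable_measurable)

lemma sq_integrable_zero: "sq_integrable N (\<lambda>x. 0)"
  by (simp add: sq_integrable_def)

lemma inner_le_half_squares:
  fixes x y :: "'b::real_inner"
  shows "\<bar>x \<bullet> y\<bar> \<le> ((norm x)\<^sup>2 + (norm y)\<^sup>2) / 2"
proof -
  have "\<bar>x \<bullet> y\<bar> \<le> norm x * norm y" by (rule Cauchy_Schwarz_ineq2)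
  moreover have "0 \<le> (norm x - norm y)\<^sup>2" by simp
  ultimately show ?thesis by (simp add: power2_diff)
qed

lemma norm_add_sq_le:
  fixes x y :: "'b::real_inner"
  shows "(norm (x + y))\<^sup>2 \<le> 2 * (norm x)\<^sup>2 + 2 * (norm y)\<^sup>2"
proof -
  have "(norm (x + y))\<^sup>2 = (norm x)\<^sup>2 + (norm y)\<^sup>2 + 2 * (x \<bullet> y)"
    by (simp add: power2_norm_eq_inner inner_add_left inner_add_right inner_commute)
  then show ?thesis using inner_le_half_squares[of x y] by (simp add: abs_le_iff)
qed

lemma sq_integrable_add:
  assumes "sq_integrable N X" "sq_integrable N Y"
  shows "sq_integrable N (\<lambda>x. X x + Y x)"
proof (rule sq_integrableI)
  note [measurable] = assms[THEN sq_integrable_measurable]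
  show "(\<lambda>x. X x + Y x) \<in> borel_measurable N" by measurable
  show "integrable N (\<lambda>x. (norm (X x + Y x))\<^sup>2)"
    by (rule Bochner_Integration.integrable_bound[where f="\<lambda>x. 2 * (norm (X x))\<^sup>2 + 2 * (norm (Y x))\<^sup>2"])
      (use assms[THEN sq_integrable_norm_sq] norm_add_sq_le in \<open>auto intro!: AE_I2\<close>)
qed

lemma sq_integrable_diff:
  assumes "sq_integrable N X" "sq_integrable N Y"
  shows "sq_integrable N (\<lambda>x. X x - Y x)"
  using sq_integrable_add[OF assms(1) sq_integrable_scaleR[OF assms(2), of "-1"]] by simp

lemma sq_integrable_sum:
  "(\<And>i. i \<in> I \<Longrightarrow> sq_integrable N (X i)) \<Longrightarrow> sq_integrable N (\<lambda>x. \<Sum>i\<in>I. X i x)"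
  by (induction I rule: infinite_finite_induct) (auto simp: sq_integrable_zero sq_integrable_add)

lemma integrable_inner_sq:
  assumes "sq_integrable N X" "sq_integrable N Y"
  shows "integrable N (\<lambda>x. X x \<bullet> Y x)"
proof (rule Bochner_Integration.integrable_bound)
  note [measurable] = assms[THEN sq_integrable_measurable]
  show "integrable N (\<lambda>x. ((norm (X x))\<^sup>2 + (norm (Y x))\<^sup>2) / 2)"
    using assms[THEN sq_integrable_norm_sq] by simp
  show "AE x in N. norm (X x \<bullet> Y x) \<le> norm (((norm (X x))\<^sup>2 + (norm (Y x))\<^sup>2) / 2)"
    using inner_le_half_squares by (auto simp: real_norm_def simp del: abs_divide)
qed (use assms[THEN sq_integrable_measurable] in measurable)

lemma integrable_mult_sq:
  fixes X Y :: "'a \<Rightarrow> real"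
  assumes "sq_integrable N X" "sq_integrable N Y"
  shows "integrable N (\<lambda>x. X x * Y x)"
  using integrable_inner_sq[OF assms] by simp

text \<open>The second moment of X + t Y is a quadratic polynomial in t that is never negative; one
  suitable t bounds its coefficients.\<close>

lemma Cauchy_Schwarz_integral:
  assumes X: "sq_integrable N X" and Y: "sq_integrable N Y"
  shows "(\<integral>x. X x \<bullet> Y x \<partial>N)\<^sup>2 \<le> (\<integral>x. (norm (X x))\<^sup>2 \<partial>N) * (\<integral>x. (norm (Y x))\<^sup>2 \<partial>N)"
proof -
  define a b c where "a = (\<integral>x. (norm (X x))\<^sup>2 \<partial>N)" "b = (\<integral>x. X x \<bullet> Y x \<partial>N)" "c = (\<integral>x. (norm (Y x))\<^sup>2 \<partial>N)"
  note i = sq_integrable_norm_sq[OF X] sq_integrable_norm_sq[OF Y]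
    integrable_inner_sq[OF X Y]
  have q: "0 \<le> a + 2 * t * b + t\<^sup>2 * c" for t
  proof -
    have "0 \<le> (\<integral>x. (norm (X x + t *\<^sub>R Y x))\<^sup>2 \<partial>N)" by simp
    also have "\<dots> = (\<integral>x. (norm (X x))\<^sup>2 + 2 * t * (X x \<bullet> Y x) + t\<^sup>2 * (norm (Y x))\<^sup>2 \<partial>N)"
      by (intro Bochner_Integration.integral_cong refl)
        (simp only: power2_norm_eq_inner, simp add: inner_add_left inner_add_right inner_commute power2_eq_square algebra_simps)
    also have "\<dots> = a + 2 * t * b + t\<^sup>2 * c" using i by (simp add: a_b_c_def)
    finally show ?thesis .
  qed
  have nn: "0 \<le> a" "0 \<le> c" by (auto simp: a_b_c_def)
  have "b\<^sup>2 \<le> a * c"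
  proof (cases "c = 0")
    case True
    then have *: "0 \<le> a + 2 * t * b" for t using q[of t] by simp
    have "b = 0"
    proof (rule ccontr)
      assume "b \<noteq> 0"
      \<comment> \<open>At this \<open>t\<close> the affine function has the value -1.\<close>
      then show False using *[of "- (a + 1) / (2 * b)"] by (simp add: field_simps)
    qed
    then show ?thesis using nn by simp
  next
    case False
    then have "c > 0" using nn by simp
    \<comment> \<open>The minimiser of the quadratic.\<close>
    then show ?thesis using q[of "- b / c"] by (simp add: field_simps power2_eq_square)
  qed
  then show ?thesis by (simp add: a_b_c_def)
qed

lemma sq_integrable_of_nn_close:
  assumes "sq_integrable N X" "Y \<in> borel_measurable N"
    "(\<integral>\<^sup>+x. ennreal ((norm (X x - Y x))\<^sup>2) \<partial>N) < \<infinity>"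
  shows "sq_integrable N Y"
proof -
  note [measurable] = sq_integrable_measurable[OF assms(1)] assms(2)
  have "sq_integrable N (\<lambda>x. X x - Y x)"
    by (intro sq_integrableI integrableI_bounded) (use assms(3) in auto)
  from sq_integrable_diff[OF assms(1) this] show ?thesis by simp
qed

text \<open>Strong L2 convergence implies weak convergence, by Cauchy-Schwarz. This is how
  identities for simple integrands pass to Ito integrals. The square integrability of
  \<open>L\<close> comes out because some \<open>X k\<close> lies at distance less than 1 from
  it.\<close>

lemma integral_inner_tendsto:
  assumes X: "\<And>k. sq_integrable N (X k)" and L: "L \<in> borel_measurable N"
    and lim: "(\<lambda>k. \<integral>\<^sup>+x. ennreal ((norm (X k x - L x))\<^sup>2) \<partial>N) \<longlonglongrightarrow> 0"
    and Y: "sq_integrable N Y"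
  shows "(\<lambda>k. \<integral>x. Y x \<bullet> X k x \<partial>N) \<longlonglongrightarrow> (\<integral>x. Y x \<bullet> L x \<partial>N)" "sq_integrable N L"
proof -
  note [measurable] = sq_integrable_measurable[OF X] L
  have "\<forall>\<^sub>F k in sequentially. (\<integral>\<^sup>+x. ennreal ((norm (X k x - L x))\<^sup>2) \<partial>N) < 1"
    using lim by (rule order_tendstoD) simp
  then obtain k where "(\<integral>\<^sup>+x. ennreal ((norm (X k x - L x))\<^sup>2) \<partial>N) < 1"
    by (meson eventually_sequentially order_refl)
  then show L2: "sq_integrable N L"
    using sq_integrable_of_nn_close[OF X L, of k] using ennreal_one_less_top less_trans by (fastforce simp: infinity_ennreal_def)
  have d: "sq_integrable N (\<lambda>x. X k x - L x)" for k by (intro sq_integrable_diff X L2)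
  have eq: "(\<integral>\<^sup>+x. ennreal ((norm (X k x - L x))\<^sup>2) \<partial>N) = ennreal (\<integral>x. (norm (X k x - L x))\<^sup>2 \<partial>N)" for k
    by (intro nn_integral_eq_integral sq_integrable_norm_sq d) auto
  have lim': "(\<lambda>k. \<integral>x. (norm (X k x - L x))\<^sup>2 \<partial>N) \<longlonglongrightarrow> 0"
    using lim unfolding eq by (simp add: ennreal_tendsto_0_iff)
  have "(\<lambda>k. (\<integral>x. Y x \<bullet> (X k x - L x) \<partial>N)\<^sup>2) \<longlonglongrightarrow> 0"
  proof (rule tendsto_sandwich[where f="\<lambda>_. 0"])
    show "\<forall>\<^sub>F k in sequentially. (\<integral>x. Y x \<bullet> (X k x - L x) \<partial>N)\<^sup>2
        \<le> (\<integral>x. (norm (Y x))\<^sup>2 \<partial>N) * (\<integral>x. (norm (X k x - L x))\<^sup>2 \<partial>N)"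
      using Cauchy_Schwarz_integral[OF Y d] by simp
    show "(\<lambda>k. (\<integral>x. (norm (Y x))\<^sup>2 \<partial>N) * (\<integral>x. (norm (X k x - L x))\<^sup>2 \<partial>N)) \<longlonglongrightarrow> 0"
      using tendsto_mult_left[OF lim'] by simp
  qed auto
  then have "(\<lambda>k. (\<integral>x. Y x \<bullet> (X k x - L x) \<partial>N)) \<longlonglongrightarrow> 0"
    by (simp add: tendsto_power_zero power_tendsto_0_iff)
  moreover have "(\<integral>x. Y x \<bullet> (X k x - L x) \<partial>N) = (\<integral>x. Y x \<bullet> X k x \<partial>N) - (\<integral>x. Y x \<bullet> L x \<partial>N)" for k
    unfolding inner_diff_right
    by (intro Bochner_Integration.integral_diff integrable_inner_sq Y X L2)
  ultimately show "(\<lambda>k. \<integral>x. Y x \<bullet> X k x \<partial>N) \<longlonglongrightarrow> (\<integral>x. Y x \<bullet> L x \<partial>N)"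
    by (simp add: LIM_zero_iff)
qed

section \<open>Brownian motion and its augmented filtration\<close>

locale brownian_space = prob_space M for M :: "'w measure" +
  fixes B :: "('w, real ^ 'd) process"
  assumes brownian: "brownian_motion M B"
begin

abbreviation F :: "real \<Rightarrow> 'w measure" where "F \<equiv> augmented_filtration M B"

lemma B_measurable: "0 \<le> t \<Longrightarrow> B t \<in> borel_measurable M"
  using brownian by (simp add: brownian_motion_def)

lemma space_natural: "space (natural_filtration M B t) = space M"
  unfolding natural_filtration_def by (rule space_measure_of) auto

lemma sets_natural:
  "sets (natural_filtration M B t) =
    sigma_sets (space M) (\<Union>u\<in>{0..t}. {B u -` A \<inter> space M | A. A \<in> sets borel})"
  unfolding natural_filtration_def by (rule sets_measure_of) auto

lemma sets_natural_subset: "sets (natural_filtration M B t) \<subseteq> events"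
  unfolding sets_natural
  by (rule sets.sigma_sets_subset) (auto intro: measurable_sets[OF B_measurable])

lemma augmented_generator: "sets (natural_filtration M B t) \<union> null_sets M \<subseteq> Pow (space M)"
proof (rule Un_least)
  show "sets (natural_filtration M B t) \<subseteq> Pow (space M)"
    by (rule order_trans[OF sets_natural_subset sets.space_closed])
  show "null_sets M \<subseteq> Pow (space M)" using sets.space_closed null_setsD2 by blast
qed

lemma space_F: "space (F t) = space M"
  unfolding augmented_filtration_def by (rule space_measure_of[OF augmented_generator])

lemma sets_F: "sets (F t) = sigma_sets (space M) (sets (natural_filtration M B t) \<union> null_sets M)"
  unfolding augmented_filtration_def by (rule sets_measure_of[OF augmented_generator])

lemma sets_F_subset: "sets (F t) \<subseteq> events"
  unfolding sets_F by (rule sets.sigma_sets_subset) (use sets_natural_subset in auto)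

lemma subalgebra_F: "subalgebra M (F t)"
  by (simp add: subalgebra_def space_F sets_F_subset)

lemma measurable_F_M: "X \<in> borel_measurable (F t) \<Longrightarrow> X \<in> borel_measurable M"
  using subalgebra_F measurable_from_subalg by blast

lemma sets_F_mono: "s \<le> t \<Longrightarrow> sets (F s) \<subseteq> sets (F t)"
  unfolding sets_F sets_natural
  by (intro sigma_sets_mono' Un_mono UN_mono order_refl) simp

lemma measurable_F_mono: "X \<in> borel_measurable (F s) \<Longrightarrow> s \<le> t \<Longrightarrow> X \<in> borel_measurable (F t)"
  by (rule measurable_from_subalg[rotated]) (auto simp: subalgebra_def space_F intro: subsetD[OF sets_F_mono])

lemma B_measurable_F:
  assumes "0 \<le> s" "s \<le> t"
  shows "B s \<in> borel_measurable (F t)"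
proof (rule measurableI)
  fix A :: "(real ^ 'd) set" assume "A \<in> sets borel"
  then have "B s -` A \<inter> space M \<in> sets (natural_filtration M B t)"
    unfolding sets_natural using assms by (intro sigma_sets.Basic UN_I[of s]) auto
  then show "B s -` A \<inter> space (F t) \<in> sets (F t)"
    unfolding space_F sets_F by (intro sigma_sets.Basic) auto
qed auto

text \<open>Being a.s. equal to a natural event holds for the generators, a null set being a.s.
  empty, and is stable under complements and countable unions. It carries independence, which
  \<open>brownian_motion\<close> states for the natural filtration, over to
  \<open>F\<close>.\<close>

lemma augmented_AE_natural:
  assumes "A \<in> sets (F t)"
  shows "\<exists>A'\<in>sets (natural_filtration M B t). AE \<omega> in M. \<omega> \<in> A \<longleftrightarrow> \<omega> \<in> A'"
  using assms unfolding sets_F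
proof (induction rule: sigma_sets.induct)
  case (Basic A)
  then show ?case
  proof
    assume "A \<in> null_sets M"
    then have "AE \<omega> in M. \<omega> \<notin> A" by (rule AE_not_in)
    then show ?thesis by (intro bexI[of _ "{}"]) auto
  qed auto
next
  case Empty
  then show ?case by (intro bexI[of _ "{}"]) auto
next
  case (Compl A)
  then obtain A' where A': "A' \<in> sets (natural_filtration M B t)" "AE \<omega> in M. \<omega> \<in> A \<longleftrightarrow> \<omega> \<in> A'"
    by blast
  have "space M - A' \<in> sets (natural_filtration M B t)"
    using sets.compl_sets[OF A'(1)] by (simp add: space_natural)
  then show ?case using A'(2) by (intro bexI[of _ "space M - A'"]) auto
next
  case (Union A)
  then obtain A' where A': "\<And>i::nat. A' i \<in> sets (natural_filtration M B t)"
      "\<And>i. AE \<omega> in M. \<omega> \<in> A i \<longleftrightarrow> \<omega> \<in> A' i"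
    by metis
  have "AE \<omega> in M. \<forall>i. \<omega> \<in> A i \<longleftrightarrow> \<omega> \<in> A' i"
    using A'(2) by (simp add: AE_all_countable)
  then have "AE \<omega> in M. \<omega> \<in> (\<Union>i. A i) \<longleftrightarrow> \<omega> \<in> (\<Union>i. A' i)"
    by (rule AE_mp) (intro AE_I2 impI, blast)
  moreover have "(\<Union>i. A' i) \<in> sets (natural_filtration M B t)"
    using A'(1) by (intro sets.countable_UN) auto
  ultimately show ?case by blast
qed

lemma indep_increment:
  assumes "0 \<le> s" "s < t"
  shows "indep_set (sets (F s)) (sets (vimage_algebra (space M) (\<lambda>\<omega>. B t \<omega> - B s \<omega>) borel))"
proof -
  have i: "indep_set (sets (natural_filtration M B s))
      (sets (vimage_algebra (space M) (\<lambda>\<omega>. B t \<omega> - B s \<omega>) borel))"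
    using brownian assms by (simp add: brownian_motion_def)
  have ev: "sets (vimage_algebra (space M) (\<lambda>\<omega>. B t \<omega> - B s \<omega>) borel) \<subseteq> events"
    using indep_setD_ev2[OF i] .
  show ?thesis
  proof (rule indep_setI)
    fix a b assume a: "a \<in> sets (F s)" and b: "b \<in> sets (vimage_algebra (space M) (\<lambda>\<omega>. B t \<omega> - B s \<omega>) borel)"
    obtain a' where a': "a' \<in> sets (natural_filtration M B s)" "AE \<omega> in M. \<omega> \<in> a \<longleftrightarrow> \<omega> \<in> a'"
      using augmented_AE_natural[OF a] by blast
    have [measurable]: "a \<in> events" "a' \<in> events" "b \<in> events"
      using subsetD[OF sets_F_subset a] subsetD[OF sets_natural_subset a'(1)] subsetD[OF ev b] by auto
    have "prob (a \<inter> b) = prob (a' \<inter> b)"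
      by (rule finite_measure_eq_AE) (use a'(2) in auto)
    also have "\<dots> = prob a' * prob b" using indep_setD[OF i a'(1) b] .
    also have "prob a' = prob a"
      by (rule finite_measure_eq_AE) (use a'(2) in auto)
    finally show "prob (a \<inter> b) = prob a * prob b" .
  qed (use ev sets_F_subset in auto)
qed

lemma increment_measurable:
  "0 \<le> s \<Longrightarrow> s \<le> t \<Longrightarrow> (\<lambda>\<omega>. B t \<omega> - B s \<omega>) \<in> borel_measurable M"
  by (intro borel_measurable_diff B_measurable) auto

text \<open>\<open>X\<close> is known at time \<open>s\<close> and the increment is independent of
  \<open>F s\<close>, so the expectation factors. The case \<open>s = t\<close> stands apart because
  \<open>brownian_motion\<close> speaks of \<open>s < t\<close> only; there the increment is 0 and
  \<phi> contributes a constant.\<close>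

lemma
  fixes X :: "'w \<Rightarrow> real" and \<phi> :: "real ^ 'd \<Rightarrow> real"
  assumes st: "0 \<le> s" "s \<le> t"
    and X: "X \<in> borel_measurable (F s)" "integrable M X"
    and \<phi>[measurable]: "\<phi> \<in> borel_measurable borel" and i\<phi>: "integrable M (\<lambda>\<omega>. \<phi> (B t \<omega> - B s \<omega>))"
  shows integrable_mult_increment: "integrable M (\<lambda>\<omega>. X \<omega> * \<phi> (B t \<omega> - B s \<omega>))"
    and integral_mult_increment:
      "(\<integral>\<omega>. X \<omega> * \<phi> (B t \<omega> - B s \<omega>) \<partial>M) = (\<integral>\<omega>. X \<omega> \<partial>M) * (\<integral>\<omega>. \<phi> (B t \<omega> - B s \<omega>) \<partial>M)"
proof -
  have "integrable M (\<lambda>\<omega>. X \<omega> * \<phi> (B t \<omega> - B s \<omega>)) \<and>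
      (\<integral>\<omega>. X \<omega> * \<phi> (B t \<omega> - B s \<omega>) \<partial>M) = (\<integral>\<omega>. X \<omega> \<partial>M) * (\<integral>\<omega>. \<phi> (B t \<omega> - B s \<omega>) \<partial>M)"
  proof (cases "s = t")
    case True
    then show ?thesis using X(2) by (simp add: prob_space)
  next
    case False
    note [measurable] = increment_measurable[OF st]
    have "indep_var borel X borel (\<lambda>\<omega>. \<phi> (B t \<omega> - B s \<omega>))"
      unfolding indep_var_eq
    proof (intro conjI)
      show "random_variable borel X" using X(2) by auto
      show "random_variable borel (\<lambda>\<omega>. \<phi> (B t \<omega> - B s \<omega>))" by measurable
      have 1: "sigma_sets (space M) {X -` A \<inter> space M |A. A \<in> sets borel} \<subseteq> sets (F s)"
        unfolding space_F[of s, symmetric]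
        by (rule sets.sigma_sets_subset) (use measurable_sets[OF X(1)] in auto)
      have 2: "sigma_sets (space M) {(\<lambda>\<omega>. \<phi> (B t \<omega> - B s \<omega>)) -` A \<inter> space M |A. A \<in> sets borel}
          \<subseteq> sets (vimage_algebra (space M) (\<lambda>\<omega>. B t \<omega> - B s \<omega>) borel)"
        unfolding sets_vimage_algebra
      proof (rule sigma_sets_mono', safe)
        fix A :: "real set" assume "A \<in> sets borel"
        then have "\<phi> -` A \<in> sets borel" using measurable_sets[OF \<phi>, of A] by simp
        then show "\<exists>A'. (\<lambda>\<omega>. \<phi> (B t \<omega> - B s \<omega>)) -` A \<inter> space M = (\<lambda>\<omega>. B t \<omega> - B s \<omega>) -` A' \<inter> space M \<and> A' \<in> sets borel"
          by (intro exI[of _ "\<phi> -` A"]) auto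
      qed
      show "indep_set (sigma_sets (space M) {X -` A \<inter> space M |A. A \<in> sets borel})
          (sigma_sets (space M) {(\<lambda>\<omega>. \<phi> (B t \<omega> - B s \<omega>)) -` A \<inter> space M |A. A \<in> sets borel})"
      proof (rule indep_setI)
        have i: "indep_set (sets (F s)) (sets (vimage_algebra (space M) (\<lambda>\<omega>. B t \<omega> - B s \<omega>) borel))"
          using st False by (intro indep_increment) auto
        show "sigma_sets (space M) {X -` A \<inter> space M |A. A \<in> sets borel} \<subseteq> events"
          using 1 indep_setD_ev1[OF i] by (rule order_trans)
        show "sigma_sets (space M) {(\<lambda>\<omega>. \<phi> (B t \<omega> - B s \<omega>)) -` A \<inter> space M |A. A \<in> sets borel} \<subseteq> events"
          using 2 indep_setD_ev2[OF i] by (rule order_trans)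
      qed (rule indep_setD[OF indep_increment[of s t] subsetD[OF 1] subsetD[OF 2]], use st False in auto)
    qed
    from indep_var_lebesgue_integral[OF this X(2) i\<phi>] indep_var_integrable[OF this X(2) i\<phi>]
    show ?thesis by simp
  qed
  then show "integrable M (\<lambda>\<omega>. X \<omega> * \<phi> (B t \<omega> - B s \<omega>))"
    "(\<integral>\<omega>. X \<omega> * \<phi> (B t \<omega> - B s \<omega>) \<partial>M) = (\<integral>\<omega>. X \<omega> \<partial>M) * (\<integral>\<omega>. \<phi> (B t \<omega> - B s \<omega>) \<partial>M)"
    by auto
qed

section \<open>Moments and covariances of Brownian increments\<close>

lemma increment_moments:
  assumes st: "0 \<le> s" "s \<le> t"
  shows "integrable M (\<lambda>\<omega>. ((B t \<omega> - B s \<omega>) $ i) ^ k)"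
    and "(\<integral>\<omega>. (B t \<omega> - B s \<omega>) $ i \<partial>M) = 0"
    and "(\<integral>\<omega>. ((B t \<omega> - B s \<omega>) $ i)\<^sup>2 \<partial>M) = t - s"
    and "(\<integral>\<omega>. ((B t \<omega> - B s \<omega>) $ i) ^ 4 \<partial>M) = 3 * (t - s)\<^sup>2"
proof -
  have "integrable M (\<lambda>\<omega>. ((B t \<omega> - B s \<omega>) $ i) ^ k) \<and> (\<integral>\<omega>. (B t \<omega> - B s \<omega>) $ i \<partial>M) = 0 \<and>
     (\<integral>\<omega>. ((B t \<omega> - B s \<omega>) $ i)\<^sup>2 \<partial>M) = t - s \<and> (\<integral>\<omega>. ((B t \<omega> - B s \<omega>) $ i) ^ 4 \<partial>M) = 3 * (t - s)\<^sup>2"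
  proof (cases "s = t")
    case True
    then show ?thesis by simp
  next
    case False
    define \<sigma> where "\<sigma> = sqrt (t - s)"
    have \<sigma>: "\<sigma> > 0" "\<sigma>\<^sup>2 = t - s" using False st by (auto simp: \<sigma>_def)
    have D: "distributed M lborel (\<lambda>\<omega>. (B t \<omega> - B s \<omega>) $ i) (normal_density 0 \<sigma>)"
      using brownian[unfolded brownian_motion_def] st False unfolding \<sigma>_def by simp
    have m: "(\<integral>\<omega>. ((B t \<omega> - B s \<omega>) $ i) ^ k \<partial>M) = (\<integral>x. normal_density 0 \<sigma> x * x ^ k \<partial>lborel)" for k
      by (subst distributed_integral[OF D]) auto
    have "integrable M (\<lambda>\<omega>. ((B t \<omega> - B s \<omega>) $ i) ^ k)"
      using integrable_normal_moment[OF \<sigma>(1), of 0 k] by (subst distributed_integrable[OF D, symmetric]) auto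
    moreover have "(\<integral>\<omega>. (B t \<omega> - B s \<omega>) $ i \<partial>M) = 0"
      using m[of 1] integral_normal_moment_odd[OF \<sigma>(1), of 0 0] by simp
    moreover have "(\<integral>\<omega>. ((B t \<omega> - B s \<omega>) $ i)\<^sup>2 \<partial>M) = t - s"
      using m[of 2] integral_normal_moment_even[OF \<sigma>(1), of 0 1] \<sigma>(2) by simp
    moreover have "(\<integral>\<omega>. ((B t \<omega> - B s \<omega>) $ i) ^ 4 \<partial>M) = 3 * (t - s)\<^sup>2"
      using m[of 4] integral_normal_moment_even[OF \<sigma>(1), of 0 2] \<sigma>(2) by (simp add: fact_numeral power_divide)
    ultimately show ?thesis by blast
  qed
  then show "integrable M (\<lambda>\<omega>. ((B t \<omega> - B s \<omega>) $ i) ^ k)"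
    and "(\<integral>\<omega>. (B t \<omega> - B s \<omega>) $ i \<partial>M) = 0"
    and "(\<integral>\<omega>. ((B t \<omega> - B s \<omega>) $ i)\<^sup>2 \<partial>M) = t - s"
    and "(\<integral>\<omega>. ((B t \<omega> - B s \<omega>) $ i) ^ 4 \<partial>M) = 3 * (t - s)\<^sup>2" by blast+
qed

lemma increment_component_measurable:
  "0 \<le> s \<Longrightarrow> s \<le> t \<Longrightarrow> (\<lambda>\<omega>. (B t \<omega> - B s \<omega>) $ i) \<in> borel_measurable M"
  using measurable_compose[OF increment_measurable borel_measurable_nth] by simp

lemma increment_integrable:
  "0 \<le> s \<Longrightarrow> s \<le> t \<Longrightarrow> integrable M (\<lambda>\<omega>. (B t \<omega> - B s \<omega>) $ i)"
  using increment_moments(1)[where k=1] by simp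

lemma increment_sq_integrable:
  "0 \<le> s \<Longrightarrow> s \<le> t \<Longrightarrow> sq_integrable M (\<lambda>\<omega>. (B t \<omega> - B s \<omega>) $ i)"
  using increment_moments(1)[where k=2] increment_component_measurable by (simp add: sq_integrable_def)

lemma increment_cross:
  assumes "0 \<le> s" "s \<le> t"
  shows "integrable M (\<lambda>\<omega>. (B t \<omega> - B s \<omega>) $ i * (B t \<omega> - B s \<omega>) $ j)"
    and "(\<integral>\<omega>. (B t \<omega> - B s \<omega>) $ i * (B t \<omega> - B s \<omega>) $ j \<partial>M) = (if i = j then t - s else 0)"
proof -
  show "integrable M (\<lambda>\<omega>. (B t \<omega> - B s \<omega>) $ i * (B t \<omega> - B s \<omega>) $ j)"
    using assms by (intro integrable_mult_sq increment_sq_integrable)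
  show "(\<integral>\<omega>. (B t \<omega> - B s \<omega>) $ i * (B t \<omega> - B s \<omega>) $ j \<partial>M) = (if i = j then t - s else 0)"
  proof (cases "i = j \<or> s = t")
    case True
    then show ?thesis using increment_moments(3)[OF assms, of i] by (auto simp: power2_eq_square)
  next
    case False
    have "indep_vars (\<lambda>_. borel) (\<lambda>i \<omega>. (B t \<omega> - B s \<omega>) $ i) UNIV"
      using brownian[unfolded brownian_motion_def] assms False by simp
    then have "indep_vars (\<lambda>_. borel) (\<lambda>i \<omega>. (B t \<omega> - B s \<omega>) $ i) {i, j}"
      by (rule indep_vars_subset) auto
    then have "(\<integral>\<omega>. (\<Prod>i\<in>{i, j}. (B t \<omega> - B s \<omega>) $ i) \<partial>M) = (\<Prod>i\<in>{i, j}. \<integral>\<omega>. (B t \<omega> - B s \<omega>) $ i \<partial>M)"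
      using assms by (intro indep_vars_lebesgue_integral increment_integrable) auto
    then show ?thesis using False increment_moments(2)[OF assms] by auto
  qed
qed

end

lemma (in finite_measure) sq_integrable_integrable:
  fixes X :: "'a \<Rightarrow> real"
  shows "sq_integrable M X \<Longrightarrow> integrable M X"
  by (rule square_integrable_imp_integrable) (auto simp: sq_integrable_def)

lemma (in finite_measure) sq_integrable_of_bounded:
  assumes "h \<in> borel_measurable M" "\<And>x. x \<in> space M \<Longrightarrow> norm (h x) \<le> K"
  shows "sq_integrable M h"
  by (rule sq_integrable_bound[where Y="\<lambda>_. 1 :: real" and c=K])
    (use assms in \<open>auto simp: sq_integrable_def\<close>)

context brownian_space begin

lemma increment_norm_sq:
  fixes s t :: real
  assumes "0 \<le> s" "s \<le> t"
  shows "has_bochner_integral M (\<lambda>\<omega>. (norm (B t \<omega> - B s \<omega>))\<^sup>2) (CARD('d) * (t - s))"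
proof -
  have "has_bochner_integral M (\<lambda>\<omega>. \<Sum>i\<in>UNIV. ((B t \<omega> - B s \<omega>) $ i)\<^sup>2) (\<Sum>i\<in>(UNIV::'d set). t - s)"
    by (rule has_bochner_integral_sum) (use increment_moments[OF assms] in \<open>auto simp: has_bochner_integral_iff\<close>)
  then show ?thesis by (simp add: norm_vec_def L2_set_def sum_nonneg)
qed

lemma increment_sq_integrable_vec:
  "0 \<le> s \<Longrightarrow> s \<le> t \<Longrightarrow> sq_integrable M (\<lambda>\<omega>. B t \<omega> - B s \<omega>)"
  using increment_norm_sq increment_measurable by (simp add: sq_integrable_def has_bochner_integral_iff)

text \<open>The square of a sum of d terms is at most d times the sum of the squares; here the terms
  are the squared components, whose second moments are 3 (t - s)^2. The order (t - s)^2 matters: it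
  survives a division by t - s in the one-step estimate.\<close>

lemma increment_norm_4:
  fixes s t :: real
  assumes "0 \<le> s" "s \<le> t"
  shows "integrable M (\<lambda>\<omega>. norm (B t \<omega> - B s \<omega>) ^ 4)"
    and "(\<integral>\<omega>. norm (B t \<omega> - B s \<omega>) ^ 4 \<partial>M) \<le> 3 * (CARD('d))\<^sup>2 * (t - s)\<^sup>2"
proof -
  let ?D = "\<lambda>i \<omega>. (B t \<omega> - B s \<omega>) $ i"
  have le: "norm (B t \<omega> - B s \<omega>) ^ 4 \<le> CARD('d) * (\<Sum>i\<in>UNIV. ?D i \<omega> ^ 4)" for \<omega>
  proof -
    have "norm (B t \<omega> - B s \<omega>) ^ 4 = (\<Sum>i\<in>UNIV. (?D i \<omega>)\<^sup>2)\<^sup>2"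
    proof -
      have "(norm (B t \<omega> - B s \<omega>))\<^sup>2 = (\<Sum>i\<in>UNIV. (?D i \<omega>)\<^sup>2)" by (simp add: norm_vec_def L2_set_def sum_nonneg)
      moreover have "norm (B t \<omega> - B s \<omega>) ^ 4 = ((norm (B t \<omega> - B s \<omega>))\<^sup>2)\<^sup>2" by simp
      ultimately show ?thesis by simp
    qed
    also have "\<dots> \<le> (\<Sum>i\<in>(UNIV::'d set). 1\<^sup>2) * (\<Sum>i\<in>UNIV. ((?D i \<omega>)\<^sup>2)\<^sup>2)"
      using Cauchy_Schwarz_ineq_sum[of "\<lambda>_. 1" "\<lambda>i. (?D i \<omega>)\<^sup>2" UNIV] by simp
    finally show ?thesis by simp
  qed
  have s: "has_bochner_integral M (\<lambda>\<omega>. CARD('d) * (\<Sum>i\<in>UNIV. ?D i \<omega> ^ 4)) (CARD('d) * (\<Sum>i\<in>(UNIV::'d set). 3 * (t - s)\<^sup>2))"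
    by (intro has_bochner_integral_mult_right has_bochner_integral_sum)
      (use increment_moments[OF assms] in \<open>auto simp: has_bochner_integral_iff\<close>)
  note [measurable] = increment_measurable[OF assms]
  show i: "integrable M (\<lambda>\<omega>. norm (B t \<omega> - B s \<omega>) ^ 4)"
  proof (rule Bochner_Integration.integrable_bound[OF integrable.intros[OF s]])
    show "AE \<omega> in M. norm (norm (B t \<omega> - B s \<omega>) ^ 4) \<le> norm (CARD('d) * (\<Sum>i\<in>UNIV. ?D i \<omega> ^ 4))"
    proof (rule AE_I2)
      fix \<omega>
      have "norm (norm (B t \<omega> - B s \<omega>) ^ 4) = norm (B t \<omega> - B s \<omega>) ^ 4" by simp
      also note le[of \<omega>]
      also have "CARD('d) * (\<Sum>i\<in>UNIV. ?D i \<omega> ^ 4) \<le> norm (CARD('d) * (\<Sum>i\<in>UNIV. ?D i \<omega> ^ 4))"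
        unfolding real_norm_def by (rule abs_ge_self)
      finally show "norm (norm (B t \<omega> - B s \<omega>) ^ 4) \<le> norm (CARD('d) * (\<Sum>i\<in>UNIV. ?D i \<omega> ^ 4))" .
    qed
  qed measurable
  have "(\<integral>\<omega>. norm (B t \<omega> - B s \<omega>) ^ 4 \<partial>M) \<le> (\<integral>\<omega>. CARD('d) * (\<Sum>i\<in>UNIV. ?D i \<omega> ^ 4) \<partial>M)"
    by (intro integral_mono i integrable.intros[OF s] le)
  also have "\<dots> = 3 * (CARD('d))\<^sup>2 * (t - s)\<^sup>2"
    using has_bochner_integral_integral_eq[OF s] by (simp add: power2_eq_square)
  finally show "(\<integral>\<omega>. norm (B t \<omega> - B s \<omega>) ^ 4 \<partial>M) \<le> 3 * (CARD('d))\<^sup>2 * (t - s)\<^sup>2" .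
qed

lemma mult_increment_zero:
  fixes H :: "'w \<Rightarrow> real"
  assumes "0 \<le> s" "s \<le> t" "H \<in> borel_measurable (F s)" "integrable M H"
  shows "has_bochner_integral M (\<lambda>\<omega>. H \<omega> * (B t \<omega> - B s \<omega>) $ i) 0"
  using integrable_mult_increment[OF assms, of "\<lambda>x. x $ i"] integral_mult_increment[OF assms, of "\<lambda>x. x $ i"]
    increment_integrable[OF assms(1,2)] increment_moments(2)[OF assms(1,2)]
  by (simp add: has_bochner_integral_iff)

lemma inner_increment_zero:
  fixes k :: "'w \<Rightarrow> real ^ 'd"
  assumes "0 \<le> s" "s \<le> t" and k: "k \<in> borel_measurable (F s)" "integrable M k"
  shows "has_bochner_integral M (\<lambda>\<omega>. k \<omega> \<bullet> (B t \<omega> - B s \<omega>)) 0"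
proof -
  have "(\<lambda>\<omega>. k \<omega> $ i) \<in> borel_measurable (F s)" for i
    using measurable_compose[OF k(1) borel_measurable_nth] by simp
  moreover have "integrable M (\<lambda>\<omega>. k \<omega> $ i)" for i
    using integrable_bounded_linear[OF bounded_linear_vec_nth k(2)] .
  ultimately have "has_bochner_integral M (\<lambda>\<omega>. \<Sum>i\<in>UNIV. k \<omega> $ i * (B t \<omega> - B s \<omega>) $ i) (\<Sum>i\<in>(UNIV::'d set). 0)"
    using assms(1,2) by (intro has_bochner_integral_sum mult_increment_zero) auto
  then show ?thesis by (simp add: inner_vec_def)
qed

lemma increment_component_measurable_F:
  "0 \<le> s \<Longrightarrow> s \<le> t \<Longrightarrow> t \<le> r \<Longrightarrow> (\<lambda>\<omega>. (B t \<omega> - B s \<omega>) $ i) \<in> borel_measurable (F r)"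
  by (rule measurable_compose[OF borel_measurable_diff[OF B_measurable_F B_measurable_F] borel_measurable_nth]) auto

text \<open>The intervals are cut at \<open>r\<close> and at \<open>m = min q s\<close>. In a
  product of pieces from different intervals, the later piece is centred and independent of the
  other factors; only the common part (r, m] contributes, and it gives its length.\<close>

lemma increment_covariance_le:
  fixes G :: "'w \<Rightarrow> real"
  assumes pq: "0 \<le> p" "p \<le> q" and rs: "p \<le> r" "r \<le> s"
    and G: "sq_integrable M G" "G \<in> borel_measurable (F r)"
  shows "has_bochner_integral M (\<lambda>\<omega>. G \<omega> * ((B q \<omega> - B p \<omega>) $ i * (B s \<omega> - B r \<omega>) $ j))
    ((if i = j then 1 else 0) * (\<integral>\<omega>. G \<omega> \<partial>M) * max 0 (min q s - r))"
proof -
  let ?D = "\<lambda>p q i \<omega>. (B q \<omega> - B p \<omega>) $ i"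
  have H: "has_bochner_integral M (\<lambda>\<omega>. (G \<omega> * ?D a b i \<omega>) * ?D c d j \<omega>) 0"
    if "0 \<le> a" "a \<le> b" "b \<le> c" "c \<le> d" "r \<le> c" for a b c d i j
  proof (rule mult_increment_zero)
    show "(\<lambda>\<omega>. G \<omega> * ?D a b i \<omega>) \<in> borel_measurable (F c)"
      by (intro borel_measurable_times increment_component_measurable_F measurable_F_mono[OF G(2)] that)
    show "integrable M (\<lambda>\<omega>. G \<omega> * ?D a b i \<omega>)"
      by (intro integrable_mult_sq increment_sq_integrable that G)
  qed (use that in auto)
  show ?thesis
  proof (cases "q \<le> r")
    case True
    have "max 0 (min q s - r) = 0" using True by simp
    then show ?thesis using H[of p q r s i j] pq rs True by (simp only: mult.assoc mult_zero_right)
  next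
    case False
    define m where "m = min q s"
    have m: "r \<le> m" "m \<le> q" "m \<le> s" "m = q \<or> m = s" using False rs by (auto simp: m_def)
    have 0: "0 \<le> r" using pq rs by simp
    have iG: "integrable M G"
      by (rule sq_integrable_integrable[OF G(1)])
    have T: "has_bochner_integral M (\<lambda>\<omega>. G \<omega> * (?D r m i \<omega> * ?D r m j \<omega>))
      ((\<integral>\<omega>. G \<omega> \<partial>M) * (if i = j then m - r else 0))"
      using integrable_mult_increment[OF 0 m(1) G(2) iG, of "\<lambda>x. x $ i * x $ j"]
        integral_mult_increment[OF 0 m(1) G(2) iG, of "\<lambda>x. x $ i * x $ j"] increment_cross[OF 0 m(1)]
      by (simp add: has_bochner_integral_iff del: vector_minus_component)
    have "has_bochner_integral M (\<lambda>\<omega>. ((G \<omega> * ?D p r i \<omega>) * ?D r m j \<omega> + (G \<omega> * ?D p r i \<omega>) * ?D m s j \<omega>)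
        + (G \<omega> * (?D r m i \<omega> * ?D r m j \<omega>)) + ((G \<omega> * ?D r m i \<omega>) * ?D m s j \<omega> + (G \<omega> * ?D r m j \<omega>) * ?D m q i \<omega>))
      ((0 + 0) + (\<integral>\<omega>. G \<omega> \<partial>M) * (if i = j then m - r else 0) + (0 + 0))"
      by (intro has_bochner_integral_add H T) (use pq rs m in auto)
    moreover have "((G \<omega> * ?D p r i \<omega>) * ?D r m j \<omega> + (G \<omega> * ?D p r i \<omega>) * ?D m s j \<omega>)
        + (G \<omega> * (?D r m i \<omega> * ?D r m j \<omega>)) + ((G \<omega> * ?D r m i \<omega>) * ?D m s j \<omega> + (G \<omega> * ?D r m j \<omega>) * ?D m q i \<omega>)
        = G \<omega> * (?D p q i \<omega> * ?D r s j \<omega>)" for \<omega>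
    proof -
      have e: "?D p q i \<omega> = ?D p r i \<omega> + ?D r m i \<omega> + ?D m q i \<omega>" "?D r s j \<omega> = ?D r m j \<omega> + ?D m s j \<omega>"
        by simp_all
      \<comment> \<open>Since \<open>m\<close> is the end of one of the two intervals, one of the
        pieces beyond \<open>m\<close> is empty.\<close>
      have "?D m q i \<omega> * ?D m s j \<omega> = 0" using m(4) by auto
      then show ?thesis unfolding e by algebra
    qed
    moreover have "(if i = j then 1 else 0) * (\<integral>\<omega>. G \<omega> \<partial>M) * max 0 (min q s - r) =
      (0 + 0) + (\<integral>\<omega>. G \<omega> \<partial>M) * (if i = j then m - r else 0) + (0 + 0)"
      using m(1) by (auto simp: m_def)
    ultimately show ?thesis by (simp only:)
  qed
qed

lemma increment_covariance:
  fixes G :: "'w \<Rightarrow> real"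
  assumes pq: "0 \<le> p" "p \<le> q" and rs: "0 \<le> r" "r \<le> s"
    and G: "sq_integrable M G" "G \<in> borel_measurable (F (max p r))"
  shows "has_bochner_integral M (\<lambda>\<omega>. G \<omega> * ((B q \<omega> - B p \<omega>) $ i * (B s \<omega> - B r \<omega>) $ j))
    ((if i = j then 1 else 0) * (\<integral>\<omega>. G \<omega> \<partial>M) * max 0 (min q s - max p r))"
proof (cases "p \<le> r")
  case True
  then show ?thesis using increment_covariance_le[OF pq True rs(2) G(1)] G(2) by (simp add: max_def)
next
  case False
  have "has_bochner_integral M (\<lambda>\<omega>. G \<omega> * ((B s \<omega> - B r \<omega>) $ j * (B q \<omega> - B p \<omega>) $ i))
      ((if j = i then 1 else 0) * (\<integral>\<omega>. G \<omega> \<partial>M) * max 0 (min s q - p))"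
    by (rule increment_covariance_le) (use False assms in \<open>auto simp: max_def\<close>)
  moreover have "max p r = p" using False by simp
  moreover have "(B s \<omega> - B r \<omega>) $ j * (B q \<omega> - B p \<omega>) $ i = (B q \<omega> - B p \<omega>) $ i * (B s \<omega> - B r \<omega>) $ j" for \<omega>
    by (rule mult.commute)
  ultimately show ?thesis by (simp only: eq_commute[of j i] min.commute[of s q])
qed

text \<open>The Ito isometry for two one-step integrands: in components, with \<open>G\<close> the
  product of a component of \<open>k\<close> and one of \<open>h\<close>, only the diagonal survives
  and adds up to the inner product. The bound on \<open>h\<close> keeps these products square
  integrable.\<close>

lemma increment_covariance_vec:
  fixes k h :: "'w \<Rightarrow> real ^ 'd"
  assumes pq: "0 \<le> p" "p \<le> q" and rs: "0 \<le> r" "r \<le> s"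
    and k: "sq_integrable M k" "k \<in> borel_measurable (F p)"
    and h: "h \<in> borel_measurable (F r)" "\<And>\<omega>. \<omega> \<in> space M \<Longrightarrow> norm (h \<omega>) \<le> K"
  shows "has_bochner_integral M (\<lambda>\<omega>. (k \<omega> \<bullet> (B q \<omega> - B p \<omega>)) * (h \<omega> \<bullet> (B s \<omega> - B r \<omega>)))
    ((\<integral>\<omega>. k \<omega> \<bullet> h \<omega> \<partial>M) * max 0 (min q s - max p r))"
proof -
  let ?D = "\<lambda>p q i \<omega>. (B q \<omega> - B p \<omega>) $ i"
  let ?m = "max 0 (min q s - max p r)"
  have kF: "(\<lambda>\<omega>. k \<omega> $ i) \<in> borel_measurable (F p)" for i
    using measurable_compose[OF k(2) borel_measurable_nth] by simp
  have hF: "(\<lambda>\<omega>. h \<omega> $ i) \<in> borel_measurable (F r)" for i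
    using measurable_compose[OF h(1) borel_measurable_nth] by simp
  have G: "sq_integrable M (\<lambda>\<omega>. k \<omega> $ i * h \<omega> $ j)" for i j
  proof (rule sq_integrable_bound[OF k(1), where c="\<bar>K\<bar>"])
    show "(\<lambda>\<omega>. k \<omega> $ i * h \<omega> $ j) \<in> borel_measurable M"
      by (intro borel_measurable_times measurable_F_M[OF kF] measurable_F_M[OF hF])
    show "AE \<omega> in M. norm (k \<omega> $ i * h \<omega> $ j) \<le> \<bar>K\<bar> * norm (k \<omega>)"
    proof (rule AE_I2)
      fix \<omega> assume "\<omega> \<in> space M"
      then have "\<bar>h \<omega> $ j\<bar> \<le> \<bar>K\<bar>" using h(2)[of \<omega>] component_le_norm_cart[of "h \<omega>" j] by linarith
      then show "norm (k \<omega> $ i * h \<omega> $ j) \<le> \<bar>K\<bar> * norm (k \<omega>)"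
        using mult_mono[OF component_le_norm_cart[of "k \<omega>" i]] by (simp add: abs_mult mult.commute)
    qed
  qed
  have iG: "integrable M (\<lambda>\<omega>. k \<omega> $ i * h \<omega> $ j)" for i j
    by (rule sq_integrable_integrable[OF G])
  have "has_bochner_integral M (\<lambda>\<omega>. \<Sum>i\<in>UNIV. \<Sum>j\<in>UNIV. (k \<omega> $ i * h \<omega> $ j) * (?D p q i \<omega> * ?D r s j \<omega>))
      (\<Sum>i\<in>UNIV. \<Sum>j\<in>UNIV. (if i = j then 1 else 0) * (\<integral>\<omega>. k \<omega> $ i * h \<omega> $ j \<partial>M) * ?m)"
    by (intro has_bochner_integral_sum increment_covariance pq rs G borel_measurable_times
        measurable_F_mono[OF kF] measurable_F_mono[OF hF]) auto
  moreover have "(\<Sum>i\<in>UNIV. \<Sum>j\<in>UNIV. (if i = j then 1 else 0) * (\<integral>\<omega>. k \<omega> $ i * h \<omega> $ j \<partial>M) * ?m)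
      = (\<integral>\<omega>. k \<omega> \<bullet> h \<omega> \<partial>M) * ?m"
  proof -
    have "(\<Sum>i\<in>UNIV. \<Sum>j\<in>UNIV. (if i = j then 1 else 0) * (\<integral>\<omega>. k \<omega> $ i * h \<omega> $ j \<partial>M) * ?m)
      = (\<Sum>i\<in>UNIV. \<Sum>j\<in>UNIV. (if i = j then (\<integral>\<omega>. k \<omega> $ i * h \<omega> $ j \<partial>M) * ?m else 0))"
      by (intro sum.cong refl) auto
    also have "\<dots> = (\<Sum>i\<in>UNIV. (\<integral>\<omega>. k \<omega> $ i * h \<omega> $ i \<partial>M) * ?m)" by simp
    also have "\<dots> = (\<integral>\<omega>. (\<Sum>i\<in>UNIV. k \<omega> $ i * h \<omega> $ i) \<partial>M) * ?m"
      using iG by (simp add: sum_distrib_right)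
    finally show ?thesis by (simp add: inner_vec_def)
  qed
  moreover have "(\<Sum>i\<in>UNIV. \<Sum>j\<in>UNIV. (k \<omega> $ i * h \<omega> $ j) * (?D p q i \<omega> * ?D r s j \<omega>))
      = (k \<omega> \<bullet> (B q \<omega> - B p \<omega>)) * (h \<omega> \<bullet> (B s \<omega> - B r \<omega>))" for \<omega>
    by (simp only: inner_vec_def sum_product inner_real_def) (intro sum.cong refl, simp add: ac_simps)
  ultimately show ?thesis by (simp only:)
qed

end

section \<open>Ito integrals\<close>

abbreviation (input) ev :: "('w, 'b) process \<Rightarrow> 'w \<times> real \<Rightarrow> 'b" where
  "ev X x \<equiv> X (snd x) (fst x)"

text \<open>Half-open intervals match the steps of \<open>simple_process\<close> and let adjacent
  slabs add up exactly. In the pair the sample point comes first, whereas a process takes time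
  first.\<close>

definition slab :: "real \<Rightarrow> real \<Rightarrow> ('w, 'b::real_normed_vector) process \<Rightarrow> 'w \<times> real \<Rightarrow> 'b" where
  "slab a b X x = indicator {a<..b} (snd x) *\<^sub>R ev X x"

lemma slab_apply: "slab a b X (\<omega>, s) = indicator {a<..b} s *\<^sub>R X s \<omega>"
  by (simp add: slab_def)

lemma slab_in: "a < snd x \<Longrightarrow> snd x \<le> b \<Longrightarrow> slab a b X x = ev X x"
  by (simp add: slab_def)

lemma slab_out: "\<not> (a < snd x \<and> snd x \<le> b) \<Longrightarrow> slab a b X x = 0"
  by (simp add: slab_def)

lemma slab_diff: "slab a b (\<lambda>s \<omega>. X s \<omega> - Y s \<omega>) x = slab a b X x - slab a b Y x"
  by (simp add: slab_def scaleR_diff_right)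

lemma slab_split: "a \<le> c \<Longrightarrow> c \<le> b \<Longrightarrow> slab a b X x = slab a c X x + slab c b X x"
  by (auto simp: slab_def indicator_def)

lemma slab_norm_sq: "slab a b (\<lambda>s \<omega>. (norm (X s \<omega>))\<^sup>2) x = (norm (slab a b X x))\<^sup>2"
  by (auto simp: slab_def indicator_def)

lemma slab_sq: "slab a b (\<lambda>s \<omega>. (X s \<omega> :: real)\<^sup>2) x = (slab a b X x)\<^sup>2"
  by (auto simp: slab_def indicator_def)

lemma slab_inner: "slab a b (\<lambda>s \<omega>. X s \<omega> \<bullet> Y s \<omega>) x = slab a b X x \<bullet> slab a b Y x"
  by (auto simp: slab_def indicator_def)

context brownian_space begin

abbreviation MT :: "('w \<times> real) measure" where "MT \<equiv> M \<Otimes>\<^sub>M lborel"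

sublocale MT: pair_sigma_finite M "lborel :: real measure" ..

lemma slab_measurable_sub:
  assumes "slab a b X \<in> borel_measurable MT" "a \<le> c" "d \<le> b"
  shows "slab c d (X :: ('w, 'b::{real_normed_vector, second_countable_topology}) process) \<in> borel_measurable MT"
proof -
  have "slab c d X = (\<lambda>x. indicator {c<..d} (snd x) *\<^sub>R slab a b X x)"
    using assms(2,3) by (auto simp: slab_def fun_eq_iff indicator_def)
  moreover have "(\<lambda>x. indicator {c<..d} (snd x) *\<^sub>R slab a b X x) \<in> borel_measurable MT"
    using assms(1) by measurable
  ultimately show ?thesis by simp
qed

lemma slab_sq_integrable_sub:
  assumes "sq_integrable MT (slab a b X)" "a \<le> c" "d \<le> b"
  shows "sq_integrable MT (slab c d X)"
  by (rule sq_integrable_bound[OF assms(1), where c=1])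
    (use slab_measurable_sub[OF sq_integrable_measurable[OF assms(1)] assms(2,3)] assms(2,3) in
      \<open>auto simp: slab_def indicator_def\<close>)

lemma slab_integrable_sub:
  assumes "integrable MT (slab a b X)" "a \<le> c" "d \<le> b"
  shows "integrable MT (slab c d (X :: ('w, real) process))"
  by (rule Bochner_Integration.integrable_bound[OF assms(1)])
    (use slab_measurable_sub[OF borel_measurable_integrable[OF assms(1)] assms(2,3)] assms(2,3) in
      \<open>auto simp: slab_def indicator_def\<close>)

lemma slab_const_integral:
  fixes X :: "'w \<Rightarrow> real"
  assumes X: "integrable M X" and pq: "p \<le> q"
  shows "has_bochner_integral MT (slab p q (\<lambda>_. X)) ((q - p) * (\<integral>\<omega>. X \<omega> \<partial>M))"
proof -
  note [measurable] = borel_measurable_integrable[OF X]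
  have m: "slab p q (\<lambda>_. X) \<in> borel_measurable MT" unfolding slab_def by measurable
  have "integrable MT (slab p q (\<lambda>_. X))"
  proof (rule MT.Fubini_integrable[OF m])
    have "(\<integral>y. norm (slab p q (\<lambda>_. X) (x, y)) \<partial>lborel) = (q - p) * \<bar>X x\<bar>" for x
      using pq by (simp add: slab_apply abs_mult)
    then show "integrable M (\<lambda>x. \<integral>y. norm (slab p q (\<lambda>_. X) (x, y)) \<partial>lborel)" using X by simp
    show "AE x in M. integrable lborel (\<lambda>y. slab p q (\<lambda>_. X) (x, y))"
      using pq by (auto simp: slab_apply intro!: AE_I2 integrable_mult_left)
  qed
  moreover have "integral\<^sup>L MT (slab p q (\<lambda>_. X)) = (q - p) * (\<integral>\<omega>. X \<omega> \<partial>M)"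
    using pq by (subst MT.integral_fst'[OF calculation, symmetric]) (simp add: slab_apply)
  ultimately show ?thesis by (simp add: has_bochner_integral_iff)
qed

lemma slab_const_sq_integrable:
  assumes k: "sq_integrable M k"
  shows "sq_integrable MT (slab p q (\<lambda>_. k))"
proof (rule sq_integrableI)
  note [measurable] = sq_integrable_measurable[OF k]
  show "slab p q (\<lambda>_. k) \<in> borel_measurable MT" unfolding slab_def by measurable
  show "integrable MT (\<lambda>x. (norm (slab p q (\<lambda>_. k) x))\<^sup>2)"
  proof (cases "p \<le> q")
    case True
    then show ?thesis
      using slab_const_integral[OF sq_integrable_norm_sq[OF k], of p q]
      by (simp add: has_bochner_integral_iff flip: slab_norm_sq)
  next
    case False
    then have "(\<lambda>x. (norm (slab p q (\<lambda>_. k) x))\<^sup>2) = (\<lambda>_. 0)" by (auto simp: slab_def fun_eq_iff)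
    then show ?thesis by simp
  qed
qed

text \<open>Cauchy-Schwarz in time against the indicator of (p, q], at almost every sample point;
  this yields the factor q - p.\<close>

lemma slab_section_integral:
  assumes f: "sq_integrable MT (slab p q (f :: ('w, real) process))" and pq: "p \<le> q"
  shows "AE \<omega> in M. integrable lborel (\<lambda>s. slab p q f (\<omega>, s))"
    and "sq_integrable M (\<lambda>\<omega>. \<integral>s. slab p q f (\<omega>, s) \<partial>lborel)"
    and "(\<integral>\<omega>. (\<integral>s. slab p q f (\<omega>, s) \<partial>lborel)\<^sup>2 \<partial>M) \<le> (q - p) * (\<integral>x. (slab p q f x)\<^sup>2 \<partial>MT)"
proof -
  note [measurable] = sq_integrable_measurable[OF f]
  have ind: "(indicator {p<..q} s :: real)\<^sup>2 = indicator {p<..q} s" for s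
    by (simp add: indicator_def)
  have one: "sq_integrable lborel (indicator {p<..q} :: real \<Rightarrow> real)"
    using integrable_real_indicator[of "{p<..q}" lborel] pq by (simp add: sq_integrable_def ind)
  have ae: "AE \<omega> in M. sq_integrable lborel (\<lambda>s. slab p q f (\<omega>, s))"
    using MT.AE_integrable_fst'[OF sq_integrable_sq[OF f]] AE_space
    by eventually_elim (auto simp: sq_integrable_def)
  have eq: "indicator {p<..q} s * slab p q f (\<omega>, s) = slab p q f (\<omega>, s)" for s \<omega>
    by (simp add: slab_apply indicator_def)
  show "AE \<omega> in M. integrable lborel (\<lambda>s. slab p q f (\<omega>, s))"
    using ae
  proof eventually_elim
    fix \<omega> assume "sq_integrable lborel (\<lambda>s. slab p q f (\<omega>, s))"
    from integrable_mult_sq[OF one this]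
    show "integrable lborel (\<lambda>s. slab p q f (\<omega>, s))" by (simp only: eq)
  qed
  have le: "AE \<omega> in M. (\<integral>s. slab p q f (\<omega>, s) \<partial>lborel)\<^sup>2 \<le> (q - p) * (\<integral>s. (slab p q f (\<omega>, s))\<^sup>2 \<partial>lborel)"
    using ae
  proof eventually_elim
    fix \<omega> assume "sq_integrable lborel (\<lambda>s. slab p q f (\<omega>, s))"
    from Cauchy_Schwarz_integral[OF one this]
    show "(\<integral>s. slab p q f (\<omega>, s) \<partial>lborel)\<^sup>2 \<le> (q - p) * (\<integral>s. (slab p q f (\<omega>, s))\<^sup>2 \<partial>lborel)"
      using pq by (simp only: eq inner_real_def real_norm_def power2_abs ind) simp
  qed
  note i = integrable_mult_right[OF MT.integrable_fst'[OF sq_integrable_sq[OF f]], of "q - p"]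
  show L2: "sq_integrable M (\<lambda>\<omega>. \<integral>s. slab p q f (\<omega>, s) \<partial>lborel)"
    using le by (intro sq_integrableI Bochner_Integration.integrable_bound[OF i]) (auto simp: pq)
  show "(\<integral>\<omega>. (\<integral>s. slab p q f (\<omega>, s) \<partial>lborel)\<^sup>2 \<partial>M) \<le> (q - p) * (\<integral>x. (slab p q f x)\<^sup>2 \<partial>MT)"
    using integral_mono_AE[OF sq_integrable_sq[OF L2] i le] MT.integral_fst'[OF sq_integrable_sq[OF f]]
    by simp
qed

lemma sq_norm_on_eq:
  assumes m[measurable]: "slab a b X \<in> borel_measurable MT"
  shows "sq_norm_on M a b X = (\<integral>\<^sup>+ x. ennreal ((norm (slab a b X x))\<^sup>2) \<partial>MT)"
proof -
  have "(\<integral>\<^sup>+ x. ennreal ((norm (slab a b X x))\<^sup>2) \<partial>MT)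
      = (\<integral>\<^sup>+ \<omega>. \<integral>\<^sup>+ s. ennreal ((norm (slab a b X (\<omega>, s)))\<^sup>2) \<partial>lborel \<partial>M)"
    by (rule lborel.nn_integral_fst[symmetric]) measurable
  also have "\<dots> = sq_norm_on M a b X"
    unfolding sq_norm_on_def
  proof (rule nn_integral_cong, rule nn_integral_cong_AE)
    fix \<omega> assume "\<omega> \<in> space M"
    show "AE s in lborel. ennreal ((norm (slab a b X (\<omega>, s)))\<^sup>2) = ennreal ((norm (X s \<omega>))\<^sup>2) * indicator {a..b} s"
      \<comment> \<open>\<open>sq_norm_on\<close> integrates over the closed interval, while the
        slab omits the left end point, a null set.\<close>
      using AE_lborel_singleton[of a] by eventually_elim (auto simp: slab_apply indicator_def)
  qed
  finally show ?thesis by simp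
qed

lemma sq_integrable_slab_iff:
  assumes m: "slab a b (X :: ('w, 'b::euclidean_space) process) \<in> borel_measurable MT"
  shows "sq_integrable MT (slab a b X) \<longleftrightarrow> sq_norm_on M a b X < \<infinity>"
proof -
  have "integrable MT (\<lambda>x. (norm (slab a b X x))\<^sup>2) \<longleftrightarrow> (\<integral>\<^sup>+ x. ennreal ((norm (slab a b X x))\<^sup>2) \<partial>MT) < \<infinity>"
    using m by (subst integrable_iff_bounded) auto
  then show ?thesis using m by (simp add: sq_integrable_def sq_norm_on_eq)
qed

section \<open>Pairings of stochastic integrals with square integrable variables\<close>

lemma simple_integrand_partition:
  assumes "simple_integrand F a b n \<tau> h" "i < n"
  shows "a \<le> \<tau> i" "\<tau> i \<le> \<tau> (Suc i)" "\<tau> (Suc i) \<le> b"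
proof -
  have ends: "a \<le> \<tau> 0" "\<tau> n \<le> b" and step: "\<And>i. i < n \<Longrightarrow> \<tau> i \<le> \<tau> (Suc i)"
    using assms(1) by (simp_all add: simple_integrand_def)
  have mono: "\<tau> i \<le> \<tau> j" if "i \<le> j" "j \<le> n" for i j
    using that
  proof (induction j)
    case (Suc j)
    show ?case
    proof (cases "i = Suc j")
      case False
      then have "\<tau> i \<le> \<tau> j" using Suc by simp
      also have "\<dots> \<le> \<tau> (Suc j)" using step[of j] Suc.prems by simp
      finally show ?thesis .
    qed simp
  qed simp
  show "a \<le> \<tau> i" by (rule order_trans[OF ends(1) mono]) (use assms(2) in auto)
  show "\<tau> i \<le> \<tau> (Suc i)" by (rule step[OF assms(2)])
  show "\<tau> (Suc i) \<le> b" by (rule order_trans[OF mono ends(2)]) (use assms(2) in auto)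
qed

lemma simple_integrand_coeff:
  assumes "simple_integrand F a b n \<tau> h" "i < n"
  shows "h i \<in> borel_measurable (F (\<tau> i))" "\<exists>K. \<forall>\<omega>\<in>space M. norm (h i \<omega>) \<le> K" "sq_integrable M (h i)"
proof -
  show h: "h i \<in> borel_measurable (F (\<tau> i))" "\<exists>K. \<forall>\<omega>\<in>space M. norm (h i \<omega>) \<le> K"
    using assms by (auto simp: simple_integrand_def space_F)
  then show "sq_integrable M (h i)"
    using sq_integrable_of_bounded[OF measurable_F_M[OF h(1)]] by blast
qed

lemma slab_simple_process:
  assumes "simple_integrand F a b n \<tau> h"
  shows "slab a b (simple_process n \<tau> h) x = (\<Sum>i<n. slab (\<tau> i) (\<tau> (Suc i)) (\<lambda>_. h i) x)"
proof -
  have *: "indicator {a<..b} (snd x) *\<^sub>R indicator {\<tau> i<..\<tau> (Suc i)} (snd x) *\<^sub>R h i (fst x)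
      = slab (\<tau> i) (\<tau> (Suc i)) (\<lambda>_. h i) x" if "i < n" for i
    using simple_integrand_partition[OF assms that] by (auto simp: slab_def indicator_def)
  have "slab a b (simple_process n \<tau> h) x
      = (\<Sum>i<n. indicator {a<..b} (snd x) *\<^sub>R indicator {\<tau> i<..\<tau> (Suc i)} (snd x) *\<^sub>R h i (fst x))"
    unfolding slab_def simple_process_def by (rule scaleR_sum_right)
  also have "\<dots> = (\<Sum>i<n. slab (\<tau> i) (\<tau> (Suc i)) (\<lambda>_. h i) x)"
    by (intro sum.cong refl *) simp
  finally show ?thesis .
qed

lemma simple_integral_sq_integrable:
  assumes "simple_integrand F a b n \<tau> h" "0 \<le> a"
  shows "sq_integrable M (simple_integral B n \<tau> h)"
    "\<And>i. i < n \<Longrightarrow> sq_integrable M (\<lambda>\<omega>. h i \<omega> \<bullet> (B (\<tau> (Suc i)) \<omega> - B (\<tau> i) \<omega>))"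
proof -
  show *: "sq_integrable M (\<lambda>\<omega>. h i \<omega> \<bullet> (B (\<tau> (Suc i)) \<omega> - B (\<tau> i) \<omega>))" if i: "i < n" for i
  proof -
    note \<tau> = simple_integrand_partition[OF assms(1) i]
    note h = simple_integrand_coeff[OF assms(1) i]
    then obtain K where K: "\<And>\<omega>. \<omega> \<in> space M \<Longrightarrow> norm (h i \<omega>) \<le> K" by blast
    have sI: "sq_integrable M (\<lambda>\<omega>. B (\<tau> (Suc i)) \<omega> - B (\<tau> i) \<omega>)"
      using \<tau> assms(2) by (intro increment_sq_integrable_vec) auto
    show ?thesis
    proof (rule sq_integrable_bound[OF sI, where c=K])
      show "AE \<omega> in M. norm (h i \<omega> \<bullet> (B (\<tau> (Suc i)) \<omega> - B (\<tau> i) \<omega>)) \<le> K * norm (B (\<tau> (Suc i)) \<omega> - B (\<tau> i) \<omega>)"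
        by (intro AE_I2) (simp, rule order_trans[OF Cauchy_Schwarz_ineq2 mult_right_mono[OF K]], auto)
    qed (use sq_integrable_measurable[OF h(3)] sq_integrable_measurable[OF sI] in measurable)
  qed
  have "simple_integral B n \<tau> h = (\<lambda>\<omega>. \<Sum>i<n. h i \<omega> \<bullet> (B (\<tau> (Suc i)) \<omega> - B (\<tau> i) \<omega>))"
    by (simp add: simple_integral_def fun_eq_iff)
  then show "sq_integrable M (simple_integral B n \<tau> h)"
    using sq_integrable_sum[OF *, of "{..<n}" "\<lambda>i. i"] by auto
qed

text \<open>The martingale property, the Ito isometry and the pairing of a stochastic integral with a Brownian
  increment are all instances, for suitable \<open>G\<close> and \<open>\<Gamma>\<close>.\<close>

lemma ito_integral_pairing:
  assumes J: "has_ito_integral M F B Z a b J" and a: "0 \<le> a"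
    and Z: "sq_integrable MT (slab a b Z)"
    and G: "sq_integrable M G" and \<Gamma>: "sq_integrable MT \<Gamma>"
    and elementary: "\<And>r s h K. a \<le> r \<Longrightarrow> r \<le> s \<Longrightarrow> s \<le> b \<Longrightarrow> h \<in> borel_measurable (F r) \<Longrightarrow>
      (\<And>\<omega>. \<omega> \<in> space M \<Longrightarrow> norm (h \<omega>) \<le> K) \<Longrightarrow>
      (\<integral>\<omega>. G \<omega> * (h \<omega> \<bullet> (B s \<omega> - B r \<omega>)) \<partial>M) = (\<integral>x. \<Gamma> x \<bullet> slab r s (\<lambda>_. h) x \<partial>MT)"
  shows "(\<integral>\<omega>. G \<omega> * J \<omega> \<partial>M) = (\<integral>x. \<Gamma> x \<bullet> slab a b Z x \<partial>MT)"
    and "sq_integrable M J"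
proof -
  from J obtain n \<tau> h where Jm: "J \<in> borel_measurable M"
    and s: "\<And>k. simple_integrand F a b (n k) (\<tau> k) (h k)"
    and l1: "(\<lambda>k. sq_norm_on M a b (\<lambda>s \<omega>. simple_process (n k) (\<tau> k) (h k) s \<omega> - Z s \<omega>)) \<longlonglongrightarrow> 0"
    and l2: "(\<lambda>k. \<integral>\<^sup>+ \<omega>. ennreal ((simple_integral B (n k) (\<tau> k) (h k) \<omega> - J \<omega>)\<^sup>2) \<partial>M) \<longlonglongrightarrow> 0"
    unfolding has_ito_integral_def by blast
  define I where "I k = simple_integral B (n k) (\<tau> k) (h k)" for k
  define S where "S k = slab a b (simple_process (n k) (\<tau> k) (h k))" for k
  have S_eq: "S k = (\<lambda>x. \<Sum>i<n k. slab (\<tau> k i) (\<tau> k (Suc i)) (\<lambda>_. h k i) x)" for k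
    using slab_simple_process[OF s] by (simp add: S_def fun_eq_iff)
  have piece: "sq_integrable MT (slab (\<tau> k i) (\<tau> k (Suc i)) (\<lambda>_. h k i))" if "i < n k" for k i
    by (intro slab_const_sq_integrable simple_integrand_coeff(3)[OF s that])
  have S2: "sq_integrable MT (S k)" for k
    unfolding S_eq by (intro sq_integrable_sum piece) auto
  have I2: "sq_integrable M (I k)" for k
    unfolding I_def by (rule simple_integral_sq_integrable[OF s a])
  \<comment> \<open>Both sides are linear in the integrand, so for a simple one the identity is a
    sum of instances of \<open>elementary\<close>, one for each step.\<close>
  have eq: "(\<integral>\<omega>. G \<omega> * I k \<omega> \<partial>M) = (\<integral>x. \<Gamma> x \<bullet> S k x \<partial>MT)" for k
  proof -
    have "(\<integral>\<omega>. G \<omega> * I k \<omega> \<partial>M)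
        = (\<integral>\<omega>. (\<Sum>i<n k. G \<omega> * (h k i \<omega> \<bullet> (B (\<tau> k (Suc i)) \<omega> - B (\<tau> k i) \<omega>))) \<partial>M)"
      by (simp add: I_def simple_integral_def sum_distrib_left)
    also have "\<dots> = (\<Sum>i<n k. \<integral>\<omega>. G \<omega> * (h k i \<omega> \<bullet> (B (\<tau> k (Suc i)) \<omega> - B (\<tau> k i) \<omega>)) \<partial>M)"
      by (intro Bochner_Integration.integral_sum integrable_mult_sq G
          simple_integral_sq_integrable(2)[OF s a]) auto
    also have "\<dots> = (\<Sum>i<n k. \<integral>x. \<Gamma> x \<bullet> slab (\<tau> k i) (\<tau> k (Suc i)) (\<lambda>_. h k i) x \<partial>MT)"
    proof (intro sum.cong refl)
      fix i assume "i \<in> {..<n k}"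
      then have i: "i < n k" by simp
      obtain K where K: "\<And>\<omega>. \<omega> \<in> space M \<Longrightarrow> norm (h k i \<omega>) \<le> K"
        using simple_integrand_coeff(2)[OF s i] by blast
      show "(\<integral>\<omega>. G \<omega> * (h k i \<omega> \<bullet> (B (\<tau> k (Suc i)) \<omega> - B (\<tau> k i) \<omega>)) \<partial>M)
          = (\<integral>x. \<Gamma> x \<bullet> slab (\<tau> k i) (\<tau> k (Suc i)) (\<lambda>_. h k i) x \<partial>MT)"
        by (rule elementary[OF simple_integrand_partition[OF s i] simple_integrand_coeff(1)[OF s i] K])
    qed
    also have "\<dots> = (\<integral>x. (\<Sum>i<n k. \<Gamma> x \<bullet> slab (\<tau> k i) (\<tau> k (Suc i)) (\<lambda>_. h k i) x) \<partial>MT)"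
      by (intro Bochner_Integration.integral_sum[symmetric] integrable_inner_sq \<Gamma> piece) auto
    finally show ?thesis by (simp add: S_eq inner_sum_right)
  qed
  have Sl: "(\<lambda>k. \<integral>\<^sup>+x. ennreal ((norm (S k x - slab a b Z x))\<^sup>2) \<partial>MT) \<longlonglongrightarrow> 0"
  proof -
    have c: "slab a b (\<lambda>s \<omega>. simple_process (n k) (\<tau> k) (h k) s \<omega> - Z s \<omega>) = (\<lambda>x. S k x - slab a b Z x)" for k
      by (simp add: fun_eq_iff slab_diff S_def)
    have "slab a b (\<lambda>s \<omega>. simple_process (n k) (\<tau> k) (h k) s \<omega> - Z s \<omega>) \<in> borel_measurable MT" for k
      unfolding c using sq_integrable_measurable[OF S2] sq_integrable_measurable[OF Z] by measurable
    then show ?thesis using l1 by (simp add: sq_norm_on_eq c)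
  qed
  have Il: "(\<lambda>k. \<integral>\<^sup>+x. ennreal ((norm (I k x - J x))\<^sup>2) \<partial>M) \<longlonglongrightarrow> 0"
    using l2 by (simp add: I_def)
  \<comment> \<open>\<open>I k\<close> tends to \<open>J\<close> and \<open>S k\<close> to the slab
    of \<open>Z\<close> in L2, so both sides of \<open>eq\<close> converge.\<close>
  note lim1 = integral_inner_tendsto[OF I2 Jm Il G]
  note lim2 = integral_inner_tendsto[OF S2 sq_integrable_measurable[OF Z] Sl \<Gamma>]
  show "sq_integrable M J" by (rule lim1)
  show "(\<integral>\<omega>. G \<omega> * J \<omega> \<partial>M) = (\<integral>x. \<Gamma> x \<bullet> slab a b Z x \<partial>MT)"
    using LIMSEQ_unique[OF lim1(1)] lim2(1) eq by simp
qed

text \<open>With \<open>G\<close> and \<Gamma> equal to zero the elementary identity is trivial, and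
  the second conclusion of the pairing remains.\<close>

lemma ito_integral_sq_integrable:
  assumes "has_ito_integral M F B Z a b J" "0 \<le> a" "sq_integrable MT (slab a b Z)"
  shows "sq_integrable M J"
  by (rule ito_integral_pairing(2)[OF assms, of "\<lambda>_. 0" "\<lambda>_. 0"]) (auto simp: sq_integrable_zero)

text \<open>The martingale property: with \<Gamma> zero the elementary identity says that an
  increment starting at \<open>r\<close> is centred against the variable G h, which is known at time
  \<open>r\<close>.\<close>

lemma ito_integral_orthogonal:
  assumes "has_ito_integral M F B Z a b J" "0 \<le> a" "sq_integrable MT (slab a b Z)"
    and G: "sq_integrable M G" "G \<in> borel_measurable (F a)"
  shows "(\<integral>\<omega>. G \<omega> * J \<omega> \<partial>M) = 0"
proof -
  have "(\<integral>\<omega>. G \<omega> * J \<omega> \<partial>M) = (\<integral>x. 0 \<bullet> slab a b Z x \<partial>MT)"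
  proof (rule ito_integral_pairing(1)[OF assms(1-3) G(1)])
    fix r s :: real and h :: "'w \<Rightarrow> real ^ 'd" and K
    assume rs: "a \<le> r" "r \<le> s" "s \<le> b" and h: "h \<in> borel_measurable (F r)" "\<And>\<omega>. \<omega> \<in> space M \<Longrightarrow> norm (h \<omega>) \<le> K"
    have Gh: "(\<lambda>\<omega>. G \<omega> *\<^sub>R h \<omega>) \<in> borel_measurable (F r)"
      by (intro borel_measurable_scaleR measurable_F_mono[OF G(2) rs(1)] h(1))
    have "integrable M (\<lambda>\<omega>. G \<omega> *\<^sub>R h \<omega>)"
    proof (rule Bochner_Integration.integrable_bound[OF integrable_mult_right[OF sq_integrable_integrable[OF G(1)], of K]])
      show "AE \<omega> in M. norm (G \<omega> *\<^sub>R h \<omega>) \<le> norm (K * G \<omega>)"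
      proof (rule AE_I2)
        fix \<omega> assume "\<omega> \<in> space M"
        then have "norm (h \<omega>) \<le> \<bar>K\<bar>" using h(2)[of \<omega>] by simp
        then show "norm (G \<omega> *\<^sub>R h \<omega>) \<le> norm (K * G \<omega>)"
          using mult_right_mono[of "norm (h \<omega>)" "\<bar>K\<bar>" "\<bar>G \<omega>\<bar>"] by (simp add: abs_mult mult.commute)
      qed
    qed (rule measurable_F_M[OF Gh])
    from inner_increment_zero[OF _ rs(2) Gh this] have "has_bochner_integral M (\<lambda>\<omega>. G \<omega> * (h \<omega> \<bullet> (B s \<omega> - B r \<omega>))) 0"
      using rs assms(2) by simp
    then show "(\<integral>\<omega>. G \<omega> * (h \<omega> \<bullet> (B s \<omega> - B r \<omega>)) \<partial>M) = (\<integral>x. 0 \<bullet> slab r s (\<lambda>_. h) x \<partial>MT)"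
      by (simp add: has_bochner_integral_iff)
  qed (rule sq_integrable_zero)
  then show ?thesis by simp
qed

text \<open>The length of the overlap is the same factor as in
  \<open>increment_covariance_vec\<close>; the two lemmas together give the elementary identity for
  one-step integrals.\<close>

lemma integral_slab_inner_const:
  assumes k: "sq_integrable M k" and h: "sq_integrable M h"
  shows "(\<integral>x. slab p q (\<lambda>_. k) x \<bullet> slab r s (\<lambda>_. h) x \<partial>MT) = (\<integral>\<omega>. k \<omega> \<bullet> h \<omega> \<partial>M) * max 0 (min q s - max p r)"
proof -
  have *: "slab p q (\<lambda>_. k) x \<bullet> slab r s (\<lambda>_. h) x = slab (max p r) (min q s) (\<lambda>_ \<omega>. k \<omega> \<bullet> h \<omega>) x" for x
    by (auto simp: slab_def indicator_def)
  show ?thesis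
  proof (cases "max p r \<le> min q s")
    case True
    then have "has_bochner_integral MT (slab (max p r) (min q s) (\<lambda>_ \<omega>. k \<omega> \<bullet> h \<omega>))
        ((min q s - max p r) * (\<integral>\<omega>. k \<omega> \<bullet> h \<omega> \<partial>M))"
      by (rule slab_const_integral[OF integrable_inner_sq[OF k h]])
    moreover have "max 0 (min q s - max p r) = min q s - max p r" using True by simp
    ultimately show ?thesis unfolding * by (simp only: has_bochner_integral_iff mult.commute)
  next
    case False
    then have "slab (max p r) (min q s) (\<lambda>_ \<omega>. k \<omega> \<bullet> h \<omega>) x = 0" for x
      by (intro slab_out) auto
    moreover have "max 0 (min q s - max p r) = 0" using False by linarith
    ultimately show ?thesis unfolding * by simp
  qed
qed

text \<open>The increment is independent of \<open>k\<close>, so the second moment of the product of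
  norms factors, and the squared norm of the increment has mean d (q - p) in dimension d.\<close>

lemma mult_increment_sq_integrable:
  fixes p q :: real
  assumes k: "sq_integrable M k" "k \<in> borel_measurable (F p)" and pq: "0 \<le> p" "p \<le> q"
  shows "sq_integrable M (\<lambda>\<omega>. k \<omega> \<bullet> (B q \<omega> - B p \<omega>))"
    and "integrable M (\<lambda>\<omega>. (norm (k \<omega>))\<^sup>2 * (norm (B q \<omega> - B p \<omega>))\<^sup>2)"
    and "(\<integral>\<omega>. (norm (k \<omega>))\<^sup>2 * (norm (B q \<omega> - B p \<omega>))\<^sup>2 \<partial>M) = CARD('d) * (q - p) * (\<integral>\<omega>. (norm (k \<omega>))\<^sup>2 \<partial>M)"
proof -
  have kF: "(\<lambda>\<omega>. (norm (k \<omega>))\<^sup>2) \<in> borel_measurable (F p)" using k(2) by measurable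
  note m = integrable_mult_increment[OF pq kF sq_integrable_norm_sq[OF k(1)], of "\<lambda>x. (norm x)\<^sup>2"]
    integral_mult_increment[OF pq kF sq_integrable_norm_sq[OF k(1)], of "\<lambda>x. (norm x)\<^sup>2"]
  note n = increment_norm_sq[OF pq]
  show i: "integrable M (\<lambda>\<omega>. (norm (k \<omega>))\<^sup>2 * (norm (B q \<omega> - B p \<omega>))\<^sup>2)"
    using m(1) n by (simp add: has_bochner_integral_iff)
  show "(\<integral>\<omega>. (norm (k \<omega>))\<^sup>2 * (norm (B q \<omega> - B p \<omega>))\<^sup>2 \<partial>M) = CARD('d) * (q - p) * (\<integral>\<omega>. (norm (k \<omega>))\<^sup>2 \<partial>M)"
    using m(2) n by (simp add: has_bochner_integral_iff)
  note [measurable] = sq_integrable_measurable[OF k(1)] increment_measurable[OF pq]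
  have "sq_integrable M (\<lambda>\<omega>. norm (k \<omega>) * norm (B q \<omega> - B p \<omega>))"
    by (rule sq_integrableI) (measurable, use i in \<open>simp add: power_mult_distrib\<close>)
  then show "sq_integrable M (\<lambda>\<omega>. k \<omega> \<bullet> (B q \<omega> - B p \<omega>))"
    by (rule sq_integrable_bound[where c=1]) (use Cauchy_Schwarz_ineq2 in \<open>auto intro!: AE_I2\<close>)
qed

text \<open>The tested variable is itself the integral of a one-step integrand, and its interval may
  lie anywhere relative to [a, b]; the elementary identity is the covariance formula.\<close>

lemma ito_integral_times_increment:
  assumes J: "has_ito_integral M F B Z a b J" "0 \<le> a" "sq_integrable MT (slab a b Z)"
    and k: "sq_integrable M k" "k \<in> borel_measurable (F p)" and pq: "0 \<le> p" "p \<le> q"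
  shows "(\<integral>\<omega>. (k \<omega> \<bullet> (B q \<omega> - B p \<omega>)) * J \<omega> \<partial>M) = (\<integral>x. slab p q (\<lambda>_. k) x \<bullet> slab a b Z x \<partial>MT)"
proof (rule ito_integral_pairing(1)[OF J])
  fix r s :: real and h :: "'w \<Rightarrow> real ^ 'd" and K
  assume rs: "a \<le> r" "r \<le> s" "s \<le> b" and h: "h \<in> borel_measurable (F r)" "\<And>\<omega>. \<omega> \<in> space M \<Longrightarrow> norm (h \<omega>) \<le> K"
  note h2 = sq_integrable_of_bounded[OF measurable_F_M[OF h(1)] h(2)]
  show "(\<integral>\<omega>. (k \<omega> \<bullet> (B q \<omega> - B p \<omega>)) * (h \<omega> \<bullet> (B s \<omega> - B r \<omega>)) \<partial>M)
      = (\<integral>x. slab p q (\<lambda>_. k) x \<bullet> slab r s (\<lambda>_. h) x \<partial>MT)"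
    using increment_covariance_vec[OF pq _ rs(2) k h] rs(1) J(2) integral_slab_inner_const[OF k(1) h2]
    by (simp add: has_bochner_integral_iff)
qed (rule mult_increment_sq_integrable[OF k pq] slab_const_sq_integrable[OF k(1)])+

lemma ito_isometry:
  assumes J: "has_ito_integral M F B Z a b J" "0 \<le> a" "sq_integrable MT (slab a b Z)"
    and J': "has_ito_integral M F B Z' a' b' J'" "0 \<le> a'" "sq_integrable MT (slab a' b' Z')"
  shows "(\<integral>\<omega>. J \<omega> * J' \<omega> \<partial>M) = (\<integral>x. slab a b Z x \<bullet> slab a' b' Z' x \<partial>MT)"
proof (rule ito_integral_pairing(1)[OF J' ito_integral_sq_integrable[OF J] J(3)])
  fix r s :: real and h :: "'w \<Rightarrow> real ^ 'd" and K
  assume rs: "a' \<le> r" "r \<le> s" "s \<le> b'" and h: "h \<in> borel_measurable (F r)" "\<And>\<omega>. \<omega> \<in> space M \<Longrightarrow> norm (h \<omega>) \<le> K"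
  note h2 = sq_integrable_of_bounded[OF measurable_F_M[OF h(1)] h(2)]
  show "(\<integral>\<omega>. J \<omega> * (h \<omega> \<bullet> (B s \<omega> - B r \<omega>)) \<partial>M) = (\<integral>x. slab a b Z x \<bullet> slab r s (\<lambda>_. h) x \<partial>MT)"
    using ito_integral_times_increment[OF J h2 h(1) _ rs(2)] rs(1) J'(2)
    by (simp add: mult.commute inner_commute)
qed

end

section \<open>The negative part of a backward supersolution\<close>

lemma mult_le_half_squares: "p * q \<le> (p\<^sup>2 + q\<^sup>2) / 2" for p q :: real
  using inner_le_half_squares[of p q] by (simp add: abs_le_iff)

text \<open>The left side is - W (1 - x) v with the discrete density 1 - x. If v < 0, the inequality
  between product and half the squares suffices. If v >= 0, the term is harmful only for x > 1,
  where the density is negative; the last summand pays for that.\<close>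

lemma negative_part_step:
  fixes u v x d :: real
  assumes "d > 0" and W: "W = max (- u) 0"
  shows "- (W * v) + W * x * v \<le>
    W\<^sup>2 / 2 - W\<^sup>2 * x + W\<^sup>2 * x\<^sup>2 / 2 + (max (- v) 0)\<^sup>2 / 2 + (W\<^sup>2 * x ^ 4 / d + d * (v - u)\<^sup>2) / 2"
proof -
  have sq: "W\<^sup>2 / 2 - W\<^sup>2 * x + W\<^sup>2 * x\<^sup>2 / 2 = (W * (1 - x))\<^sup>2 / 2"
    by (simp add: power2_eq_square algebra_simps)
  have rest: "0 \<le> (W\<^sup>2 * x ^ 4 / d + d * (v - u)\<^sup>2) / 2" using assms by simp
  have W0: "0 \<le> W" using W by simp
  show ?thesis
  proof (cases "v < 0")
    case True
    have "- (W * v) + W * x * v = (W * (1 - x)) * (- v)" by (simp add: algebra_simps)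
    also have "\<dots> \<le> ((W * (1 - x))\<^sup>2 + (- v)\<^sup>2) / 2" by (rule mult_le_half_squares)
    finally show ?thesis using True rest unfolding sq by (simp add: add_divide_distrib)
  next
    case False
    have "- (W * v) + W * x * v \<le> (W\<^sup>2 * x ^ 4 / d + d * (v - u)\<^sup>2) / 2"
    proof (cases "x \<le> 1 \<or> W = 0")
      case True
      have "- (W * v) + W * x * v = W * v * (x - 1)" by (simp add: algebra_simps)
      also have "\<dots> \<le> 0"
      proof (cases "W = 0")
        case False
        then show ?thesis using True W0 \<open>\<not> v < 0\<close> by (intro mult_nonneg_nonpos) auto
      qed simp
      finally show ?thesis using rest by simp
    next
      \<comment> \<open>Here W > 0, so u = - W < 0 and v <= v - u. With x - 1 <= x^2 this trades the
        wrong sign for x^4, which is small in expectation, and for the increment v - u. The weight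
        \<open>d\<close> will be the length of the time step.\<close>
      case x: False
      then have "v \<le> v - u" "0 \<le> v - u" using False W by (auto simp: max_def split: if_splits)
      have "- (W * v) + W * x * v = W * ((x - 1) * v)" by (simp add: algebra_simps)
      also have "\<dots> \<le> W * (x\<^sup>2 * (v - u))"
      proof (intro mult_left_mono mult_mono)
        have "x * 1 \<le> x * x" using x by (intro mult_left_mono) auto
        then show "x - 1 \<le> x\<^sup>2" by (simp add: power2_eq_square)
      qed (use W0 False \<open>v \<le> v - u\<close> in auto)
      also have "\<dots> = (W * x\<^sup>2 / sqrt d) * (sqrt d * (v - u))" using assms(1) by simp
      also have "\<dots> \<le> ((W * x\<^sup>2 / sqrt d)\<^sup>2 + (sqrt d * (v - u))\<^sup>2) / 2" by (rule mult_le_half_squares)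
      also have "\<dots> = (W\<^sup>2 * x ^ 4 / d + d * (v - u)\<^sup>2) / 2"
        using assms(1) by (simp add: power_mult_distrib power_divide)
      finally show ?thesis .
    qed
    moreover have "(max (- v) 0)\<^sup>2 / 2 = 0" using False by simp
    moreover have "0 \<le> (W * (1 - x))\<^sup>2 / 2" by simp
    ultimately show ?thesis unfolding sq by linarith
  qed
qed

text \<open>A partition argument without sorted lists of points: splitting at a point of
  \<open>S\<close> strictly decreases the number of points of \<open>S\<close> inside the
  interval.\<close>

lemma interval_chain:
  fixes P :: "real \<Rightarrow> real \<Rightarrow> bool"
  assumes "finite S"
    and trans: "\<And>p s q. a \<le> p \<Longrightarrow> p < s \<Longrightarrow> s < q \<Longrightarrow> q \<le> b \<Longrightarrow> P p s \<Longrightarrow> P s q \<Longrightarrow> P p q"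
    and base: "\<And>p q. a \<le> p \<Longrightarrow> p < q \<Longrightarrow> q \<le> b \<Longrightarrow> S \<inter> {p<..<q} = {} \<Longrightarrow> P p q"
    and pq: "a \<le> p" "p < q" "q \<le> b"
  shows "P p q"
  using pq
proof (induction "card (S \<inter> {p<..<q})" arbitrary: p q rule: less_induct)
  case less
  show ?case
  proof (cases "S \<inter> {p<..<q} = {}")
    case True
    then show ?thesis using base less.prems by blast
  next
    case False
    then obtain s where s: "s \<in> S" "p < s" "s < q" by auto
    have "card (S \<inter> {p<..<s}) < card (S \<inter> {p<..<q})" "card (S \<inter> {s<..<q}) < card (S \<inter> {p<..<q})"
      using assms(1) s by (auto intro!: psubset_card_mono)
    then have "P p s" "P s q" using less s by auto
    then show ?thesis using trans less.prems s by blast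
  qed
qed

lemma finite_mesh:
  fixes a b d :: real
  assumes "d > 0"
  obtains S where "finite S" "\<And>p q. a \<le> p \<Longrightarrow> q \<le> b \<Longrightarrow> S \<inter> {p<..<q} = {} \<Longrightarrow> q - p \<le> d"
proof
  define N where "N = nat \<lceil>(b - a) / d\<rceil>"
  let ?S = "(\<lambda>i. a + d * real i) ` {..N}"
  show "finite ?S" by simp
  fix p q assume pq: "a \<le> p" "q \<le> b" "?S \<inter> {p<..<q} = {}"
  show "q - p \<le> d"
  proof (rule ccontr)
    assume "\<not> q - p \<le> d"
    \<comment> \<open>The first grid point strictly after \<open>p\<close>; adding 1 to the floor
      makes it strict. When q - p > d, this point still lies before \<open>q\<close>.\<close>
    define i where "i = nat \<lfloor>(p - a) / d\<rfloor> + 1"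
    have "0 \<le> (p - a) / d" using pq assms by simp
    then have i: "(p - a) / d < real i" "real i \<le> (p - a) / d + 1" unfolding i_def by linarith+
    then have "p < a + d * real i" "a + d * real i \<le> p + d" using assms by (auto simp: field_simps)
    moreover have "i \<le> N"
    proof -
      have "d * real i \<le> b - a" using calculation \<open>\<not> q - p \<le> d\<close> pq by linarith
      then have "real i \<le> (b - a) / d" using assms by (simp add: field_simps)
      then show ?thesis unfolding N_def by linarith
    qed
    ultimately have "a + d * real i \<in> ?S \<inter> {p<..<q}" using \<open>\<not> q - p \<le> d\<close> by auto
    then show False using pq by blast
  qed
qed

context brownian_space begin

text \<open>What is used of a stochastic integral over (p, q]: orthogonality to the past, the
  pairing with one-step integrals, and a second moment bound. The bound is by a separate process
  \<open>m\<close> instead of the squared norm of \<open>V\<close>, so that it passes to differences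
  by (x - y)^2 <= 2 x^2 + 2 y^2.\<close>

definition ito_increment ::
    "real \<Rightarrow> real \<Rightarrow> ('w, real ^ 'd) process \<Rightarrow> ('w, real) process \<Rightarrow> ('w \<Rightarrow> real) \<Rightarrow> bool" where
  "ito_increment p q V m L \<longleftrightarrow> sq_integrable M L \<and>
    (\<forall>G. sq_integrable M G \<longrightarrow> G \<in> borel_measurable (F p) \<longrightarrow> (\<integral>\<omega>. G \<omega> * L \<omega> \<partial>M) = 0) \<and>
    (\<forall>k. sq_integrable M k \<longrightarrow> k \<in> borel_measurable (F p) \<longrightarrow>
      (\<integral>\<omega>. (k \<omega> \<bullet> (B q \<omega> - B p \<omega>)) * L \<omega> \<partial>M) = (\<integral>x. slab p q (\<lambda>_. k) x \<bullet> slab p q V x \<partial>MT)) \<and>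
    (\<integral>\<omega>. (L \<omega>)\<^sup>2 \<partial>M) \<le> (\<integral>x. slab p q m x \<partial>MT)"

text \<open>\<open>S\<close> holds the possible jump times. Quantifying over intervals without a
  point of \<open>S\<close> inside lets \<open>S\<close> be enlarged, for a common refinement of two
  processes or by a fine mesh.\<close>

definition predictable_step :: "real \<Rightarrow> real \<Rightarrow> real set \<Rightarrow> ('w, real ^ 'd) process \<Rightarrow> bool" where
  "predictable_step a b S v \<longleftrightarrow> finite S \<and>
    (\<forall>p q. a \<le> p \<longrightarrow> p < q \<longrightarrow> q \<le> b \<longrightarrow> S \<inter> {p<..<q} = {} \<longrightarrow>
      (\<exists>w \<in> borel_measurable (F p). \<forall>s\<in>{p<..q}. \<forall>\<omega>\<in>space M. v s \<omega> = w \<omega>))"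

text \<open>Supplies, on a short interval, an \<open>F p\<close>-measurable stand-in for
  \<open>V\<close> whose direction enters the second test.\<close>

definition approximable :: "real \<Rightarrow> real \<Rightarrow> ('w, real ^ 'd) process \<Rightarrow> bool" where
  "approximable a b V \<longleftrightarrow> (\<forall>\<epsilon>>0. \<exists>S v. predictable_step a b S v \<and> sq_integrable MT (slab a b v) \<and>
    (\<integral>x. (norm (slab a b V x - slab a b v x))\<^sup>2 \<partial>MT) \<le> \<epsilon>)"

lemma approximableE:
  assumes "approximable a b V" "0 < \<epsilon>"
  obtains S v where "predictable_step a b S v" "sq_integrable MT (slab a b v)"
    "(\<integral>x. (norm (slab a b V x - slab a b v x))\<^sup>2 \<partial>MT) \<le> \<epsilon>"
  using assms(1)[unfolded approximable_def, rule_format, OF assms(2)] by (elim exE conjE) (rule that)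

lemma approximableI:
  assumes "\<And>\<epsilon>. 0 < \<epsilon> \<Longrightarrow> \<exists>S v. predictable_step a b S v \<and> sq_integrable MT (slab a b v) \<and>
    (\<integral>x. (norm (slab a b V x - slab a b v x))\<^sup>2 \<partial>MT) \<le> \<epsilon>"
  shows "approximable a b V"
  using assms unfolding approximable_def by (intro allI impI)

lemma predictable_stepE:
  assumes "predictable_step a b S v" "a \<le> p" "p < q" "q \<le> b" "S \<inter> {p<..<q} = {}"
  obtains w where "w \<in> borel_measurable (F p)" "\<And>s \<omega>. s \<in> {p<..q} \<Longrightarrow> \<omega> \<in> space M \<Longrightarrow> v s \<omega> = w \<omega>"
  using assms(1)[unfolded predictable_step_def, THEN conjunct2, rule_format, OF assms(2-5)]
  by (elim bexE) (rule that, auto)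

end

text \<open>The driver has been replaced by its value along the solution, a process \<open>f\<close>
  with a lower bound. The variable \<open>L\<close> may be chosen afresh for each interval, and
  \<open>U\<close> enters through fixed times and its slab only, not through its paths.\<close>

locale bsde_supersolution = brownian_space M B for M :: "'w measure" and B :: "('w, real ^ 'd) process" +
  fixes a b C :: real and U f m :: "('w, real) process" and V :: "('w, real ^ 'd) process"
  assumes a0: "0 \<le> a" and C0: "0 \<le> C"
    and U_adapted: "\<And>t. a \<le> t \<Longrightarrow> t \<le> b \<Longrightarrow> U t \<in> borel_measurable (F t)"
    and U_L2: "\<And>t. a \<le> t \<Longrightarrow> t \<le> b \<Longrightarrow> sq_integrable M (U t)"
    and U_MT: "sq_integrable MT (slab a b U)"
    and f_MT: "sq_integrable MT (slab a b f)"
    and V_MT: "sq_integrable MT (slab a b V)"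
    and m_MT: "integrable MT (slab a b m)" and m0: "\<And>s \<omega>. 0 \<le> m s \<omega>"
    and dynamics: "\<And>p q. a \<le> p \<Longrightarrow> p \<le> q \<Longrightarrow> q \<le> b \<Longrightarrow> \<exists>L. ito_increment p q V m L \<and>
      (AE \<omega> in M. U p \<omega> = U q \<omega> + (\<integral>s. slab p q f (\<omega>, s) \<partial>lborel) - L \<omega>)"
    and generator: "AE x in MT. a < snd x \<and> snd x \<le> b \<longrightarrow>
      ev f x \<ge> - C * (\<bar>ev U x\<bar> + norm (ev V x))"
    and V_approx: "approximable a b V"
begin

definition drift :: "real \<Rightarrow> real \<Rightarrow> 'w \<Rightarrow> real" where
  "drift p q \<omega> = (\<integral>s. slab p q f (\<omega>, s) \<partial>lborel)"

text \<open>An additive function of the interval that dominates E (U_q - U_p)^2 for q - p <= 1.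
  Additivity lets errors of the form (q - p) * energy be summed over a partition. The factors 2 come
  from squaring a sum of two terms.\<close>

definition energy :: "real \<Rightarrow> real \<Rightarrow> real" where
  "energy p q = (\<integral>x. slab p q (\<lambda>s \<omega>. 2 * (f s \<omega>)\<^sup>2 + 2 * m s \<omega>) x \<partial>MT)"

definition \<Phi> :: "real \<Rightarrow> real" where
  "\<Phi> t = (\<integral>\<omega>. (max (- U t \<omega>) 0)\<^sup>2 \<partial>M)"

lemma f_sub: "a \<le> p \<Longrightarrow> q \<le> b \<Longrightarrow> sq_integrable MT (slab p q f)"
  by (rule slab_sq_integrable_sub[OF f_MT])

lemma m_sub: "a \<le> p \<Longrightarrow> q \<le> b \<Longrightarrow> integrable MT (slab p q m)"
  by (rule slab_integrable_sub[OF m_MT])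

lemma energy_integrand:
  assumes "a \<le> p" "q \<le> b"
  shows "integrable MT (slab p q (\<lambda>s \<omega>. 2 * (f s \<omega>)\<^sup>2 + 2 * m s \<omega>))"
    and "energy p q = 2 * (\<integral>x. (slab p q f x)\<^sup>2 \<partial>MT) + 2 * (\<integral>x. slab p q m x \<partial>MT)"
proof -
  have eq: "slab p q (\<lambda>s \<omega>. 2 * (f s \<omega>)\<^sup>2 + 2 * m s \<omega>) = (\<lambda>x. 2 * (slab p q f x)\<^sup>2 + 2 * slab p q m x)"
    by (auto simp: fun_eq_iff slab_def indicator_def)
  note i = sq_integrable_sq[OF f_sub[OF assms]] m_sub[OF assms]
  show "integrable MT (slab p q (\<lambda>s \<omega>. 2 * (f s \<omega>)\<^sup>2 + 2 * m s \<omega>))" unfolding eq using i by simp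
  show "energy p q = 2 * (\<integral>x. (slab p q f x)\<^sup>2 \<partial>MT) + 2 * (\<integral>x. slab p q m x \<partial>MT)"
    unfolding energy_def eq using i by simp
qed

lemma slab_m_nonneg: "0 \<le> slab p q m x"
  by (simp add: slab_def m0)

lemma drift_pairing:
  assumes pq: "a \<le> p" "q \<le> b" and G: "sq_integrable M G"
  shows "(\<integral>\<omega>. G \<omega> * drift p q \<omega> \<partial>M) = (\<integral>x. slab p q (\<lambda>_. G) x * slab p q f x \<partial>MT)"
proof -
  have "integrable MT (\<lambda>x. slab p q (\<lambda>_. G) x * slab p q f x)"
    by (intro integrable_mult_sq slab_const_sq_integrable G f_sub pq)
  then have "(\<integral>x. slab p q (\<lambda>_. G) x * slab p q f x \<partial>MT)
      = (\<integral>\<omega>. \<integral>s. slab p q (\<lambda>_. G) (\<omega>, s) * slab p q f (\<omega>, s) \<partial>lborel \<partial>M)"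
    by (rule MT.integral_fst'[symmetric])
  also have "\<dots> = (\<integral>\<omega>. \<integral>s. G \<omega> * slab p q f (\<omega>, s) \<partial>lborel \<partial>M)"
    by (intro Bochner_Integration.integral_cong refl) (simp add: slab_apply indicator_def)
  finally show ?thesis by (simp add: drift_def)
qed

lemma drift_L2:
  assumes "a \<le> p" "p \<le> q" "q \<le> b"
  shows "sq_integrable M (drift p q)"
    and "(\<integral>\<omega>. (drift p q \<omega>)\<^sup>2 \<partial>M) \<le> (q - p) * (\<integral>x. (slab p q f x)\<^sup>2 \<partial>MT)"
  using slab_section_integral(2,3)[OF f_sub[OF assms(1,3)] assms(2)] by (simp_all add: drift_def[abs_def])

lemma dynamics':
  assumes pq: "a \<le> p" "p \<le> q" "q \<le> b"
  obtains L where "ito_increment p q V m L" "AE \<omega> in M. U p \<omega> = U q \<omega> + drift p q \<omega> - L \<omega>"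
    "sq_integrable M (drift p q)"
  using dynamics[OF pq] drift_L2(1)[OF pq] unfolding drift_def by blast

text \<open>The increment of \<open>U\<close> is \<open>L\<close> minus the drift; the drift brings
  an extra factor q - p, which is estimated by 1.\<close>

lemma increment_energy:
  assumes pq: "a \<le> p" "p \<le> q" "q \<le> b" "q - p \<le> 1"
  shows "(\<integral>\<omega>. (U q \<omega> - U p \<omega>)\<^sup>2 \<partial>M) \<le> energy p q"
proof -
  obtain L where L: "ito_increment p q V m L" "AE \<omega> in M. U p \<omega> = U q \<omega> + drift p q \<omega> - L \<omega>"
    "sq_integrable M (drift p q)" using dynamics'[OF pq(1-3)] .
  have L2: "sq_integrable M L" "(\<integral>\<omega>. (L \<omega>)\<^sup>2 \<partial>M) \<le> (\<integral>x. slab p q m x \<partial>MT)"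
    using L(1) by (auto simp: ito_increment_def)
  note i = sq_integrable_sq[OF L(3)] sq_integrable_sq[OF L2(1)]
  have "(\<integral>\<omega>. (U q \<omega> - U p \<omega>)\<^sup>2 \<partial>M) \<le> (\<integral>\<omega>. 2 * (drift p q \<omega>)\<^sup>2 + 2 * (L \<omega>)\<^sup>2 \<partial>M)"
  proof (rule integral_mono_AE)
    show "integrable M (\<lambda>\<omega>. (U q \<omega> - U p \<omega>)\<^sup>2)"
      using pq by (intro sq_integrable_sq sq_integrable_diff U_L2) auto
    show "AE \<omega> in M. (U q \<omega> - U p \<omega>)\<^sup>2 \<le> 2 * (drift p q \<omega>)\<^sup>2 + 2 * (L \<omega>)\<^sup>2"
      using L(2)
    proof eventually_elim
      fix \<omega> assume "U p \<omega> = U q \<omega> + drift p q \<omega> - L \<omega>"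
      then have "U q \<omega> - U p \<omega> = L \<omega> + (- drift p q \<omega>)" by simp
      then show "(U q \<omega> - U p \<omega>)\<^sup>2 \<le> 2 * (drift p q \<omega>)\<^sup>2 + 2 * (L \<omega>)\<^sup>2"
        using norm_add_sq_le[of "L \<omega>" "- drift p q \<omega>"] by simp
    qed
  qed (use i in auto)
  also have "\<dots> = 2 * (\<integral>\<omega>. (drift p q \<omega>)\<^sup>2 \<partial>M) + 2 * (\<integral>\<omega>. (L \<omega>)\<^sup>2 \<partial>M)" using i by simp
  also have "\<dots> \<le> 2 * (\<integral>x. (slab p q f x)\<^sup>2 \<partial>MT) + 2 * (\<integral>x. slab p q m x \<partial>MT)"
  proof -
    have "(q - p) * (\<integral>x. (slab p q f x)\<^sup>2 \<partial>MT) \<le> 1 * (\<integral>x. (slab p q f x)\<^sup>2 \<partial>MT)"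
      using pq by (intro mult_right_mono) auto
    then show ?thesis using drift_L2(2)[OF pq(1-3)] L2(2) by simp
  qed
  finally show ?thesis using energy_integrand(2)[OF pq(1,3)] by simp
qed

lemma energy_mono:
  assumes "a \<le> p" "p \<le> s" "s \<le> q" "q \<le> b"
  shows "energy p s \<le> energy p q"
  unfolding energy_def
  by (rule integral_mono[OF energy_integrand(1) energy_integrand(1)])
    (use assms m0 in \<open>auto simp: slab_def indicator_def intro!: add_nonneg_nonneg\<close>)

text \<open>A substitute for path continuity of \<open>U\<close>: at each fixed time s in (p, q] the
  increment from p has second moment at most the energy, and integrating over s by Fubini yields the
  factor q - p.\<close>

lemma oscillation_energy:
  assumes pq: "a \<le> p" "p \<le> q" "q \<le> b" "q - p \<le> 1"
  shows "integrable MT (\<lambda>x. (slab p q U x - slab p q (\<lambda>_. U p) x)\<^sup>2)"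
    and "(\<integral>x. (slab p q U x - slab p q (\<lambda>_. U p) x)\<^sup>2 \<partial>MT) \<le> (q - p) * energy p q"
proof -
  define h where "h \<omega> s = (slab p q U (\<omega>, s) - slab p q (\<lambda>_. U p) (\<omega>, s))\<^sup>2" for \<omega> s
  have h: "case_prod h = (\<lambda>x. (slab p q U x - slab p q (\<lambda>_. U p) x)\<^sup>2)"
    by (simp add: h_def fun_eq_iff)
  have "sq_integrable MT (\<lambda>x. slab p q U x - slab p q (\<lambda>_. U p) x)"
    using pq by (intro sq_integrable_diff slab_sq_integrable_sub[OF U_MT] slab_const_sq_integrable U_L2) auto
  from sq_integrable_sq[OF this] show i: "integrable MT (\<lambda>x. (slab p q U x - slab p q (\<lambda>_. U p) x)\<^sup>2)" .
  then have i': "integrable MT (case_prod h)" by (simp add: h)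
  have "(\<integral>x. (slab p q U x - slab p q (\<lambda>_. U p) x)\<^sup>2 \<partial>MT) = (\<integral>s. \<integral>\<omega>. h \<omega> s \<partial>M \<partial>lborel)"
    using MT.integral_snd[OF i'] by (simp add: h)
  also have "\<dots> \<le> (\<integral>s. indicator {p<..q} s * energy p q \<partial>lborel)"
  proof (rule integral_mono[OF MT.integrable_snd[OF i']])
    show "integrable lborel (\<lambda>s. indicator {p<..q} s * energy p q)"
      using pq by (intro integrable_mult_left) simp
    fix s
    show "(\<integral>\<omega>. h \<omega> s \<partial>M) \<le> indicator {p<..q} s * energy p q"
    proof (cases "s \<in> {p<..q}")
      case True
      then have "(\<integral>\<omega>. h \<omega> s \<partial>M) = (\<integral>\<omega>. (U s \<omega> - U p \<omega>)\<^sup>2 \<partial>M)" by (simp add: h_def slab_apply)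
      also have "\<dots> \<le> energy p s" using True pq by (intro increment_energy) auto
      also have "\<dots> \<le> energy p q" using True pq by (intro energy_mono) auto
      finally show ?thesis using True by simp
    qed (simp add: h_def slab_apply)
  qed
  also have "\<dots> = (q - p) * energy p q" using pq by simp
  finally show "(\<integral>x. (slab p q U x - slab p q (\<lambda>_. U p) x)\<^sup>2 \<partial>MT) \<le> (q - p) * energy p q" .
qed

end

text \<open>The vector C W sgn w replaces C W |v| by a term linear in v: as sgn w . w = |w|, the
  defect |v| - sgn w . v is at most 2 |v - w|. Where W is nonzero, |u| = W, hence W |u'| <= W^2 + W
  |u' - u|. Estimating the products by squares gives the constants 3/2 C and C^2.\<close>

lemma generator_linearized:
  fixes v w :: "'a::real_inner" and C :: real
  assumes C0: "0 \<le> C" and W: "W = max (- u) 0" and f: "y \<ge> - C * (\<bar>u'\<bar> + norm v)"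
  shows "- (W * y) - ((C * W) *\<^sub>R sgn w) \<bullet> v
    \<le> (3 / 2 * C + C\<^sup>2) * W\<^sup>2 + C / 2 * (u' - u)\<^sup>2 + (norm (v - w))\<^sup>2"
proof -
  have W0: "0 \<le> W" using W by simp
  have cw: "sgn w \<bullet> w = norm w" by (cases "w = 0") (auto simp: sgn_div_norm power2_norm_eq_inner[symmetric] power2_eq_square)
  have "norm w - sgn w \<bullet> v = sgn w \<bullet> (w - v)" by (simp add: inner_diff_right cw)
  also have "\<dots> \<le> norm (sgn w) * norm (w - v)" by (rule norm_cauchy_schwarz)
  also have "\<dots> \<le> 1 * norm (w - v)" by (intro mult_right_mono) (auto simp: norm_sgn)
  finally have V: "norm v - sgn w \<bullet> v \<le> 2 * norm (v - w)"
    using norm_triangle_ineq2[of v w] by (simp add: norm_minus_commute)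
  have "- (W * y) - ((C * W) *\<^sub>R sgn w) \<bullet> v = W * (- y) - C * W * (sgn w \<bullet> v)" by simp
  also have "\<dots> \<le> W * (C * (\<bar>u'\<bar> + norm v)) - C * W * (sgn w \<bullet> v)"
    using f W0 by (intro diff_right_mono mult_left_mono) auto
  also have "\<dots> = C * (W * \<bar>u'\<bar>) + C * W * (norm v - sgn w \<bullet> v)" by (simp add: algebra_simps)
  also have "\<dots> \<le> C * (3 / 2 * W\<^sup>2 + (u' - u)\<^sup>2 / 2) + C * W * (2 * norm (v - w))"
  proof (intro add_mono mult_left_mono V)
    have "W * \<bar>u'\<bar> \<le> W * (W + \<bar>u' - u\<bar>)"
    proof (cases "W = 0")
      case False
      then have "\<bar>u\<bar> = W" using W by (auto simp: max_def split: if_splits)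
      then show ?thesis using W0 by (intro mult_left_mono) auto
    qed simp
    also have "\<dots> = W\<^sup>2 + W * \<bar>u' - u\<bar>" by (simp add: power2_eq_square algebra_simps)
    finally show "W * \<bar>u'\<bar> \<le> 3 / 2 * W\<^sup>2 + (u' - u)\<^sup>2 / 2"
      using mult_le_half_squares[of W "\<bar>u' - u\<bar>"] by simp
  qed (use C0 W0 in auto)
  also have "C * W * (2 * norm (v - w)) \<le> C\<^sup>2 * W\<^sup>2 + (norm (v - w))\<^sup>2"
    using mult_le_half_squares[of "C * W" "norm (v - w)"] by (simp add: power_mult_distrib)
  finally show ?thesis by (simp add: algebra_simps)
qed

context bsde_supersolution begin

text \<open>Twice the coefficients of (q - p) E W^2 collected in \<open>one_step\<close>, in
  dimension d: C^2 d / 2 occurs there two times, 3 C^4 d^2 / 2 comes from the fourth moment, and 3/2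
  C + C^2 from \<open>generator_linearized\<close>. The doubling is due to a term E W^2 / 2 that is
  moved to the left.\<close>

definition rate :: real where
  "rate = 2 * C\<^sup>2 * CARD('d) + 3 * C ^ 4 * (CARD('d))\<^sup>2 + 3 * C + 2 * C\<^sup>2"

lemma negative_part_L2:
  assumes "a \<le> t" "t \<le> b"
  shows "sq_integrable M (\<lambda>\<omega>. max (- U t \<omega>) 0)"
  using U_L2[OF assms]
  by (rule sq_integrable_bound[where c=1]) (use sq_integrable_measurable[OF U_L2[OF assms]] in auto)

text \<open>Since \<open>W = U\<^sub>p\<^sup>-\<close> and \<open>k = C W sgn w\<close> are known at time \<open>p\<close>, testing the dynamics with \<open>W\<close> and with
  \<open>k \<bullet> (B\<^sub>q - B\<^sub>p)\<close> gives \<open>E W\<^sup>2 = E (-W + k \<bullet> (B\<^sub>q - B\<^sub>p)) U\<^sub>q + \<dots>\<close>; the weight \<open>1 - C sgn w \<bullet> (B\<^sub>q - B\<^sub>p)\<close>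
  is a discrete Girsanov density that absorbs the \<open>V\<close>-dependence of the generator.\<close>

lemma one_step:
  assumes pq: "a \<le> p" "p < q" "q \<le> b" "q - p \<le> 1" and w: "w \<in> borel_measurable (F p)"
    and wV: "integrable MT (\<lambda>x. (norm (slab p q V x - slab p q (\<lambda>_. w) x))\<^sup>2)"
  shows "(1 - rate * (q - p)) * \<Phi> p \<le> \<Phi> q + (2 + C) * (q - p) * energy p q
    + 2 * (\<integral>x. (norm (slab p q V x - slab p q (\<lambda>_. w) x))\<^sup>2 \<partial>MT)"
proof -
  define d where "d = q - p"
  have d: "0 < d" "d \<le> 1" using pq by (auto simp: d_def)
  have pq': "0 \<le> p" "p \<le> q" "p \<le> b" "a \<le> q" using pq a0 by auto
  define W where "W \<omega> = max (- U p \<omega>) 0" for \<omega>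
  define x where "x \<omega> = C * (sgn (w \<omega>) \<bullet> (B q \<omega> - B p \<omega>))" for \<omega>
  define k where "k \<omega> = (C * W \<omega>) *\<^sub>R sgn (w \<omega>)" for \<omega>
  have kx: "k \<omega> \<bullet> (B q \<omega> - B p \<omega>) = W \<omega> * x \<omega>" for \<omega> by (simp add: k_def x_def)
  have WF[measurable]: "W \<in> borel_measurable (F p)" unfolding W_def using U_adapted[OF pq(1) pq'(3)] by measurable
  have sF[measurable]: "(\<lambda>\<omega>. sgn (w \<omega>)) \<in> borel_measurable (F p)"
    using w unfolding sgn_div_norm by measurable
  have W2: "sq_integrable M W" unfolding W_def by (rule negative_part_L2[OF pq(1) pq'(3)])
  have kF: "k \<in> borel_measurable (F p)" unfolding k_def by measurable
  have norm_k: "norm (k \<omega>) \<le> C * \<bar>W \<omega>\<bar>" for \<omega>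
    using C0 mult_left_mono[of "norm (sgn (w \<omega>))" 1 "C * \<bar>W \<omega>\<bar>"] by (simp add: k_def abs_mult norm_sgn)
  have k2: "sq_integrable M k"
    by (rule sq_integrable_bound[OF W2 measurable_F_M[OF kF]]) (use norm_k in auto)
  have x_le: "\<bar>x \<omega>\<bar> \<le> C * norm (B q \<omega> - B p \<omega>)" for \<omega>
  proof -
    have "\<bar>sgn (w \<omega>) \<bullet> (B q \<omega> - B p \<omega>)\<bar> \<le> norm (sgn (w \<omega>)) * norm (B q \<omega> - B p \<omega>)" by (rule Cauchy_Schwarz_ineq2)
    also have "\<dots> \<le> 1 * norm (B q \<omega> - B p \<omega>)" by (intro mult_right_mono) (auto simp: norm_sgn)
    finally show ?thesis using C0 by (simp add: x_def abs_mult mult_left_mono)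
  qed
  have x_meas[measurable]: "x \<in> borel_measurable M"
    unfolding x_def using measurable_F_M[OF sF] increment_measurable[OF pq'(1,2)] by measurable
  have [measurable]: "W \<in> borel_measurable M" by (rule measurable_F_M[OF WF])
  have Wx2: "sq_integrable M (\<lambda>\<omega>. W \<omega> * x \<omega>)"
    using mult_increment_sq_integrable(1)[OF k2 kF pq'(1,2)] unfolding kx .
  let ?A = "\<integral>\<omega>. (W \<omega>)\<^sup>2 \<partial>M"
  have A0: "0 \<le> ?A" by simp
  have Uq2: "sq_integrable M (U q)" and Up2: "sq_integrable M (U p)" by (auto intro!: U_L2 pq pq')
  obtain L where L: "ito_increment p q V m L" "AE \<omega> in M. U p \<omega> = U q \<omega> + drift p q \<omega> - L \<omega>"
    and I2: "sq_integrable M (drift p q)" using dynamics'[OF pq(1) pq'(2) pq(3)] .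
  have L2: "sq_integrable M L" and LW: "(\<integral>\<omega>. W \<omega> * L \<omega> \<partial>M) = 0"
    and Lk: "(\<integral>\<omega>. (W \<omega> * x \<omega>) * L \<omega> \<partial>M) = (\<integral>x. slab p q (\<lambda>_. k) x \<bullet> slab p q V x \<partial>MT)"
    using L(1) W2 WF k2 kF by (auto simp: ito_increment_def kx[symmetric])
  \<comment> \<open>The coefficient W^2 sgn w is known at time \<open>p\<close> and integrable, so
    it is orthogonal to the increment. Because W U_p = - W^2, this says that \<open>U p\<close>
    contributes nothing to the second test.\<close>
  have W2x: "has_bochner_integral M (\<lambda>\<omega>. (W \<omega>)\<^sup>2 * x \<omega>) 0"
  proof -
    have "(\<lambda>\<omega>. (C * (W \<omega>)\<^sup>2) *\<^sub>R sgn (w \<omega>)) \<in> borel_measurable (F p)" by measurable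
    moreover have "integrable M (\<lambda>\<omega>. (C * (W \<omega>)\<^sup>2) *\<^sub>R sgn (w \<omega>))"
    proof (rule Bochner_Integration.integrable_bound)
      show "integrable M (\<lambda>\<omega>. C * (W \<omega>)\<^sup>2)" using sq_integrable_sq[OF W2] by simp
    qed (use measurable_F_M[OF calculation] C0 in \<open>auto simp: norm_sgn\<close>)
    ultimately show ?thesis
      using inner_increment_zero[OF pq'(1,2), of "\<lambda>\<omega>. (C * (W \<omega>)\<^sup>2) *\<^sub>R sgn (w \<omega>)"] by (simp add: x_def mult_ac)
  qed
  have WU: "W \<omega> * U p \<omega> = - (W \<omega>)\<^sup>2" for \<omega>
    by (auto simp: W_def max_def power2_eq_square)
  note int = integrable_mult_sq
  \<comment> \<open>The first test gives E W^2 = - E W U_q - E W drift, the second 0 = E W x (U_q +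
    drift - L); the claim is their sum. The term with \<open>L\<close> is kept because it carries
    the integral of k . V.\<close>
  have A_eq: "?A = (\<integral>\<omega>. - (W \<omega> * U q \<omega>) + W \<omega> * x \<omega> * U q \<omega> \<partial>M)
      + (\<integral>\<omega>. (W \<omega> * x \<omega>) * drift p q \<omega> \<partial>M) - (\<integral>\<omega>. W \<omega> * drift p q \<omega> \<partial>M) - (\<integral>\<omega>. (W \<omega> * x \<omega>) * L \<omega> \<partial>M)"
  proof -
    have "- ?A = (\<integral>\<omega>. W \<omega> * U q \<omega> + W \<omega> * drift p q \<omega> - W \<omega> * L \<omega> \<partial>M)"
    proof -
      have "- ?A = (\<integral>\<omega>. W \<omega> * U p \<omega> \<partial>M)" by (simp add: WU)
      also have "\<dots> = (\<integral>\<omega>. W \<omega> * U q \<omega> + W \<omega> * drift p q \<omega> - W \<omega> * L \<omega> \<partial>M)"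
      proof (rule integral_cong_AE)
        show "AE \<omega> in M. W \<omega> * U p \<omega> = W \<omega> * U q \<omega> + W \<omega> * drift p q \<omega> - W \<omega> * L \<omega>"
          using L(2)
        proof eventually_elim
          fix \<omega> assume e: "U p \<omega> = U q \<omega> + drift p q \<omega> - L \<omega>"
          show "W \<omega> * U p \<omega> = W \<omega> * U q \<omega> + W \<omega> * drift p q \<omega> - W \<omega> * L \<omega>"
            unfolding e by (simp add: algebra_simps)
        qed
      qed (use int[OF W2 Up2] int[OF W2 Uq2] int[OF W2 I2] int[OF W2 L2] in auto)
      finally show ?thesis .
    qed
    also have "\<dots> = (\<integral>\<omega>. W \<omega> * U q \<omega> \<partial>M) + (\<integral>\<omega>. W \<omega> * drift p q \<omega> \<partial>M)"
      using int[OF W2 Uq2] int[OF W2 I2] int[OF W2 L2] LW by simp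
    finally have 1: "?A = - (\<integral>\<omega>. W \<omega> * U q \<omega> \<partial>M) - (\<integral>\<omega>. W \<omega> * drift p q \<omega> \<partial>M)" by simp
    have "0 = (\<integral>\<omega>. (W \<omega> * x \<omega>) * U p \<omega> \<partial>M)"
    proof -
      have "(W \<omega> * x \<omega>) * U p \<omega> = - ((W \<omega>)\<^sup>2 * x \<omega>)" for \<omega> using arg_cong[OF WU[of \<omega>], of "\<lambda>u. u * x \<omega>"] by (simp add: mult_ac)
      then show ?thesis using W2x by (simp add: has_bochner_integral_iff)
    qed
    also have "\<dots> = (\<integral>\<omega>. (W \<omega> * x \<omega>) * U q \<omega> + (W \<omega> * x \<omega>) * drift p q \<omega> - (W \<omega> * x \<omega>) * L \<omega> \<partial>M)"
    proof (rule integral_cong_AE)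
      show "AE \<omega> in M. (W \<omega> * x \<omega>) * U p \<omega> = (W \<omega> * x \<omega>) * U q \<omega> + (W \<omega> * x \<omega>) * drift p q \<omega> - (W \<omega> * x \<omega>) * L \<omega>"
        using L(2)
      proof eventually_elim
        fix \<omega> assume e: "U p \<omega> = U q \<omega> + drift p q \<omega> - L \<omega>"
        show "(W \<omega> * x \<omega>) * U p \<omega> = (W \<omega> * x \<omega>) * U q \<omega> + (W \<omega> * x \<omega>) * drift p q \<omega> - (W \<omega> * x \<omega>) * L \<omega>"
          unfolding e by (simp add: algebra_simps)
      qed
    qed (use int[OF Wx2 Up2] int[OF Wx2 Uq2] int[OF Wx2 I2] int[OF Wx2 L2] in auto)
    also have "\<dots> = (\<integral>\<omega>. (W \<omega> * x \<omega>) * U q \<omega> \<partial>M) + (\<integral>\<omega>. (W \<omega> * x \<omega>) * drift p q \<omega> \<partial>M) - (\<integral>\<omega>. (W \<omega> * x \<omega>) * L \<omega> \<partial>M)"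
      using int[OF Wx2 Uq2] int[OF Wx2 I2] int[OF Wx2 L2] by simp
    finally show ?thesis using 1 int[OF W2 Uq2] int[OF Wx2 Uq2] by simp
  qed
  have Wx_sq: "integrable M (\<lambda>\<omega>. (W \<omega>)\<^sup>2 * (x \<omega>)\<^sup>2)" "(\<integral>\<omega>. (W \<omega>)\<^sup>2 * (x \<omega>)\<^sup>2 \<partial>M) \<le> C\<^sup>2 * CARD('d) * d * ?A"
  proof -
    show i: "integrable M (\<lambda>\<omega>. (W \<omega>)\<^sup>2 * (x \<omega>)\<^sup>2)"
      using sq_integrable_sq[OF Wx2] by (simp add: power_mult_distrib)
    have "(\<integral>\<omega>. (W \<omega>)\<^sup>2 * (x \<omega>)\<^sup>2 \<partial>M) \<le> (\<integral>\<omega>. (norm (k \<omega>))\<^sup>2 * (norm (B q \<omega> - B p \<omega>))\<^sup>2 \<partial>M)"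
    proof (rule integral_mono[OF i mult_increment_sq_integrable(2)[OF k2 kF pq'(1,2)]])
      fix \<omega>
      have "\<bar>W \<omega> * x \<omega>\<bar> \<le> norm (k \<omega>) * norm (B q \<omega> - B p \<omega>)"
        unfolding kx[symmetric] by (rule Cauchy_Schwarz_ineq2)
      then have "\<bar>W \<omega> * x \<omega>\<bar>\<^sup>2 \<le> (norm (k \<omega>) * norm (B q \<omega> - B p \<omega>))\<^sup>2" by (intro power_mono) auto
      then show "(W \<omega>)\<^sup>2 * (x \<omega>)\<^sup>2 \<le> (norm (k \<omega>))\<^sup>2 * (norm (B q \<omega> - B p \<omega>))\<^sup>2"
        by (simp add: power_mult_distrib)
    qed
    also have "\<dots> = CARD('d) * d * (\<integral>\<omega>. (norm (k \<omega>))\<^sup>2 \<partial>M)"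
      using mult_increment_sq_integrable(3)[OF k2 kF pq'(1,2)] by (simp add: d_def)
    also have "\<dots> \<le> CARD('d) * d * (\<integral>\<omega>. C\<^sup>2 * (W \<omega>)\<^sup>2 \<partial>M)"
    proof (intro mult_left_mono integral_mono sq_integrable_norm_sq[OF k2])
      show "integrable M (\<lambda>\<omega>. C\<^sup>2 * (W \<omega>)\<^sup>2)" using sq_integrable_sq[OF W2] by simp
      fix \<omega>
      show "(norm (k \<omega>))\<^sup>2 \<le> C\<^sup>2 * (W \<omega>)\<^sup>2"
        using power_mono[OF norm_k[of \<omega>], of 2] by (simp add: power_mult_distrib)
    qed (use d in auto)
    finally show "(\<integral>\<omega>. (W \<omega>)\<^sup>2 * (x \<omega>)\<^sup>2 \<partial>M) \<le> C\<^sup>2 * CARD('d) * d * ?A" by (simp add: mult_ac)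
  qed
  \<comment> \<open>Of order d^2, with \<open>d\<close> the step length; after the division by
    \<open>d\<close> in \<open>negative_part_step\<close> it is of order d.\<close>
  have Wx_4: "integrable M (\<lambda>\<omega>. (W \<omega>)\<^sup>2 * x \<omega> ^ 4)" "(\<integral>\<omega>. (W \<omega>)\<^sup>2 * x \<omega> ^ 4 \<partial>M) \<le> 3 * C ^ 4 * (CARD('d))\<^sup>2 * d\<^sup>2 * ?A"
  proof -
    let ?N = "\<lambda>\<omega>. (W \<omega>)\<^sup>2 * norm (B q \<omega> - B p \<omega>) ^ 4"
    have W2F: "(\<lambda>\<omega>. (W \<omega>)\<^sup>2) \<in> borel_measurable (F p)" by measurable
    have iN: "integrable M ?N"
      by (rule integrable_mult_increment[OF pq'(1,2) W2F sq_integrable_sq[OF W2], of "\<lambda>x. norm x ^ 4"])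
        (measurable, rule increment_norm_4[OF pq'(1,2)])
    have N: "(\<integral>\<omega>. ?N \<omega> \<partial>M) = ?A * (\<integral>\<omega>. norm (B q \<omega> - B p \<omega>) ^ 4 \<partial>M)"
      by (rule integral_mult_increment[OF pq'(1,2) W2F sq_integrable_sq[OF W2], of "\<lambda>x. norm x ^ 4"])
        (measurable, rule increment_norm_4[OF pq'(1,2)])
    have le: "(W \<omega>)\<^sup>2 * x \<omega> ^ 4 \<le> C ^ 4 * ?N \<omega>" for \<omega>
    proof -
      have "\<bar>x \<omega>\<bar> ^ 4 \<le> (C * norm (B q \<omega> - B p \<omega>)) ^ 4" by (intro power_mono x_le) auto
      then have "x \<omega> ^ 4 \<le> C ^ 4 * norm (B q \<omega> - B p \<omega>) ^ 4" by (simp add: power_mult_distrib)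
      then show ?thesis using mult_left_mono[of "x \<omega> ^ 4" "C ^ 4 * norm (B q \<omega> - B p \<omega>) ^ 4" "(W \<omega>)\<^sup>2"]
        by (simp add: mult.left_commute)
    qed
    show i: "integrable M (\<lambda>\<omega>. (W \<omega>)\<^sup>2 * x \<omega> ^ 4)"
    proof (rule Bochner_Integration.integrable_bound[OF integrable_mult_right[OF iN, of "C ^ 4"]])
      show "AE \<omega> in M. norm ((W \<omega>)\<^sup>2 * x \<omega> ^ 4) \<le> norm (C ^ 4 * ?N \<omega>)"
        using le by (intro AE_I2) (simp add: abs_mult)
    qed measurable
    have "(\<integral>\<omega>. (W \<omega>)\<^sup>2 * x \<omega> ^ 4 \<partial>M) \<le> (\<integral>\<omega>. C ^ 4 * ?N \<omega> \<partial>M)"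
      by (intro integral_mono i le integrable_mult_right iN)
    also have "\<dots> = C ^ 4 * ?A * (\<integral>\<omega>. norm (B q \<omega> - B p \<omega>) ^ 4 \<partial>M)" using N by simp
    also have "\<dots> \<le> C ^ 4 * ?A * (3 * (CARD('d))\<^sup>2 * d\<^sup>2)"
      using increment_norm_4(2)[OF pq'(1,2)] C0 A0 unfolding d_def by (intro mult_left_mono) auto
    finally show "(\<integral>\<omega>. (W \<omega>)\<^sup>2 * x \<omega> ^ 4 \<partial>M) \<le> 3 * C ^ 4 * (CARD('d))\<^sup>2 * d\<^sup>2 * ?A" by (simp add: mult_ac)
  qed
  have E0: "0 \<le> energy p q" unfolding energy_def by (intro integral_nonneg_AE AE_I2) (simp add: slab_def m0)
  have part1: "(\<integral>\<omega>. - (W \<omega> * U q \<omega>) + W \<omega> * x \<omega> * U q \<omega> \<partial>M)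
      \<le> ?A / 2 + C\<^sup>2 * CARD('d) * d * ?A / 2 + \<Phi> q / 2 + (3 * C ^ 4 * (CARD('d))\<^sup>2 * d * ?A + d * energy p q) / 2"
  proof -
    have iU: "integrable M (\<lambda>\<omega>. (U q \<omega> - U p \<omega>)\<^sup>2)"
      by (intro sq_integrable_sq sq_integrable_diff Uq2 Up2)
    have iP: "integrable M (\<lambda>\<omega>. (max (- U q \<omega>) 0)\<^sup>2)"
      by (intro sq_integrable_sq negative_part_L2 pq pq')
    note i = sq_integrable_sq[OF W2] W2x[THEN integrable.intros] Wx_sq(1) Wx_4(1) iU iP
    have "(\<integral>\<omega>. - (W \<omega> * U q \<omega>) + W \<omega> * x \<omega> * U q \<omega> \<partial>M)
      \<le> (\<integral>\<omega>. (W \<omega>)\<^sup>2 / 2 - (W \<omega>)\<^sup>2 * x \<omega> + (W \<omega>)\<^sup>2 * (x \<omega>)\<^sup>2 / 2 + (max (- U q \<omega>) 0)\<^sup>2 / 2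
          + ((W \<omega>)\<^sup>2 * x \<omega> ^ 4 / d + d * (U q \<omega> - U p \<omega>)\<^sup>2) / 2 \<partial>M)"
      by (rule integral_mono[OF _ _ negative_part_step[OF d(1)]])
        (use int[OF W2 Uq2] int[OF Wx2 Uq2] i in \<open>auto simp: W_def\<close>)
    also have "\<dots> = ?A / 2 + (\<integral>\<omega>. (W \<omega>)\<^sup>2 * (x \<omega>)\<^sup>2 \<partial>M) / 2 + \<Phi> q / 2
        + ((\<integral>\<omega>. (W \<omega>)\<^sup>2 * x \<omega> ^ 4 \<partial>M) / d + d * (\<integral>\<omega>. (U q \<omega> - U p \<omega>)\<^sup>2 \<partial>M)) / 2"
      using i has_bochner_integral_integral_eq[OF W2x] by (simp add: \<Phi>_def)
    also have "\<dots> \<le> ?A / 2 + C\<^sup>2 * CARD('d) * d * ?A / 2 + \<Phi> q / 2 + (3 * C ^ 4 * (CARD('d))\<^sup>2 * d * ?A + d * energy p q) / 2"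
    proof (intro add_mono divide_right_mono order_refl Wx_sq(2))
      have "(\<integral>\<omega>. (W \<omega>)\<^sup>2 * x \<omega> ^ 4 \<partial>M) / d \<le> (3 * C ^ 4 * (CARD('d))\<^sup>2 * d\<^sup>2 * ?A) / d"
        using d by (intro divide_right_mono Wx_4(2)) auto
      then show "(\<integral>\<omega>. (W \<omega>)\<^sup>2 * x \<omega> ^ 4 \<partial>M) / d \<le> 3 * C ^ 4 * (CARD('d))\<^sup>2 * d * ?A"
        using d by (simp add: power2_eq_square)
      show "d * (\<integral>\<omega>. (U q \<omega> - U p \<omega>)\<^sup>2 \<partial>M) \<le> d * energy p q"
        using d increment_energy[OF pq(1) pq'(2) pq(3,4)] by (intro mult_left_mono) auto
    qed auto
    finally show ?thesis .
  qed
  let ?K = "3 / 2 * C + C\<^sup>2"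
  let ?D = "\<integral>x. (norm (slab p q V x - slab p q (\<lambda>_. w) x))\<^sup>2 \<partial>MT"
  let ?Y = "\<lambda>\<omega>. W \<omega> * x \<omega>"
  \<comment> \<open>All three terms become integrals over the slab, so they can be estimated
    pointwise: - W f - k . V by \<open>generator_linearized\<close>, and W x f by the half-squares
    inequality with weight \<open>d\<close>, whose factor 1/d is cancelled by the length of the
    slab.\<close>
  have part2: "(\<integral>\<omega>. ?Y \<omega> * drift p q \<omega> \<partial>M) - (\<integral>\<omega>. W \<omega> * drift p q \<omega> \<partial>M) - (\<integral>\<omega>. ?Y \<omega> * L \<omega> \<partial>M)
      \<le> (C\<^sup>2 * CARD('d) * d * ?A + d * (energy p q / 2)) / 2 + ?K * (d * ?A) + C / 2 * (d * energy p q) + ?D"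
  proof -
    let ?f = "slab p q f" and ?sY = "slab p q (\<lambda>_. ?Y)" and ?sW = "slab p q (\<lambda>_. W)"
    let ?osc = "\<lambda>z. (slab p q U z - slab p q (\<lambda>_. U p) z)\<^sup>2"
    let ?R = "\<lambda>z. ((?sY z)\<^sup>2 / d + d * (?f z)\<^sup>2) / 2 + ?K * (?sW z)\<^sup>2 + C / 2 * ?osc z
      + (norm (slab p q V z - slab p q (\<lambda>_. w) z))\<^sup>2"
    note s2 = slab_const_sq_integrable[OF Wx2, of p q] slab_const_sq_integrable[OF W2, of p q]
      slab_const_sq_integrable[OF k2, of p q] f_sub[OF pq(1,3)] slab_sq_integrable_sub[OF V_MT pq(1,3)]
    note osc = oscillation_energy[OF pq(1) pq'(2) pq(3,4)]
    note i = int[OF s2(1,4)] int[OF s2(2,4)] integrable_inner_sq[OF s2(3,5)]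
    have iR: "integrable MT ?R"
      using sq_integrable_sq[OF s2(1)] sq_integrable_sq[OF s2(2)] sq_integrable_sq[OF s2(4)] osc(1) wV by simp
    have "(\<integral>\<omega>. ?Y \<omega> * drift p q \<omega> \<partial>M) - (\<integral>\<omega>. W \<omega> * drift p q \<omega> \<partial>M) - (\<integral>\<omega>. ?Y \<omega> * L \<omega> \<partial>M)
        = (\<integral>z. ?sY z * ?f z - ?sW z * ?f z - slab p q (\<lambda>_. k) z \<bullet> slab p q V z \<partial>MT)"
      using i by (simp add: Lk drift_pairing[OF pq(1,3) Wx2] drift_pairing[OF pq(1,3) W2])
    also have "\<dots> \<le> (\<integral>z. ?R z \<partial>MT)"
    proof (rule integral_mono_AE)
      show "AE z in MT. ?sY z * ?f z - ?sW z * ?f z - slab p q (\<lambda>_. k) z \<bullet> slab p q V z \<le> ?R z"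
        using generator
      proof eventually_elim
        fix z assume g: "a < snd z \<and> snd z \<le> b \<longrightarrow>
          f (snd z) (fst z) \<ge> - C * (\<bar>U (snd z) (fst z)\<bar> + norm (V (snd z) (fst z)))"
        show "?sY z * ?f z - ?sW z * ?f z - slab p q (\<lambda>_. k) z \<bullet> slab p q V z \<le> ?R z"
        proof (cases "p < snd z \<and> snd z \<le> q")
          case True
          let ?\<omega> = "fst z" and ?s = "snd z"
          have "?Y ?\<omega> * f ?s ?\<omega> = (?Y ?\<omega> / sqrt d) * (sqrt d * f ?s ?\<omega>)" using d by simp
          also have "\<dots> \<le> ((?Y ?\<omega> / sqrt d)\<^sup>2 + (sqrt d * f ?s ?\<omega>)\<^sup>2) / 2"
            by (rule mult_le_half_squares)
          also have "\<dots> = ((?Y ?\<omega>)\<^sup>2 / d + d * (f ?s ?\<omega>)\<^sup>2) / 2"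
            using d by (simp add: power_mult_distrib power_divide)
          finally have 1: "?Y ?\<omega> * f ?s ?\<omega> \<le> ((?Y ?\<omega>)\<^sup>2 / d + d * (f ?s ?\<omega>)\<^sup>2) / 2" .
          have 2: "- (W ?\<omega> * f ?s ?\<omega>) - k ?\<omega> \<bullet> V ?s ?\<omega>
              \<le> ?K * (W ?\<omega>)\<^sup>2 + C / 2 * (U ?s ?\<omega> - U p ?\<omega>)\<^sup>2 + (norm (V ?s ?\<omega> - w ?\<omega>))\<^sup>2"
            unfolding k_def using g True pq by (intro generator_linearized[OF C0]) (auto simp: W_def)
          show ?thesis unfolding slab_in[OF conjunct1[OF True] conjunct2[OF True]] using 1 2 by linarith
        qed (simp add: slab_out)
      qed
    qed (use i iR in auto)
    also have "\<dots> = ((\<integral>z. (?sY z)\<^sup>2 \<partial>MT) / d + d * (\<integral>z. (?f z)\<^sup>2 \<partial>MT)) / 2 + ?K * (\<integral>z. (?sW z)\<^sup>2 \<partial>MT)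
        + C / 2 * (\<integral>z. ?osc z \<partial>MT) + ?D"
      using sq_integrable_sq[OF s2(1)] sq_integrable_sq[OF s2(2)] sq_integrable_sq[OF s2(4)] osc(1) wV by simp
    also have "(\<integral>z. (?sY z)\<^sup>2 \<partial>MT) = d * (\<integral>\<omega>. (W \<omega>)\<^sup>2 * (x \<omega>)\<^sup>2 \<partial>M)"
      using slab_const_integral[OF sq_integrable_sq[OF Wx2] pq'(2)]
      by (simp add: has_bochner_integral_iff slab_sq power_mult_distrib d_def flip: slab_sq)
    also have "(\<integral>z. (?sW z)\<^sup>2 \<partial>MT) = d * ?A"
      using slab_const_integral[OF sq_integrable_sq[OF W2] pq'(2)]
      by (simp add: has_bochner_integral_iff d_def flip: slab_sq)
    also have "((d * (\<integral>\<omega>. (W \<omega>)\<^sup>2 * (x \<omega>)\<^sup>2 \<partial>M)) / d + d * (\<integral>z. (?f z)\<^sup>2 \<partial>MT)) / 2 + ?K * (d * ?A)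
        + C / 2 * (\<integral>z. ?osc z \<partial>MT) + ?D
      \<le> (C\<^sup>2 * CARD('d) * d * ?A + d * (energy p q / 2)) / 2 + ?K * (d * ?A) + C / 2 * (d * energy p q) + ?D"
    proof (intro add_mono divide_right_mono mult_left_mono order_refl)
      show "d * (\<integral>\<omega>. (W \<omega>)\<^sup>2 * (x \<omega>)\<^sup>2 \<partial>M) / d \<le> C\<^sup>2 * CARD('d) * d * ?A" using Wx_sq(2) d by simp
      show "(\<integral>z. (?f z)\<^sup>2 \<partial>MT) \<le> energy p q / 2"
        using energy_integrand(2)[OF pq(1,3)] Bochner_Integration.integral_nonneg[of MT "slab p q m", OF slab_m_nonneg] by simp
      show "(\<integral>z. ?osc z \<partial>MT) \<le> d * energy p q" using osc(2) by (simp add: d_def)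
    qed (use d C0 in auto)
    finally show ?thesis .
  qed
  \<comment> \<open>The sum of \<open>A_eq\<close>, \<open>part1\<close> and \<open>part2\<close>
    has E W^2 / 2 and \<Phi> q / 2 on the right. Absorbing the former and doubling gives \<Phi> q
    the coefficient 1.\<close>
  have "?A \<le> \<Phi> q + rate * d * ?A + (3 / 2 + C) * (d * energy p q) + 2 * ?D"
    using A_eq part1 part2 unfolding rate_def by (simp add: field_simps)
  also have "(3 / 2 + C) * (d * energy p q) \<le> (2 + C) * (d * energy p q)"
    using E0 d by (intro mult_right_mono) auto
  finally show ?thesis by (simp add: \<Phi>_def W_def d_def algebra_simps)
qed

end

text \<open>Since (1 - c)(1 + 2c) = 1 + c (1 - 2c) >= 1 on [0, 1/2], exp (2c) dominates 1 / (1 - c).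
  Exponentials of lengths multiply exactly when intervals are joined.\<close>

lemma le_exp_of_contraction:
  fixes c A R :: real
  assumes "0 \<le> c" "c \<le> 1 / 2" "0 \<le> R" "(1 - c) * A \<le> R"
  shows "A \<le> exp (2 * c) * R"
proof -
  have "1 \<le> (1 - c) * (1 + 2 * c)" using assms mult_left_mono[of c "1 / 2" c] by (simp add: algebra_simps)
  also have "\<dots> \<le> (1 - c) * exp (2 * c)" using assms exp_ge_add_one_self[of "2 * c"] by (intro mult_left_mono) auto
  finally have e: "1 \<le> (1 - c) * exp (2 * c)" .
  have "0 < 1 - c" using assms by simp
  have "A \<le> R / (1 - c)" using assms(4) \<open>0 < 1 - c\<close> by (simp add: field_simps)
  also have "\<dots> \<le> exp (2 * c) * R"
    using mult_right_mono[OF e assms(3)] \<open>0 < 1 - c\<close> by (simp add: field_simps)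
  finally show ?thesis .
qed

context bsde_supersolution begin

lemma rate_nonneg: "0 \<le> rate"
  unfolding rate_def using C0 by simp

lemma \<Phi>_nonneg: "0 \<le> \<Phi> t"
  by (simp add: \<Phi>_def)

lemma \<Phi>_eq_0_iff:
  assumes "a \<le> t" "t \<le> b"
  shows "\<Phi> t = 0 \<longleftrightarrow> (AE \<omega> in M. 0 \<le> U t \<omega>)"
  unfolding \<Phi>_def
  by (subst integral_nonneg_eq_0_iff_AE[OF sq_integrable_sq[OF negative_part_L2[OF assms]]])
    (auto simp: max_def intro!: AE_cong)

lemma energy_nonneg: "0 \<le> energy p q"
  unfolding energy_def by (intro integral_nonneg_AE AE_I2) (simp add: slab_def m0)

text \<open>The form that can be chained: in the error the step length is replaced by the common
  bound \<delta>, which makes the error additive in the interval.\<close>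

lemma one_step_exp:
  assumes pq: "a \<le> p" "p < q" "q \<le> b" "q - p \<le> \<delta>" and \<delta>: "\<delta> \<le> 1" "rate * \<delta> \<le> 1 / 2"
    and w: "w \<in> borel_measurable (F p)" "\<And>s \<omega>. s \<in> {p<..q} \<Longrightarrow> \<omega> \<in> space M \<Longrightarrow> v s \<omega> = w \<omega>"
    and v: "sq_integrable MT (slab a b v)"
  shows "\<Phi> p \<le> exp (2 * rate * (q - p)) * (\<Phi> q + ((2 + C) * \<delta> * energy p q
    + 2 * (\<integral>x. (norm (slab p q V x - slab p q v x))\<^sup>2 \<partial>MT)))"
proof -
  let ?D = "\<lambda>x. (norm (slab p q V x - slab p q v x))\<^sup>2"
  have eq: "slab p q (\<lambda>_. w) x = slab p q v x" if "x \<in> space MT" for x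
    using w(2)[of "snd x" "fst x"] that by (auto simp: slab_def space_pair_measure indicator_def)
  have "integrable MT ?D"
    using pq by (intro sq_integrable_norm_sq sq_integrable_diff slab_sq_integrable_sub[OF V_MT]
        slab_sq_integrable_sub[OF v]) auto
  moreover have c: "integrable MT (\<lambda>x. (norm (slab p q V x - slab p q (\<lambda>_. w) x))\<^sup>2) = integrable MT ?D"
    "(\<integral>x. (norm (slab p q V x - slab p q (\<lambda>_. w) x))\<^sup>2 \<partial>MT) = (\<integral>x. ?D x \<partial>MT)"
    by (intro Bochner_Integration.integrable_cong Bochner_Integration.integral_cong refl, simp add: eq)+
  ultimately have "(1 - rate * (q - p)) * \<Phi> p \<le> \<Phi> q + (2 + C) * (q - p) * energy p q + 2 * (\<integral>x. ?D x \<partial>MT)"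
    using one_step[OF pq(1-3) _ w(1)] pq \<delta> by simp
  also have "\<dots> \<le> \<Phi> q + ((2 + C) * \<delta> * energy p q + 2 * (\<integral>x. ?D x \<partial>MT))"
    using pq C0 energy_nonneg[of p q] by (simp add: mult_left_mono mult_right_mono)
  finally have step: "(1 - rate * (q - p)) * \<Phi> p \<le> \<Phi> q + ((2 + C) * \<delta> * energy p q + 2 * (\<integral>x. ?D x \<partial>MT))" .
  have "rate * (q - p) \<le> rate * \<delta>" using pq(4) rate_nonneg by (rule mult_left_mono)
  then have "rate * (q - p) \<le> 1 / 2" using \<delta>(2) by (rule order_trans)
  moreover have "0 \<le> rate * (q - p)" using rate_nonneg pq by simp
  moreover have "0 \<le> \<Phi> q + ((2 + C) * \<delta> * energy p q + 2 * (\<integral>x. ?D x \<partial>MT))"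
    using pq C0 energy_nonneg[of p q] \<Phi>_nonneg[of q] by simp
  ultimately show ?thesis using le_exp_of_contraction[OF _ _ _ step] by (simp only: mult.assoc)
qed

text \<open>A single parameter \<delta> bounds both the mesh and the approximation error of
  \<open>V\<close>; \<Phi> t is at most c * \<delta> with \<open>c\<close> independent of \<delta>,
  hence zero.\<close>

theorem nonneg:
  assumes end_nonneg: "AE \<omega> in M. 0 \<le> U b \<omega>" and t: "a \<le> t" "t \<le> b"
  shows "AE \<omega> in M. 0 \<le> U t \<omega>"
proof (cases "t = b")
  case True
  then show ?thesis using end_nonneg by simp
next
  case False
  then have tb: "t < b" using t by simp
  have ab: "a \<le> b" using t by simp
  have \<Phi>b: "\<Phi> b = 0" by (rule \<Phi>_eq_0_iff[THEN iffD2, OF ab order_refl end_nonneg])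
  define c where "c = exp (2 * rate * (b - t)) * ((2 + C) * energy t b + 2)"
  have bound: "\<Phi> t \<le> c * \<delta>" if \<delta>: "0 < \<delta>" "\<delta> \<le> 1" "rate * \<delta> \<le> 1 / 2" for \<delta>
  proof -
    obtain S v where Sv: "predictable_step a b S v" and v: "sq_integrable MT (slab a b v)"
      and vV: "(\<integral>x. (norm (slab a b V x - slab a b v x))\<^sup>2 \<partial>MT) \<le> \<delta>"
      by (rule approximableE[OF V_approx \<delta>(1)])
    then have S: "finite S" by (simp add: predictable_step_def)
    obtain S' where S': "finite S'" "\<And>p q. a \<le> p \<Longrightarrow> q \<le> b \<Longrightarrow> S' \<inter> {p<..<q} = {} \<Longrightarrow> q - p \<le> \<delta>"
      using finite_mesh[OF \<delta>(1)] by blast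
    define D where "D p q = (\<integral>x. (norm (slab p q V x - slab p q v x))\<^sup>2 \<partial>MT)" for p q
    define e where "e p q = (2 + C) * \<delta> * energy p q + 2 * D p q" for p q
    have D0: "0 \<le> D p q" for p q by (simp add: D_def)
    have e0: "0 \<le> e p q" for p q
      unfolding e_def using \<delta> C0 energy_nonneg[of p q] D0[of p q] by simp
    have iD: "integrable MT (\<lambda>x. (norm (slab p q V x - slab p q v x))\<^sup>2)" if "a \<le> p" "q \<le> b" for p q
      using that by (intro sq_integrable_norm_sq sq_integrable_diff slab_sq_integrable_sub[OF V_MT]
        slab_sq_integrable_sub[OF v]) auto
    have e_add: "e p q = e p s + e s q" if "a \<le> p" "p < s" "s < q" "q \<le> b" for p s q
    proof -
      have "energy p q = energy p s + energy s q"
        unfolding energy_def using that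
        by (subst Bochner_Integration.integral_add[symmetric, OF energy_integrand(1) energy_integrand(1)])
          (auto intro!: Bochner_Integration.integral_cong slab_split)
      moreover have "D p q = D p s + D s q"
        unfolding D_def using that
        by (subst Bochner_Integration.integral_add[symmetric, OF iD iD])
          (auto intro!: Bochner_Integration.integral_cong simp: slab_def indicator_def)
      ultimately show ?thesis by (simp add: e_def algebra_simps)
    qed
    \<comment> \<open>The partition consists of the jump times of \<open>v\<close> and a mesh of
      width \<delta>. The estimate survives joining because the exponents and \<open>e\<close> add
      up and the exponential factor is at least 1.\<close>
    have "\<Phi> t \<le> exp (2 * rate * (b - t)) * (\<Phi> b + e t b)"
    proof (rule interval_chain[where P="\<lambda>p q. \<Phi> p \<le> exp (2 * rate * (q - p)) * (\<Phi> q + e p q)"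
          and S="S \<union> S'" and a=a and b=b])
      fix p s q assume *: "a \<le> p" "p < s" "s < q" "q \<le> b"
        and 1: "\<Phi> p \<le> exp (2 * rate * (s - p)) * (\<Phi> s + e p s)"
        and 2: "\<Phi> s \<le> exp (2 * rate * (q - s)) * (\<Phi> q + e s q)"
      have "e p s \<le> exp (2 * rate * (q - s)) * e p s"
        using mult_right_mono[of 1 "exp (2 * rate * (q - s))" "e p s"] e0[of p s] rate_nonneg * by simp
      then have "\<Phi> s + e p s \<le> exp (2 * rate * (q - s)) * (\<Phi> q + e p q)"
        using 2 e_add[OF *] by (simp add: algebra_simps)
      then have "exp (2 * rate * (s - p)) * (\<Phi> s + e p s)
          \<le> exp (2 * rate * (s - p)) * (exp (2 * rate * (q - s)) * (\<Phi> q + e p q))"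
        by (rule mult_left_mono) simp
      also have "\<dots> = exp (2 * rate * (q - p)) * (\<Phi> q + e p q)"
        unfolding mult.assoc[symmetric] exp_add[symmetric] by (simp add: algebra_simps)
      finally show "\<Phi> p \<le> exp (2 * rate * (q - p)) * (\<Phi> q + e p q)" using 1 by simp
    next
      fix p q assume *: "a \<le> p" "p < q" "q \<le> b" "(S \<union> S') \<inter> {p<..<q} = {}"
      then have **: "S \<inter> {p<..<q} = {}" "S' \<inter> {p<..<q} = {}" by auto
      obtain w where w: "w \<in> borel_measurable (F p)" "\<And>s \<omega>. s \<in> {p<..q} \<Longrightarrow> \<omega> \<in> space M \<Longrightarrow> v s \<omega> = w \<omega>"
        by (rule predictable_stepE[OF Sv *(1-3) **(1)]) (rule that, auto)
      show "\<Phi> p \<le> exp (2 * rate * (q - p)) * (\<Phi> q + e p q)"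
        unfolding e_def D_def by (rule one_step_exp[OF *(1-3) S'(2)[OF *(1,3) **(2)] \<delta>(2,3) w v])
    qed (use S S' t tb in auto)
    also have "\<dots> \<le> exp (2 * rate * (b - t)) * (((2 + C) * energy t b + 2) * \<delta>)"
    proof (intro mult_left_mono)
      have "D t b \<le> D a b" unfolding D_def using t
        by (intro integral_mono iD) (auto simp: slab_def indicator_def)
      also have "\<dots> \<le> \<delta>" using vV by (simp add: D_def)
      finally show "\<Phi> b + e t b \<le> ((2 + C) * energy t b + 2) * \<delta>"
        using \<Phi>b by (simp add: e_def algebra_simps)
    qed simp
    finally show ?thesis by (simp add: c_def mult.assoc)
  qed
  have c0: "0 \<le> c" unfolding c_def using C0 energy_nonneg[of t b] by simp
  have "\<Phi> t \<le> 0"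
  proof (rule field_le_epsilon)
    fix \<epsilon> :: real assume \<epsilon>: "0 < \<epsilon>"
    \<comment> \<open>The three bounds ensure \<delta> <= 1, rate * \<delta> <= 1/2 and c * \<delta>
      <= \<epsilon>; the added 1 guards against division by zero.\<close>
    define \<delta> where "\<delta> = min 1 (min (1 / (2 * (rate + 1))) (\<epsilon> / (c + 1)))"
    have \<delta>: "0 < \<delta>" "\<delta> \<le> 1" "\<delta> \<le> 1 / (2 * (rate + 1))" "\<delta> \<le> \<epsilon> / (c + 1)"
      unfolding \<delta>_def using \<epsilon> c0 rate_nonneg by auto
    have r: "(rate + 1) * (1 / (2 * (rate + 1))) = 1 / 2" using rate_nonneg by (simp add: divide_simps)
    have "rate * \<delta> \<le> (rate + 1) * (1 / (2 * (rate + 1)))"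
      using \<delta> rate_nonneg by (intro mult_mono) auto
    then have "rate * \<delta> \<le> 1 / 2" unfolding r .
    from bound[OF \<delta>(1,2) this] have "\<Phi> t \<le> c * \<delta>" .
    also have "\<dots> \<le> (c + 1) * (\<epsilon> / (c + 1))" using \<delta> c0 by (intro mult_mono) auto
    finally show "\<Phi> t \<le> 0 + \<epsilon>" using c0 by simp
  qed
  then show ?thesis using \<Phi>_eq_0_iff[OF t] \<Phi>_nonneg[of t] by simp
qed

end

section \<open>Solutions of BSDEs\<close>

text \<open>Along a simple function only finitely many sections \<open>h c\<close> occur, so the
  composition is measurable; continuity in \<open>c\<close> carries this to the limit.\<close>

lemma borel_measurable_Caratheodory:
  fixes h :: "'c::{metric_space, second_countable_topology} \<Rightarrow> 'a \<Rightarrow> 'b::real_normed_vector"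
  assumes h: "\<And>c. h c \<in> borel_measurable N" and cont: "\<And>x. x \<in> space N \<Longrightarrow> continuous_on UNIV (\<lambda>c. h c x)"
    and X: "X \<in> borel_measurable N"
  shows "(\<lambda>x. h (X x) x) \<in> borel_measurable N"
proof -
  obtain S where S: "\<And>i. simple_function N (S i)" "\<And>x. x \<in> space N \<Longrightarrow> (\<lambda>i. S i x) \<longlonglongrightarrow> X x"
    using borel_measurable_implies_sequence_metric[OF X, of undefined] by blast
  show ?thesis
  proof (rule borel_measurable_LIMSEQ_metric)
    fix i
    show "(\<lambda>x. h (S i x) x) \<in> borel_measurable N"
    proof (rule measurable_compose_countable'[where I="S i ` space N"])
      show "S i \<in> N \<rightarrow>\<^sub>M count_space (S i ` space N)"
        using measurable_simple_function[OF S(1)] by (auto simp: measurable_count_space_eq2_countable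
            simple_functionD[OF S(1)] measurable_def)
      show "countable (S i ` space N)" using simple_functionD(1)[OF S(1)] by (rule countable_finite)
    qed (rule h)
  next
    fix x assume "x \<in> space N"
    then show "(\<lambda>i. h (S i x) x) \<longlonglongrightarrow> h (X x) x"
      by (intro continuous_on_tendsto_compose[OF cont S(2)]) auto
  qed
qed

text \<open>The set where the functions differ lies in a null set, so every subset of it is
  measurable in the completion. This serves time integrals with respect to \<open>lebesgue\<close>,
  the completion of \<open>lborel\<close>.\<close>

lemma borel_measurable_completion_cong_AE:
  fixes \<phi> \<psi> :: "'a \<Rightarrow> 'b::topological_space"
  assumes \<psi>: "\<psi> \<in> borel_measurable N" and eq: "AE x in N. \<phi> x = \<psi> x"
  shows "\<phi> \<in> borel_measurable (completion N)"
proof (rule measurableI)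
  fix A :: "'b set" assume A: "A \<in> sets borel"
  have [measurable]: "\<psi> \<in> borel_measurable (completion N)" by (rule measurable_completion[OF \<psi>])
  have [measurable]: "Measurable.pred (completion N) (\<lambda>x. \<phi> x \<noteq> \<psi> x)"
    by (rule sets_completion_AE) (use eq in simp)
  have [measurable]: "Measurable.pred (completion N) (\<lambda>x. \<phi> x \<noteq> \<psi> x \<and> \<phi> x \<in> A)"
    by (rule sets_completion_AE) (use eq in auto)
  have "Measurable.pred (completion N) (\<lambda>x. (\<not> \<phi> x \<noteq> \<psi> x \<and> \<psi> x \<in> A) \<or> (\<phi> x \<noteq> \<psi> x \<and> \<phi> x \<in> A))"
    using A by measurable
  moreover have "(\<lambda>x. (\<not> \<phi> x \<noteq> \<psi> x \<and> \<psi> x \<in> A) \<or> (\<phi> x \<noteq> \<psi> x \<and> \<phi> x \<in> A)) = (\<lambda>x. \<phi> x \<in> A)" by auto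
  ultimately have "Measurable.pred (completion N) (\<lambda>x. \<phi> x \<in> A)" by (simp only:)
  then have "{x \<in> space (completion N). \<phi> x \<in> A} \<in> sets (completion N)" by (simp add: pred_def)
  then show "\<phi> -` A \<inter> space (completion N) \<in> sets (completion N)"
    by (simp add: vimage_def Int_def conj_commute)
qed auto

lemma integral_completion_cong_AE:
  fixes \<phi> \<psi> :: "'a \<Rightarrow> 'b::{banach, second_countable_topology}"
  assumes \<psi>: "\<psi> \<in> borel_measurable N" and eq: "AE x in N. \<phi> x = \<psi> x"
  shows "integral\<^sup>L (completion N) \<phi> = integral\<^sup>L N \<psi>"
proof -
  have "integral\<^sup>L (completion N) \<phi> = integral\<^sup>L (completion N) \<psi>"
    using borel_measurable_completion_cong_AE[OF \<psi> eq] measurable_completion[OF \<psi>] AE_completion[OF eq]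
    by (rule integral_cong_AE)
  also have "\<dots> = integral\<^sup>L N \<psi>" by (rule integral_completion[OF \<psi>])
  finally show ?thesis .
qed

text \<open>Joins (y, z) into one argument, the form required by
  \<open>borel_measurable_Caratheodory\<close> and by the density argument for drivers.\<close>

lemma lipschitz_imp_continuous_pair:
  fixes k :: "real \<Rightarrow> 'c::real_normed_vector \<Rightarrow> real"
  assumes "0 \<le> C" and lip: "\<And>y y' z z'. \<bar>k y z - k y' z'\<bar> \<le> C * (\<bar>y - y'\<bar> + norm (z - z'))"
  shows "continuous_on UNIV (\<lambda>c. k (fst c) (snd c))"
proof (rule lipschitz_on_continuous_on[where L="2 * C"], rule lipschitz_onI)
  fix c c' :: "real \<times> 'c"
  have "dist (k (fst c) (snd c)) (k (fst c') (snd c')) \<le> C * (dist (fst c) (fst c') + dist (snd c) (snd c'))"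
    using lip[of "fst c" "snd c" "fst c'" "snd c'"] by (simp add: dist_norm)
  also have "\<dots> \<le> C * (dist c c' + dist c c')"
    using assms(1) by (intro mult_left_mono add_mono dist_fst_le dist_snd_le)
  finally show "dist (k (fst c) (snd c)) (k (fst c') (snd c')) \<le> 2 * C * dist c c'" by simp
qed (use assms(1) in simp)

section \<open>From drivers and solutions to processes on the product space\<close>

context brownian_space begin

text \<open>Clamping time to [0, T] pulls functions on the restricted product back to
  \<open>MT\<close> and is the identity where the slab is supported, so the unconstrained values of
  a process at other times never enter.\<close>

lemma clamp_measurable:
  assumes "0 \<le> (T :: real)"
  shows "(\<lambda>x. (fst x, max 0 (min (snd x) T))) \<in> MT \<rightarrow>\<^sub>M M \<Otimes>\<^sub>M restrict_space lborel {0..T}"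
  by (intro measurable_Pair measurable_fst measurable_restrict_space2) (use assms in auto)

lemma slab_measurable:
  fixes X :: "('w, 'b::{real_normed_vector, second_countable_topology}) process"
  assumes X: "measurable_adapted M F T X" and T: "0 \<le> T"
  shows "slab 0 T X \<in> borel_measurable MT"
proof -
  have m: "(\<lambda>(\<omega>, s). X s \<omega>) \<in> borel_measurable (M \<Otimes>\<^sub>M restrict_space lborel {0..T})"
    using X by (simp add: measurable_adapted_def)
  have [measurable]: "(\<lambda>x. X (max 0 (min (snd x) T)) (fst x)) \<in> borel_measurable MT"
    using measurable_compose[OF clamp_measurable[OF T] m] by simp
  have "slab 0 T X = (\<lambda>x. indicator {0<..T} (snd x) *\<^sub>R X (max 0 (min (snd x) T)) (fst x))"
    by (auto simp: slab_def fun_eq_iff indicator_def)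
  then show ?thesis by simp
qed

text \<open>The exceptional set is returned explicitly because the driver is later multiplied by the
  indicator of its complement. It is the preimage of the given null set under the clamp, cut to (0,
  T]; Fubini on both product spaces shows that it is null.\<close>

lemma AE_restrict_imp_AE_MT:
  assumes ae: "AE x in M \<Otimes>\<^sub>M restrict_space lborel {0..T}. P x" and T: "0 \<le> T"
  shows "\<exists>N. N \<in> null_sets MT \<and> (\<forall>x\<in>space MT. 0 < snd x \<and> snd x \<le> T \<and> x \<notin> N \<longrightarrow> P x)"
proof -
  let ?R = "restrict_space (lborel :: real measure) {0..T}"
  let ?c = "\<lambda>x. (fst x, max 0 (min (snd x) T)) :: 'w \<times> real"
  interpret R: sigma_finite_measure ?R
    by (rule sigma_finite_measure_restrict_space) (auto intro: sigma_finite_lborel)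
  interpret MR: pair_sigma_finite M ?R ..
  obtain N where N: "N \<in> null_sets (M \<Otimes>\<^sub>M ?R)" "{x \<in> space (M \<Otimes>\<^sub>M ?R). \<not> P x} \<subseteq> N"
    using ae unfolding eventually_ae_filter by auto
  define N' where "N' = {x \<in> space MT. 0 < snd x \<and> snd x \<le> T \<and> ?c x \<in> N}"
  have [measurable]: "?c \<in> MT \<rightarrow>\<^sub>M M \<Otimes>\<^sub>M ?R" by (rule clamp_measurable[OF T])
  have [measurable]: "N \<in> sets (M \<Otimes>\<^sub>M ?R)" using N(1) by auto
  have N'[measurable]: "N' \<in> sets MT" unfolding N'_def by measurable
  have "AE \<omega> in M. AE s in ?R. (\<omega>, s) \<notin> N"
    using MR.AE_pair[OF AE_not_in[OF N(1)]] .
  then have "AE \<omega> in M. AE s in lborel. (\<omega>, s) \<notin> N'"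
  proof eventually_elim
    fix \<omega> assume "AE s in ?R. (\<omega>, s) \<notin> N"
    then have "AE s in lborel. s \<in> {0..T} \<longrightarrow> (\<omega>, s) \<notin> N"
      by (subst (asm) AE_restrict_space_iff) auto
    then show "AE s in lborel. (\<omega>, s) \<notin> N'"
      by eventually_elim (auto simp: N'_def min_def max_def split: if_splits)
  qed
  then have "AE x in MT. x \<notin> N'"
    by (rule MT.AE_pair_measure[rotated]) measurable
  then have "N' \<in> null_sets MT" using AE_iff_null_sets[OF N'] by simp
  moreover have "P x" if "x \<in> space MT" "0 < snd x" "snd x \<le> T" "x \<notin> N'" for x
  proof -
    have "?c x = x" using that by (auto simp: prod_eq_iff)
    then have "x \<notin> N" using that by (simp add: N'_def)
    moreover have "x \<in> space (M \<Otimes>\<^sub>M ?R)" using that by (auto simp: space_pair_measure space_restrict_space)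
    ultimately show "P x" using N(2) by blast
  qed
  ultimately show ?thesis by blast
qed

text \<open>The exceptional set may depend on the time; joint measurability permits the exchange of
  the two almost everywhere statements.\<close>

lemma AE_MT_I:
  assumes "Measurable.pred MT P" "\<And>s. AE \<omega> in M. P (\<omega>, s)"
  shows "AE x in MT. P x"
proof -
  have m: "{x \<in> space MT. P x} \<in> sets MT" using assms(1) by (simp add: pred_def)
  have "AE s in lborel. AE \<omega> in M. P (\<omega>, s)" using assms(2) by simp
  then have "AE \<omega> in M. AE s in lborel. P (\<omega>, s)"
    using MT.AE_commute[of "\<lambda>\<omega> s. P (\<omega>, s)"] m by simp
  then show ?thesis by (rule MT.AE_pair_measure[OF m])
qed

text \<open>In the hypothesis the exceptional set depends on \<open>s\<close> and on
  \<open>c\<close>. Fubini removes the dependence on \<open>s\<close>, a countable dense set that on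
  \<open>c\<close>, and continuity reaches all \<open>c\<close>, because a negative value would
  persist on an open set. Random arguments may then be inserted for \<open>c\<close>.\<close>

lemma AE_MT_nonneg_continuous:
  fixes h :: "'c::second_countable_topology \<Rightarrow> ('w, real) process"
  assumes m: "\<And>c. slab a b (h c) \<in> borel_measurable MT"
    and nn: "\<And>s c. a < s \<Longrightarrow> s \<le> b \<Longrightarrow> AE \<omega> in M. 0 \<le> h c s \<omega>"
    and cont: "AE x in MT. a < snd x \<and> snd x \<le> b \<longrightarrow> continuous_on UNIV (\<lambda>c. ev (h c) x)"
  shows "AE x in MT. a < snd x \<and> snd x \<le> b \<longrightarrow> (\<forall>c. 0 \<le> ev (h c) x)"
proof -
  obtain D :: "'c set" where D: "countable D" "\<And>X. open X \<Longrightarrow> X \<noteq> {} \<Longrightarrow> \<exists>d\<in>D. d \<in> X"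
    by (rule countable_dense_setE) blast
  have "AE x in MT. 0 \<le> slab a b (h c) x" for c
  proof (rule AE_MT_I)
    show "Measurable.pred MT (\<lambda>x. 0 \<le> slab a b (h c) x)" using m by measurable
    show "AE \<omega> in M. 0 \<le> slab a b (h c) (\<omega>, s)" for s
      using nn[of s c] by (cases "a < s \<and> s \<le> b") (auto simp: slab_apply indicator_def)
  qed
  then have "AE x in MT. \<forall>c\<in>D. 0 \<le> slab a b (h c) x"
    by (simp add: AE_ball_countable[OF D(1)])
  with cont show ?thesis
  proof eventually_elim
    fix x assume c: "a < snd x \<and> snd x \<le> b \<longrightarrow> continuous_on UNIV (\<lambda>c. ev (h c) x)"
      and d: "\<forall>c\<in>D. 0 \<le> slab a b (h c) x"
    show "a < snd x \<and> snd x \<le> b \<longrightarrow> (\<forall>c. 0 \<le> ev (h c) x)"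
    proof (intro impI allI, rule ccontr)
      fix e assume s: "a < snd x \<and> snd x \<le> b" and neg: "\<not> 0 \<le> ev (h e) x"
      have "open ((\<lambda>c. ev (h c) x) -` {..<0})"
        using c s by (intro open_vimage) auto
      moreover have "e \<in> (\<lambda>c. ev (h c) x) -` {..<0}" using neg by simp
      ultimately obtain c where "c \<in> D" "ev (h c) x < 0"
        using D(2)[of "(\<lambda>c. ev (h c) x) -` {..<0}"] by auto
      then show False using d s by (auto simp: slab_in)
    qed
  qed
qed

lemma driver_lipschitz:
  assumes "standard_driver M F T g" "0 \<le> T"
  obtains C N where "0 < C" "N \<in> null_sets MT"
    "\<And>x y y' z z'. x \<in> space MT \<Longrightarrow> 0 < snd x \<Longrightarrow> snd x \<le> T \<Longrightarrow> x \<notin> N \<Longrightarrow>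
      \<bar>ev g x y z - ev g x y' z'\<bar> \<le> C * (\<bar>y - y'\<bar> + norm (z - z'))"
proof -
  obtain C where C: "0 < C" and ae: "AE x in M \<Otimes>\<^sub>M restrict_space lborel {0..T}. \<forall>y y' z z'.
      \<bar>ev g x y z - ev g x y' z'\<bar> \<le> C * (\<bar>y - y'\<bar> + norm (z - z'))"
    using assms(1) unfolding standard_driver_def case_prod_beta by blast
  from AE_restrict_imp_AE_MT[OF ae assms(2)] C that show ?thesis by (elim exE conjE) simp
qed

text \<open>Off a null set the driver is Lipschitz in (y, z), so it can be composed measurably with
  (Y, Z) once it is set to zero on that set. The bound |g(., 0, 0)| + C (|Y| + |Z|) gives square
  integrability.\<close>

lemma generator_process:
  assumes drv: "standard_driver M F T g" and T: "0 \<le> T"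
    and Y: "sq_integrable MT (slab 0 T Y)" and Z: "sq_integrable MT (slab 0 T Z)"
  obtains f where "sq_integrable MT (slab 0 T f)"
    "AE x in MT. 0 < snd x \<and> snd x \<le> T \<longrightarrow>
      ev f x = ev g x (ev Y x) (ev Z x)"
proof -
  obtain C N where C: "0 < C" and N: "N \<in> null_sets MT" and lip:
    "\<And>x y y' z z'. x \<in> space MT \<Longrightarrow> 0 < snd x \<Longrightarrow> snd x \<le> T \<Longrightarrow> x \<notin> N \<Longrightarrow>
      \<bar>ev g x y z - ev g x y' z'\<bar> \<le> C * (\<bar>y - y'\<bar> + norm (z - z'))"
    using driver_lipschitz[OF drv T] by blast
  define h where "h c x = indicator (- N) x * slab 0 T (\<lambda>s \<omega>. g s \<omega> (fst c) (snd c)) x" for c x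
  define H where "H x = h (slab 0 T Y x, slab 0 T Z x) x" for x
  define f where "f s \<omega> = H (\<omega>, s)" for s \<omega>
  have [measurable]: "N \<in> sets MT" using N by auto
  have g_m: "slab 0 T (\<lambda>s \<omega>. g s \<omega> y z) \<in> borel_measurable MT" for y z
    using drv T by (intro slab_measurable) (auto simp: standard_driver_def)
  have h_lip: "\<bar>h (y, z) x - h (y', z') x\<bar> \<le> C * (\<bar>y - y'\<bar> + norm (z - z'))" if x: "x \<in> space MT" for x y y' z z'
  proof (cases "0 < snd x \<and> snd x \<le> T \<and> x \<notin> N")
    case True
    then show ?thesis using lip[OF x, of y z y' z'] by (simp add: h_def slab_in)
  next
    case False
    then have "h c x = 0" for c by (auto simp: h_def slab_out indicator_def)
    then show ?thesis using C by simp
  qed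
  have H_m: "H \<in> borel_measurable MT"
    unfolding H_def[abs_def]
  proof (rule borel_measurable_Caratheodory[where h=h])
    show "h c \<in> borel_measurable MT" for c
      unfolding h_def using g_m[of "fst c" "snd c"] by measurable
    show "continuous_on UNIV (\<lambda>c. h c x)" if "x \<in> space MT" for x
      using lipschitz_imp_continuous_pair[of C "\<lambda>y z. h (y, z) x"] C h_lip[OF that] by simp
    show "(\<lambda>x. (slab 0 T Y x, slab 0 T Z x)) \<in> borel_measurable MT"
      using sq_integrable_measurable[OF Y] sq_integrable_measurable[OF Z] by measurable
  qed
  have H_eq: "slab 0 T f = H"
    by (auto simp: fun_eq_iff slab_def f_def H_def h_def indicator_def)
  have g0: "sq_integrable MT (slab 0 T (\<lambda>s \<omega>. g s \<omega> 0 0))"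
    using drv unfolding sq_integrable_slab_iff[OF g_m] by (simp add: standard_driver_def)
  have "sq_integrable MT H"
  proof (rule sq_integrable_bound[OF _ H_m, where c=1])
    show "sq_integrable MT (\<lambda>x. \<bar>slab 0 T (\<lambda>s \<omega>. g s \<omega> 0 0) x\<bar> + C *\<^sub>R (\<bar>slab 0 T Y x\<bar> + norm (slab 0 T Z x)))"
      using sq_integrable_norm[OF g0] sq_integrable_norm[OF Y] sq_integrable_norm[OF Z]
      by (intro sq_integrable_add sq_integrable_scaleR) auto
    show "AE x in MT. norm (H x)
        \<le> 1 * norm (\<bar>slab 0 T (\<lambda>s \<omega>. g s \<omega> 0 0) x\<bar> + C *\<^sub>R (\<bar>slab 0 T Y x\<bar> + norm (slab 0 T Z x)))"
    proof (rule AE_I2)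
      fix x assume x: "x \<in> space MT"
      have "\<bar>H x - h (0, 0) x\<bar> \<le> C * (\<bar>slab 0 T Y x\<bar> + norm (slab 0 T Z x))"
        using h_lip[OF x, of "slab 0 T Y x" "slab 0 T Z x" 0 0] by (simp add: H_def)
      moreover have "\<bar>h (0, 0) x\<bar> \<le> \<bar>slab 0 T (\<lambda>s \<omega>. g s \<omega> 0 0) x\<bar>"
        by (simp add: h_def indicator_def)
      ultimately have "\<bar>H x\<bar> \<le> \<bar>slab 0 T (\<lambda>s \<omega>. g s \<omega> 0 0) x\<bar> + C * (\<bar>slab 0 T Y x\<bar> + norm (slab 0 T Z x))"
        by linarith
      also note abs_ge_self
      finally show "norm (H x)
        \<le> 1 * norm (\<bar>slab 0 T (\<lambda>s \<omega>. g s \<omega> 0 0) x\<bar> + C *\<^sub>R (\<bar>slab 0 T Y x\<bar> + norm (slab 0 T Z x)))"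
        by (simp only: real_norm_def real_scaleR_def mult_1)
    qed
  qed
  then have "sq_integrable MT (slab 0 T f)" by (simp add: H_eq)
  moreover have "AE x in MT. 0 < snd x \<and> snd x \<le> T \<longrightarrow>
      ev f x = ev g x (ev Y x) (ev Z x)"
    using AE_not_in[OF N] by eventually_elim (auto simp: f_def H_def h_def slab_in)
  ultimately show ?thesis by (rule that)
qed

text \<open>Integrals up to \<open>T\<close> are given, each with its own approximating sequence, so
  the integral over (p, q] is realised as a difference. In its second moment the cross term of the
  isometry is the integral over (q, T], which cancels what lies beyond \<open>q\<close>.\<close>

lemma ito_increment_diff_integral:
  assumes Jp: "has_ito_integral M F B Z p T Jp" and Jq: "has_ito_integral M F B Z q T Jq"
    and pq: "0 \<le> p" "p \<le> q" "q \<le> T" and Z: "sq_integrable MT (slab 0 T Z)"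
  shows "ito_increment p q Z (\<lambda>s \<omega>. (norm (Z s \<omega>))\<^sup>2) (\<lambda>\<omega>. Jp \<omega> - Jq \<omega>)"
proof -
  have q: "0 \<le> q" using pq by simp
  have Zp: "sq_integrable MT (slab p T Z)" and Zq: "sq_integrable MT (slab q T Z)"
    and Zpq: "sq_integrable MT (slab p q Z)"
    using pq by (auto intro!: slab_sq_integrable_sub[OF Z])
  note Jp = Jp pq(1) Zp and Jq = Jq q Zq
  note J2 = ito_integral_sq_integrable[OF Jp] ito_integral_sq_integrable[OF Jq]
  note int = integrable_mult_sq
  have split: "slab p T Z x = slab p q Z x + slab q T Z x" for x
    using pq by (intro slab_split) auto
  show ?thesis unfolding ito_increment_def
  proof (intro conjI allI impI)
    show "sq_integrable M (\<lambda>\<omega>. Jp \<omega> - Jq \<omega>)" by (intro sq_integrable_diff J2)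
  next
    fix G :: "'w \<Rightarrow> real" assume G: "sq_integrable M G" "G \<in> borel_measurable (F p)"
    have "(\<integral>\<omega>. G \<omega> * (Jp \<omega> - Jq \<omega>) \<partial>M) = (\<integral>\<omega>. G \<omega> * Jp \<omega> \<partial>M) - (\<integral>\<omega>. G \<omega> * Jq \<omega> \<partial>M)"
      unfolding right_diff_distrib by (intro Bochner_Integration.integral_diff int G J2)
    then show "(\<integral>\<omega>. G \<omega> * (Jp \<omega> - Jq \<omega>) \<partial>M) = 0"
      using ito_integral_orthogonal[OF Jp G] ito_integral_orthogonal[OF Jq G(1) measurable_F_mono[OF G(2) pq(2)]]
      by simp
  next
    fix k :: "'w \<Rightarrow> real ^ 'd" assume k: "sq_integrable M k" "k \<in> borel_measurable (F p)"
    let ?k = "slab p q (\<lambda>_. k)"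
    have k2: "sq_integrable MT ?k" by (rule slab_const_sq_integrable[OF k(1)])
    have "(\<integral>\<omega>. (k \<omega> \<bullet> (B q \<omega> - B p \<omega>)) * (Jp \<omega> - Jq \<omega>) \<partial>M)
        = (\<integral>\<omega>. (k \<omega> \<bullet> (B q \<omega> - B p \<omega>)) * Jp \<omega> \<partial>M) - (\<integral>\<omega>. (k \<omega> \<bullet> (B q \<omega> - B p \<omega>)) * Jq \<omega> \<partial>M)"
      unfolding right_diff_distrib
      by (intro Bochner_Integration.integral_diff int mult_increment_sq_integrable(1)[OF k pq(1,2)] J2)
    also have "\<dots> = (\<integral>x. ?k x \<bullet> slab p T Z x \<partial>MT) - (\<integral>x. ?k x \<bullet> slab q T Z x \<partial>MT)"
      by (simp only: ito_integral_times_increment[OF Jp k pq(1,2)] ito_integral_times_increment[OF Jq k pq(1,2)])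
    also have "\<dots> = (\<integral>x. ?k x \<bullet> slab p T Z x - ?k x \<bullet> slab q T Z x \<partial>MT)"
      by (intro Bochner_Integration.integral_diff[symmetric] integrable_inner_sq k2 Zp Zq)
    also have "\<dots> = (\<integral>x. ?k x \<bullet> slab p q Z x \<partial>MT)"
      by (simp add: split inner_add_right)
    finally show "(\<integral>\<omega>. (k \<omega> \<bullet> (B q \<omega> - B p \<omega>)) * (Jp \<omega> - Jq \<omega>) \<partial>M) = (\<integral>x. ?k x \<bullet> slab p q Z x \<partial>MT)" .
  next
    have "(\<integral>\<omega>. (Jp \<omega> - Jq \<omega>)\<^sup>2 \<partial>M) = (\<integral>\<omega>. Jp \<omega> * Jp \<omega> - 2 * (Jp \<omega> * Jq \<omega>) + Jq \<omega> * Jq \<omega> \<partial>M)"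
      by (intro Bochner_Integration.integral_cong refl) (simp add: power2_eq_square algebra_simps)
    also have "\<dots> = (\<integral>\<omega>. Jp \<omega> * Jp \<omega> \<partial>M) - 2 * (\<integral>\<omega>. Jp \<omega> * Jq \<omega> \<partial>M) + (\<integral>\<omega>. Jq \<omega> * Jq \<omega> \<partial>M)"
      using int[OF J2(1) J2(1)] int[OF J2] int[OF J2(2) J2(2)] by simp
    also have "\<dots> = (\<integral>x. slab p T Z x \<bullet> slab p T Z x \<partial>MT) - 2 * (\<integral>x. slab p T Z x \<bullet> slab q T Z x \<partial>MT)
        + (\<integral>x. slab q T Z x \<bullet> slab q T Z x \<partial>MT)"
      by (simp only: ito_isometry[OF Jp Jp] ito_isometry[OF Jp Jq] ito_isometry[OF Jq Jq])
    also have "\<dots> = (\<integral>x. slab p T Z x \<bullet> slab p T Z x - 2 * (slab p T Z x \<bullet> slab q T Z x)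
        + slab q T Z x \<bullet> slab q T Z x \<partial>MT)"
      using integrable_inner_sq[OF Zp Zp] integrable_inner_sq[OF Zp Zq]
        integrable_inner_sq[OF Zq Zq] by simp
    also have "\<dots> = (\<integral>x. slab p q (\<lambda>s \<omega>. (norm (Z s \<omega>))\<^sup>2) x \<partial>MT)"
      by (intro Bochner_Integration.integral_cong refl)
        (simp add: split slab_inner power2_norm_eq_inner inner_add_left inner_add_right inner_commute)
    finally show "(\<integral>\<omega>. (Jp \<omega> - Jq \<omega>)\<^sup>2 \<partial>M) \<le> (\<integral>x. slab p q (\<lambda>s \<omega>. (norm (Z s \<omega>))\<^sup>2) x \<partial>MT)" by simp
  qed
qed

lemma bsde_dynamics:
  assumes sol: "bsde_solution M F B T \<xi> g Y Z" and drv: "standard_driver M F T g"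
    and \<xi>: "L2_rv M (F T) \<xi>" and T: "0 \<le> T"
  obtains f where "sq_integrable MT (slab 0 T f)"
    "AE x in MT. 0 < snd x \<and> snd x \<le> T \<longrightarrow>
      ev f x = ev g x (ev Y x) (ev Z x)"
    "\<And>t. 0 \<le> t \<Longrightarrow> t \<le> T \<Longrightarrow> sq_integrable M (Y t)"
    "\<And>p q. 0 \<le> p \<Longrightarrow> p \<le> q \<Longrightarrow> q \<le> T \<Longrightarrow> \<exists>L. ito_increment p q Z (\<lambda>s \<omega>. (norm (Z s \<omega>))\<^sup>2) L \<and>
      (AE \<omega> in M. Y p \<omega> = Y q \<omega> + (\<integral>s. slab p q f (\<omega>, s) \<partial>lborel) - L \<omega>)"
    "AE \<omega> in M. Y T \<omega> = \<xi> \<omega>"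
    "sq_integrable MT (slab 0 T Y)" "sq_integrable MT (slab 0 T Z)"
proof -
  have Ym: "measurable_adapted M F T Y" and Zm: "measurable_adapted M F T Z"
    using sol by (auto simp: bsde_solution_def)
  have Y: "sq_integrable MT (slab 0 T Y)" and Z: "sq_integrable MT (slab 0 T Z)"
    using sol sq_integrable_slab_iff[OF slab_measurable[OF Ym T]]
      sq_integrable_slab_iff[OF slab_measurable[OF Zm T]] by (auto simp: bsde_solution_def)
  obtain f where f: "sq_integrable MT (slab 0 T f)" and f_eq: "AE x in MT. 0 < snd x \<and> snd x \<le> T \<longrightarrow>
      ev f x = ev g x (ev Y x) (ev Z x)"
    using generator_process[OF drv T Y Z] .
  have f_sub: "sq_integrable MT (slab t T f)" if "0 \<le> t" for t
    using that by (intro slab_sq_integrable_sub[OF f]) auto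
  have ex: "\<exists>J. has_ito_integral M F B Z t T J \<and>
      (AE \<omega> in M. Y t \<omega> = \<xi> \<omega> + (\<integral>s. slab t T f (\<omega>, s) \<partial>lborel) - J \<omega>)" if t: "0 \<le> t" "t \<le> T" for t
  proof -
    obtain J where J: "has_ito_integral M F B Z t T J"
      and eq: "AE \<omega> in M. Y t \<omega> = \<xi> \<omega> + (LINT s:{t..T}|lebesgue. g s \<omega> (Y s \<omega>) (Z s \<omega>)) - J \<omega>"
      using sol t unfolding bsde_solution_def by (meson atLeastAtMost_iff)
    have "AE \<omega> in M. Y t \<omega> = \<xi> \<omega> + (\<integral>s. slab t T f (\<omega>, s) \<partial>lborel) - J \<omega>"
      using eq MT.AE_pair[OF f_eq] AE_space
    proof eventually_elim
      fix \<omega> assume eq: "Y t \<omega> = \<xi> \<omega> + (LINT s:{t..T}|lebesgue. g s \<omega> (Y s \<omega>) (Z s \<omega>)) - J \<omega>"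
        and ae: "AE s in lborel. 0 < snd (\<omega>, s) \<and> snd (\<omega>, s) \<le> T \<longrightarrow>
          f (snd (\<omega>, s)) (fst (\<omega>, s)) = g (snd (\<omega>, s)) (fst (\<omega>, s)) (Y (snd (\<omega>, s)) (fst (\<omega>, s))) (Z (snd (\<omega>, s)) (fst (\<omega>, s)))"
        and \<omega>: "\<omega> \<in> space M"
      \<comment> \<open>\<open>lebesgue\<close> is the completion of \<open>lborel\<close>, and the
        integrand agrees almost everywhere with a Borel measurable section of the slab; the left end
        point \<open>t\<close> is a null set.\<close>
      have "(LINT s:{t..T}|lebesgue. g s \<omega> (Y s \<omega>) (Z s \<omega>)) = (\<integral>s. slab t T f (\<omega>, s) \<partial>lborel)"
        unfolding set_lebesgue_integral_def
      proof (rule integral_completion_cong_AE)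
        show "(\<lambda>s. slab t T f (\<omega>, s)) \<in> borel_measurable lborel"
          using sq_integrable_measurable[OF f_sub[OF t(1)]] \<omega> by measurable
        show "AE s in lborel. indicat_real {t..T} s *\<^sub>R g s \<omega> (Y s \<omega>) (Z s \<omega>) = slab t T f (\<omega>, s)"
          using ae AE_lborel_singleton[of t]
          by eventually_elim (use t in \<open>auto simp: slab_apply indicator_def\<close>)
      qed
      then show "Y t \<omega> = \<xi> \<omega> + (\<integral>s. slab t T f (\<omega>, s) \<partial>lborel) - J \<omega>" using eq by simp
    qed
    with J show ?thesis by blast
  qed
  define J where "J t = (SOME J. has_ito_integral M F B Z t T J \<and>
      (AE \<omega> in M. Y t \<omega> = \<xi> \<omega> + (\<integral>s. slab t T f (\<omega>, s) \<partial>lborel) - J \<omega>))" for t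
  have J: "has_ito_integral M F B Z t T (J t)"
    and J_eq: "AE \<omega> in M. Y t \<omega> = \<xi> \<omega> + (\<integral>s. slab t T f (\<omega>, s) \<partial>lborel) - J t \<omega>" if "0 \<le> t" "t \<le> T" for t
    using someI_ex[OF ex[OF that]] unfolding J_def by simp_all
  have Z_sub: "sq_integrable MT (slab t T Z)" if "0 \<le> t" for t
    using that by (intro slab_sq_integrable_sub[OF Z]) auto
  have J2: "sq_integrable M (J t)" if "0 \<le> t" "t \<le> T" for t
    by (rule ito_integral_sq_integrable[OF J[OF that] that(1) Z_sub[OF that(1)]])
  have \<xi>2: "sq_integrable M \<xi>"
    using \<xi> measurable_F_M by (auto simp: L2_rv_def sq_integrable_def)
  show ?thesis
  proof (rule that[OF f f_eq _ _ _ Y Z])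
    \<comment> \<open>\<open>bsde_solution\<close> bounds \<open>Y\<close> on the product space
      only; square integrability at a fixed time is read off the equation.\<close>
    fix t assume t: "0 \<le> t" "t \<le> T"
    have "sq_integrable M (\<lambda>\<omega>. \<xi> \<omega> + (\<integral>s. slab t T f (\<omega>, s) \<partial>lborel) - J t \<omega>)"
      by (intro sq_integrable_diff sq_integrable_add \<xi>2 J2 t slab_section_integral(2) f_sub)
    moreover have "Y t \<in> borel_measurable M"
      using Ym t measurable_F_M by (auto simp: measurable_adapted_def)
    ultimately show "sq_integrable M (Y t)"
      by (rule sq_integrable_bound[where c=1]) (use J_eq[OF t] in auto)
  next
    fix p q assume pq: "0 \<le> p" "p \<le> q" "q \<le> T"
    have q: "0 \<le> q" and p: "p \<le> T" using pq by auto
    have "AE \<omega> in M. Y p \<omega> = Y q \<omega> + (\<integral>s. slab p q f (\<omega>, s) \<partial>lborel) - (J p \<omega> - J q \<omega>)"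
      using J_eq[OF pq(1) p] J_eq[OF q pq(3)] slab_section_integral(1)[OF f_sub[OF q] pq(3)]
        slab_section_integral(1)[OF slab_sq_integrable_sub[OF f pq(1,3)] pq(2)]
    proof eventually_elim
      fix \<omega> assume 1: "Y p \<omega> = \<xi> \<omega> + (\<integral>s. slab p T f (\<omega>, s) \<partial>lborel) - J p \<omega>"
        "Y q \<omega> = \<xi> \<omega> + (\<integral>s. slab q T f (\<omega>, s) \<partial>lborel) - J q \<omega>"
        and 2: "integrable lborel (\<lambda>s. slab q T f (\<omega>, s))" "integrable lborel (\<lambda>s. slab p q f (\<omega>, s))"
      have "slab p T f (\<omega>, s) = slab p q f (\<omega>, s) + slab q T f (\<omega>, s)" for s
        using pq by (intro slab_split) auto
      then show "Y p \<omega> = Y q \<omega> + (\<integral>s. slab p q f (\<omega>, s) \<partial>lborel) - (J p \<omega> - J q \<omega>)"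
        using 1 2 by simp
    qed
    then show "\<exists>L. ito_increment p q Z (\<lambda>s \<omega>. (norm (Z s \<omega>))\<^sup>2) L \<and>
      (AE \<omega> in M. Y p \<omega> = Y q \<omega> + (\<integral>s. slab p q f (\<omega>, s) \<partial>lborel) - L \<omega>)"
      using ito_increment_diff_integral[OF J[OF pq(1) p] J[OF q pq(3)] pq Z] by blast
  next
    have 0: "slab T T X x = 0" for X :: "('w, 'b::real_normed_vector) process" and x
      by (simp add: slab_def)
    \<comment> \<open>The slab (T, T] is empty, so by the isometry the integral vanishes and the
      terminal value is attained.\<close>
    have "(\<integral>\<omega>. (J T \<omega>)\<^sup>2 \<partial>M) = 0"
      using ito_isometry[OF J[OF T order_refl] T Z_sub[OF T] J[OF T order_refl] T Z_sub[OF T]]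
      by (simp add: slab_def power2_eq_square)
    then have "AE \<omega> in M. (J T \<omega>)\<^sup>2 = 0"
      using integral_nonneg_eq_0_iff_AE[OF sq_integrable_sq[OF J2[OF T order_refl]]] by simp
    then show "AE \<omega> in M. Y T \<omega> = \<xi> \<omega>"
      using J_eq[OF T order_refl] by eventually_elim (simp add: slab_def)
  qed
qed

text \<open>The definition of the integral already supplies simple processes converging to
  \<open>Z\<close>; their partition points serve as jump times.\<close>

lemma ito_integrable_approximable:
  assumes J: "has_ito_integral M F B Z a b J" and a: "0 \<le> a"
    and Z: "sq_integrable MT (slab a b Z)"
  shows "approximable a b Z"
proof (rule approximableI)
  fix \<epsilon> :: real assume \<epsilon>: "0 < \<epsilon>"
  from J obtain n \<tau> h where s: "\<And>k. simple_integrand F a b (n k) (\<tau> k) (h k)"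
    and l: "(\<lambda>k. sq_norm_on M a b (\<lambda>s \<omega>. simple_process (n k) (\<tau> k) (h k) s \<omega> - Z s \<omega>)) \<longlonglongrightarrow> 0"
    unfolding has_ito_integral_def by blast
  have "\<forall>\<^sub>F k in sequentially. sq_norm_on M a b (\<lambda>s \<omega>. simple_process (n k) (\<tau> k) (h k) s \<omega> - Z s \<omega>) < ennreal \<epsilon>"
    using l \<epsilon> by (intro order_tendstoD) auto
  then obtain k where k: "sq_norm_on M a b (\<lambda>s \<omega>. simple_process (n k) (\<tau> k) (h k) s \<omega> - Z s \<omega>) < ennreal \<epsilon>"
    by (meson eventually_sequentially order_refl)
  define v where "v = simple_process (n k) (\<tau> k) (h k)"
  have v: "sq_integrable MT (slab a b v)"
  proof -
    have "slab a b v = (\<lambda>x. \<Sum>i<n k. slab (\<tau> k i) (\<tau> k (Suc i)) (\<lambda>_. h k i) x)"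
      using slab_simple_process[OF s] by (simp add: v_def fun_eq_iff)
    then show ?thesis
      using simple_integrand_coeff(3)[OF s, of _ k] by (auto intro!: sq_integrable_sum slab_const_sq_integrable)
  qed
  have d: "slab a b (\<lambda>s \<omega>. v s \<omega> - Z s \<omega>) = (\<lambda>x. slab a b v x - slab a b Z x)"
    by (simp add: fun_eq_iff slab_diff)
  have vZ: "sq_integrable MT (\<lambda>x. slab a b v x - slab a b Z x)" by (intro sq_integrable_diff v Z)
  have "sq_norm_on M a b (\<lambda>s \<omega>. v s \<omega> - Z s \<omega>) = (\<integral>\<^sup>+ x. ennreal ((norm (slab a b v x - slab a b Z x))\<^sup>2) \<partial>MT)"
    using sq_norm_on_eq[of a b "\<lambda>s \<omega>. v s \<omega> - Z s \<omega>"] sq_integrable_measurable[OF vZ] by (simp add: d)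
  also have "\<dots> = ennreal (\<integral>x. (norm (slab a b v x - slab a b Z x))\<^sup>2 \<partial>MT)"
    by (rule nn_integral_eq_integral[OF sq_integrable_norm_sq[OF vZ]]) simp
  finally have "(\<integral>x. (norm (slab a b v x - slab a b Z x))\<^sup>2 \<partial>MT) \<le> \<epsilon>"
    using k \<epsilon> by (simp add: v_def ennreal_less_iff)
  moreover have "norm (slab a b v x - slab a b Z x) = norm (slab a b Z x - slab a b v x)" for x
    by (rule norm_minus_commute)
  ultimately have le: "(\<integral>x. (norm (slab a b Z x - slab a b v x))\<^sup>2 \<partial>MT) \<le> \<epsilon>" by (simp only:)
  have const: "\<exists>w \<in> borel_measurable (F p). \<forall>s\<in>{p<..q}. \<forall>\<omega>\<in>space M. v s \<omega> = w \<omega>"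
    if pq: "a \<le> p" "p < q" "q \<le> b" "\<tau> k ` {..n k} \<inter> {p<..<q} = {}" for p q
  proof -
    \<comment> \<open>The indices whose interval covers (p, q]; with no partition point inside,
      every other interval misses it. A sum over \<open>I\<close> also covers the case of an empty
      \<open>I\<close>, and \<open>\<tau> k i \<le> p\<close> makes the coefficients measurable at
      time \<open>p\<close>.\<close>
    define I where "I = {i. i < n k \<and> \<tau> k i \<le> p \<and> q \<le> \<tau> k (Suc i)}"
    have I: "finite I" "I \<subseteq> {..<n k}" by (auto simp: I_def)
    have m: "(\<lambda>\<omega>. \<Sum>i\<in>I. h k i \<omega>) \<in> borel_measurable (F p)"
    proof (rule borel_measurable_sum)
      fix i assume "i \<in> I"
      then show "h k i \<in> borel_measurable (F p)"
        using measurable_F_mono[OF simple_integrand_coeff(1)[OF s, of i k], of p] by (simp add: I_def)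
    qed
    have "v s \<omega> = (\<Sum>i\<in>I. h k i \<omega>)" if s: "s \<in> {p<..q}" for s \<omega>
    proof -
      have "indicator {\<tau> k i<..\<tau> k (Suc i)} s *\<^sub>R h k i \<omega> = (if i \<in> I then h k i \<omega> else 0)" if i: "i < n k" for i
      proof -
        have "\<tau> k i \<in> \<tau> k ` {..n k}" "\<tau> k (Suc i) \<in> \<tau> k ` {..n k}" using i by auto
        then have "\<tau> k i \<notin> {p<..<q}" "\<tau> k (Suc i) \<notin> {p<..<q}" using pq(4) by blast+
        then show ?thesis using s i by (auto simp: I_def indicator_def)
      qed
      then have "v s \<omega> = (\<Sum>i<n k. if i \<in> I then h k i \<omega> else 0)"
        unfolding v_def simple_process_def by (intro sum.cong refl) simp
      also have "\<dots> = (\<Sum>i\<in>{..<n k} \<inter> I. h k i \<omega>)" by (rule sum.inter_restrict[symmetric]) simp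
      also have "{..<n k} \<inter> I = I" using I by blast
      finally show ?thesis .
    qed
    with m show ?thesis by (intro bexI[of _ "\<lambda>\<omega>. \<Sum>i\<in>I. h k i \<omega>"]) simp_all
  qed
  have "predictable_step a b (\<tau> k ` {..n k}) v"
    unfolding predictable_step_def using const by simp
  with v le show "\<exists>S v. predictable_step a b S v \<and> sq_integrable MT (slab a b v) \<and>
    (\<integral>x. (norm (slab a b Z x - slab a b v x))\<^sup>2 \<partial>MT) \<le> \<epsilon>" by blast
qed


lemma approximable_sub:
  assumes V: "approximable a b V" "sq_integrable MT (slab a b V)" and cd: "a \<le> c" "d \<le> b"
  shows "approximable c d V"
proof (rule approximableI)
  fix \<epsilon> :: real assume \<epsilon>: "0 < \<epsilon>"
  obtain S v where Sv: "predictable_step a b S v" and v: "sq_integrable MT (slab a b v)"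
    and le: "(\<integral>x. (norm (slab a b V x - slab a b v x))\<^sup>2 \<partial>MT) \<le> \<epsilon>"
    by (rule approximableE[OF V(1) \<epsilon>])
  have v': "sq_integrable MT (slab c d v)" by (rule slab_sq_integrable_sub[OF v cd])
  have "(\<integral>x. (norm (slab c d V x - slab c d v x))\<^sup>2 \<partial>MT) \<le> (\<integral>x. (norm (slab a b V x - slab a b v x))\<^sup>2 \<partial>MT)"
    by (intro integral_mono sq_integrable_norm_sq sq_integrable_diff v v' V
        slab_sq_integrable_sub[OF V(2) cd]) (use cd in \<open>auto simp: slab_def indicator_def\<close>)
  then have le': "(\<integral>x. (norm (slab c d V x - slab c d v x))\<^sup>2 \<partial>MT) \<le> \<epsilon>" using le by (rule order_trans)
  have "predictable_step c d S v"
    using Sv order_trans[OF cd(1)] order_trans[OF _ cd(2)] unfolding predictable_step_def by simp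
  then show "\<exists>S v. predictable_step c d S v \<and> sq_integrable MT (slab c d v) \<and>
    (\<integral>x. (norm (slab c d V x - slab c d v x))\<^sup>2 \<partial>MT) \<le> \<epsilon>"
    using v' le' by (intro exI conjI)
qed

lemma approximable_diff:
  assumes V: "approximable a b V" "sq_integrable MT (slab a b V)"
    and V': "approximable a b V'" "sq_integrable MT (slab a b V')"
  shows "approximable a b (\<lambda>s \<omega>. V s \<omega> - V' s \<omega>)"
proof (rule approximableI)
  fix \<epsilon> :: real assume "0 < \<epsilon>"
  \<comment> \<open>A quarter for each process, since the square of a sum is at most twice the sum
    of the squares.\<close>
  then have \<epsilon>: "0 < \<epsilon> / 4" by simp
  obtain S v where Sv: "predictable_step a b S v" and v: "sq_integrable MT (slab a b v)"
    and le: "(\<integral>x. (norm (slab a b V x - slab a b v x))\<^sup>2 \<partial>MT) \<le> \<epsilon> / 4"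
    by (rule approximableE[OF V(1) \<epsilon>])
  obtain S' v' where Sv': "predictable_step a b S' v'" and v': "sq_integrable MT (slab a b v')"
    and le': "(\<integral>x. (norm (slab a b V' x - slab a b v' x))\<^sup>2 \<partial>MT) \<le> \<epsilon> / 4"
    by (rule approximableE[OF V'(1) \<epsilon>])
  let ?V = "\<lambda>s \<omega>. V s \<omega> - V' s \<omega>" and ?v = "\<lambda>s \<omega>. v s \<omega> - v' s \<omega>"
  have dv: "slab a b ?v = (\<lambda>x. slab a b v x - slab a b v' x)" and dV: "slab a b ?V = (\<lambda>x. slab a b V x - slab a b V' x)"
    by (simp_all add: fun_eq_iff slab_diff)
  have v2: "sq_integrable MT (slab a b ?v)" and V2: "sq_integrable MT (slab a b ?V)"
    unfolding dv dV by (intro sq_integrable_diff v v' V V')+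
  have i: "integrable MT (\<lambda>x. (norm (slab a b V x - slab a b v x))\<^sup>2)"
    "integrable MT (\<lambda>x. (norm (slab a b V' x - slab a b v' x))\<^sup>2)"
    by (intro sq_integrable_norm_sq sq_integrable_diff v v' V V')+
  have "(\<integral>x. (norm (slab a b ?V x - slab a b ?v x))\<^sup>2 \<partial>MT)
      \<le> (\<integral>x. 2 * (norm (slab a b V x - slab a b v x))\<^sup>2 + 2 * (norm (slab a b V' x - slab a b v' x))\<^sup>2 \<partial>MT)"
  proof (rule integral_mono)
    show "integrable MT (\<lambda>x. (norm (slab a b ?V x - slab a b ?v x))\<^sup>2)"
      by (intro sq_integrable_norm_sq sq_integrable_diff v2 V2)
    show "integrable MT (\<lambda>x. 2 * (norm (slab a b V x - slab a b v x))\<^sup>2 + 2 * (norm (slab a b V' x - slab a b v' x))\<^sup>2)"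
      using i by simp
    fix x
    have "slab a b ?V x - slab a b ?v x = (slab a b V x - slab a b v x) + - (slab a b V' x - slab a b v' x)"
      by (simp add: slab_diff)
    then show "(norm (slab a b ?V x - slab a b ?v x))\<^sup>2
        \<le> 2 * (norm (slab a b V x - slab a b v x))\<^sup>2 + 2 * (norm (slab a b V' x - slab a b v' x))\<^sup>2"
      using norm_add_sq_le[of "slab a b V x - slab a b v x" "- (slab a b V' x - slab a b v' x)"]
      by (simp only: norm_minus_cancel)
  qed
  also have "\<dots> \<le> \<epsilon>" using i le le' by simp
  finally have e: "(\<integral>x. (norm (slab a b ?V x - slab a b ?v x))\<^sup>2 \<partial>MT) \<le> \<epsilon>" .
  have "predictable_step a b (S \<union> S') ?v"
    unfolding predictable_step_def
  proof (intro conjI allI impI)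
    show "finite (S \<union> S')" using Sv Sv' by (simp add: predictable_step_def)
    fix p q assume pq: "a \<le> p" "p < q" "q \<le> b" and "(S \<union> S') \<inter> {p<..<q} = {}"
    then have 0: "S \<inter> {p<..<q} = {}" "S' \<inter> {p<..<q} = {}" by auto
    obtain u where u: "u \<in> borel_measurable (F p)" "\<And>s \<omega>. s \<in> {p<..q} \<Longrightarrow> \<omega> \<in> space M \<Longrightarrow> v s \<omega> = u \<omega>"
      by (rule predictable_stepE[OF Sv pq 0(1)]) (rule that, auto)
    obtain u' where u': "u' \<in> borel_measurable (F p)" "\<And>s \<omega>. s \<in> {p<..q} \<Longrightarrow> \<omega> \<in> space M \<Longrightarrow> v' s \<omega> = u' \<omega>"
      by (rule predictable_stepE[OF Sv' pq 0(2)]) (rule that, auto)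
    show "\<exists>w \<in> borel_measurable (F p). \<forall>s\<in>{p<..q}. \<forall>\<omega>\<in>space M. ?v s \<omega> = w \<omega>"
      using u u' by (intro bexI[of _ "\<lambda>\<omega>. u \<omega> - u' \<omega>"] borel_measurable_diff) simp_all
  qed
  with v2 e show "\<exists>S v. predictable_step a b S v \<and> sq_integrable MT (slab a b v) \<and>
    (\<integral>x. (norm (slab a b ?V x - slab a b v x))\<^sup>2 \<partial>MT) \<le> \<epsilon>"
    by (intro exI[of _ "S \<union> S'"] exI[of _ ?v] conjI)
qed

text \<open>The pairing clauses are linear; for the second moment the crude bound 2 m + 2 m' avoids
  the cross term.\<close>

lemma ito_increment_diff:
  assumes L: "ito_increment p q V m L" and L': "ito_increment p q V' m' L'" and pq: "0 \<le> p" "p \<le> q"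
    and V: "sq_integrable MT (slab p q V)" "sq_integrable MT (slab p q V')"
    and m: "integrable MT (slab p q m)" "integrable MT (slab p q m')"
  shows "ito_increment p q (\<lambda>s \<omega>. V s \<omega> - V' s \<omega>) (\<lambda>s \<omega>. 2 * m s \<omega> + 2 * m' s \<omega>) (\<lambda>\<omega>. L \<omega> - L' \<omega>)"
proof -
  have L2: "sq_integrable M L" "sq_integrable M L'"
    using L L' by (auto simp: ito_increment_def)
  note int = integrable_mult_sq
  show ?thesis unfolding ito_increment_def
  proof (intro conjI allI impI)
    show "sq_integrable M (\<lambda>\<omega>. L \<omega> - L' \<omega>)" by (intro sq_integrable_diff L2)
  next
    fix G :: "'w \<Rightarrow> real" assume G: "sq_integrable M G" "G \<in> borel_measurable (F p)"
    then have "(\<integral>\<omega>. G \<omega> * L \<omega> \<partial>M) = 0" "(\<integral>\<omega>. G \<omega> * L' \<omega> \<partial>M) = 0"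
      using L L' by (auto simp: ito_increment_def)
    then show "(\<integral>\<omega>. G \<omega> * (L \<omega> - L' \<omega>) \<partial>M) = 0"
      using int[OF G(1) L2(1)] int[OF G(1) L2(2)] by (simp add: right_diff_distrib)
  next
    fix k :: "'w \<Rightarrow> real ^ 'd" assume k: "sq_integrable M k" "k \<in> borel_measurable (F p)"
    let ?x = "\<lambda>\<omega>. k \<omega> \<bullet> (B q \<omega> - B p \<omega>)" and ?k = "slab p q (\<lambda>_. k)"
    have x2: "sq_integrable M ?x" by (rule mult_increment_sq_integrable(1)[OF k pq])
    have k2: "sq_integrable MT ?k" by (rule slab_const_sq_integrable[OF k(1)])
    have "(\<integral>\<omega>. ?x \<omega> * (L \<omega> - L' \<omega>) \<partial>M) = (\<integral>\<omega>. ?x \<omega> * L \<omega> \<partial>M) - (\<integral>\<omega>. ?x \<omega> * L' \<omega> \<partial>M)"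
      unfolding right_diff_distrib by (intro Bochner_Integration.integral_diff int x2 L2)
    also have "\<dots> = (\<integral>x. ?k x \<bullet> slab p q V x \<partial>MT) - (\<integral>x. ?k x \<bullet> slab p q V' x \<partial>MT)"
      using L L' k by (simp add: ito_increment_def)
    also have "\<dots> = (\<integral>x. ?k x \<bullet> slab p q V x - ?k x \<bullet> slab p q V' x \<partial>MT)"
      by (intro Bochner_Integration.integral_diff[symmetric] integrable_inner_sq k2 V)
    finally show "(\<integral>\<omega>. ?x \<omega> * (L \<omega> - L' \<omega>) \<partial>M) = (\<integral>x. ?k x \<bullet> slab p q (\<lambda>s \<omega>. V s \<omega> - V' s \<omega>) x \<partial>MT)"
      by (simp only: slab_diff inner_diff_right)
  next
    note i = sq_integrable_sq[OF L2(1)] sq_integrable_sq[OF L2(2)]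
    have "(\<integral>\<omega>. (L \<omega> - L' \<omega>)\<^sup>2 \<partial>M) \<le> (\<integral>\<omega>. 2 * (L \<omega>)\<^sup>2 + 2 * (L' \<omega>)\<^sup>2 \<partial>M)"
    proof (rule integral_mono)
      show "integrable M (\<lambda>\<omega>. (L \<omega> - L' \<omega>)\<^sup>2)" by (intro sq_integrable_sq sq_integrable_diff L2)
      show "(L \<omega> - L' \<omega>)\<^sup>2 \<le> 2 * (L \<omega>)\<^sup>2 + 2 * (L' \<omega>)\<^sup>2" for \<omega>
        using norm_add_sq_le[of "L \<omega>" "- L' \<omega>"] by simp
    qed (use i in simp)
    also have "\<dots> = 2 * (\<integral>\<omega>. (L \<omega>)\<^sup>2 \<partial>M) + 2 * (\<integral>\<omega>. (L' \<omega>)\<^sup>2 \<partial>M)" using i by simp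
    also have "\<dots> \<le> 2 * (\<integral>x. slab p q m x \<partial>MT) + 2 * (\<integral>x. slab p q m' x \<partial>MT)"
      using L L' by (simp add: ito_increment_def)
    also have "\<dots> = (\<integral>x. 2 * slab p q m x + 2 * slab p q m' x \<partial>MT)" using m by simp
    also have "\<dots> = (\<integral>x. slab p q (\<lambda>s \<omega>. 2 * m s \<omega> + 2 * m' s \<omega>) x \<partial>MT)"
      by (intro Bochner_Integration.integral_cong refl) (simp add: slab_def algebra_simps)
    finally show "(\<integral>\<omega>. (L \<omega> - L' \<omega>)\<^sup>2 \<partial>M) \<le> (\<integral>x. slab p q (\<lambda>s \<omega>. 2 * m s \<omega> + 2 * m' s \<omega>) x \<partial>MT)" .
  qed
qed

lemma slab_norm_sq_integrable:
  "sq_integrable MT (slab a b Z) \<Longrightarrow> integrable MT (slab a b (\<lambda>s \<omega>. (norm (Z s \<omega>))\<^sup>2))"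
  by (simp add: sq_integrable_def slab_norm_sq[abs_def])

lemma bsde_approximable:
  assumes "bsde_solution M F B T \<xi> g Y Z" "0 \<le> T" "sq_integrable MT (slab 0 T Z)"
  shows "approximable 0 T Z"
proof -
  obtain J where "has_ito_integral M F B Z 0 T J"
    using assms(1,2) unfolding bsde_solution_def by (metis atLeastAtMost_iff order_refl)
  then show ?thesis using assms(3) by (intro ito_integrable_approximable) auto
qed

section \<open>The comparison on the late and on the early interval\<close>

lemma horizon_comparison:
  assumes T: "0 < T\<^sub>1" "T\<^sub>1 < T\<^sub>2"
    and \<xi>: "L2_rv M (F T\<^sub>1) \<xi>\<^sub>1" "L2_rv M (F T\<^sub>2) \<xi>\<^sub>2"
    and drv: "standard_driver M F T\<^sub>1 g\<^sub>1" "standard_driver M F T\<^sub>2 g\<^sub>2"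
    and sol: "bsde_solution M F B T\<^sub>1 \<xi>\<^sub>1 g\<^sub>1 Y\<^sub>1 Z\<^sub>1" "bsde_solution M F B T\<^sub>2 \<xi>\<^sub>2 g\<^sub>2 Y\<^sub>2 Z\<^sub>2"
    and g12: "\<And>s y z. s \<in> {0..T\<^sub>1} \<Longrightarrow> AE \<omega> in M. g\<^sub>2 s \<omega> y z \<ge> g\<^sub>1 s \<omega> y z"
    and g2: "\<And>s y z. s \<in> {T\<^sub>1..T\<^sub>2} \<Longrightarrow> AE \<omega> in M. g\<^sub>2 s \<omega> y z \<ge> 0"
    and \<xi>12: "AE \<omega> in M. \<xi>\<^sub>2 \<omega> \<ge> \<xi>\<^sub>1 \<omega>"
  shows "(\<forall>t\<in>{0..T\<^sub>1}. AE \<omega> in M. Y\<^sub>2 t \<omega> \<ge> Y\<^sub>1 t \<omega>) \<and> (\<forall>t\<in>{T\<^sub>1..T\<^sub>2}. AE \<omega> in M. Y\<^sub>2 t \<omega> \<ge> \<xi>\<^sub>1 \<omega>)"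
proof -
  have T0: "0 \<le> T\<^sub>1" "0 \<le> T\<^sub>2" using T by auto
  obtain f\<^sub>1 where f1: "sq_integrable MT (slab 0 T\<^sub>1 f\<^sub>1)" "AE x in MT. 0 < snd x \<and> snd x \<le> T\<^sub>1 \<longrightarrow>
      ev f\<^sub>1 x = ev g\<^sub>1 x (ev Y\<^sub>1 x) (ev Z\<^sub>1 x)"
    and Y1: "\<And>t. 0 \<le> t \<Longrightarrow> t \<le> T\<^sub>1 \<Longrightarrow> sq_integrable M (Y\<^sub>1 t)"
    and dyn1: "\<And>p q. 0 \<le> p \<Longrightarrow> p \<le> q \<Longrightarrow> q \<le> T\<^sub>1 \<Longrightarrow> \<exists>L. ito_increment p q Z\<^sub>1 (\<lambda>s \<omega>. (norm (Z\<^sub>1 s \<omega>))\<^sup>2) L \<and>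
      (AE \<omega> in M. Y\<^sub>1 p \<omega> = Y\<^sub>1 q \<omega> + (\<integral>s. slab p q f\<^sub>1 (\<omega>, s) \<partial>lborel) - L \<omega>)"
    and end1: "AE \<omega> in M. Y\<^sub>1 T\<^sub>1 \<omega> = \<xi>\<^sub>1 \<omega>"
    and Y1s: "sq_integrable MT (slab 0 T\<^sub>1 Y\<^sub>1)" and Z1s: "sq_integrable MT (slab 0 T\<^sub>1 Z\<^sub>1)"
    by (rule bsde_dynamics[OF sol(1) drv(1) \<xi>(1) T0(1)]) (rule that)
  obtain f\<^sub>2 where f2: "sq_integrable MT (slab 0 T\<^sub>2 f\<^sub>2)" "AE x in MT. 0 < snd x \<and> snd x \<le> T\<^sub>2 \<longrightarrow>
      ev f\<^sub>2 x = ev g\<^sub>2 x (ev Y\<^sub>2 x) (ev Z\<^sub>2 x)"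
    and Y2: "\<And>t. 0 \<le> t \<Longrightarrow> t \<le> T\<^sub>2 \<Longrightarrow> sq_integrable M (Y\<^sub>2 t)"
    and dyn2: "\<And>p q. 0 \<le> p \<Longrightarrow> p \<le> q \<Longrightarrow> q \<le> T\<^sub>2 \<Longrightarrow> \<exists>L. ito_increment p q Z\<^sub>2 (\<lambda>s \<omega>. (norm (Z\<^sub>2 s \<omega>))\<^sup>2) L \<and>
      (AE \<omega> in M. Y\<^sub>2 p \<omega> = Y\<^sub>2 q \<omega> + (\<integral>s. slab p q f\<^sub>2 (\<omega>, s) \<partial>lborel) - L \<omega>)"
    and end2: "AE \<omega> in M. Y\<^sub>2 T\<^sub>2 \<omega> = \<xi>\<^sub>2 \<omega>"
    and Y2s: "sq_integrable MT (slab 0 T\<^sub>2 Y\<^sub>2)" and Z2s: "sq_integrable MT (slab 0 T\<^sub>2 Z\<^sub>2)"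
    by (rule bsde_dynamics[OF sol(2) drv(2) \<xi>(2) T0(2)]) (rule that)
  have Y1F: "Y\<^sub>1 t \<in> borel_measurable (F t)" if "0 \<le> t" "t \<le> T\<^sub>1" for t
    using sol(1) that by (simp add: bsde_solution_def measurable_adapted_def)
  have Y2F: "Y\<^sub>2 t \<in> borel_measurable (F t)" if "0 \<le> t" "t \<le> T\<^sub>2" for t
    using sol(2) that by (simp add: bsde_solution_def measurable_adapted_def)
  obtain C\<^sub>1 N\<^sub>1 where C1: "0 < C\<^sub>1" and N1: "N\<^sub>1 \<in> null_sets MT"
    and lip1: "\<And>x y y' z z'. x \<in> space MT \<Longrightarrow> 0 < snd x \<Longrightarrow> snd x \<le> T\<^sub>1 \<Longrightarrow> x \<notin> N\<^sub>1 \<Longrightarrow>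
      \<bar>ev g\<^sub>1 x y z - ev g\<^sub>1 x y' z'\<bar> \<le> C\<^sub>1 * (\<bar>y - y'\<bar> + norm (z - z'))"
    by (rule driver_lipschitz[OF drv(1) T0(1)]) (rule that)
  obtain C\<^sub>2 N\<^sub>2 where C2: "0 < C\<^sub>2" and N2: "N\<^sub>2 \<in> null_sets MT"
    and lip2: "\<And>x y y' z z'. x \<in> space MT \<Longrightarrow> 0 < snd x \<Longrightarrow> snd x \<le> T\<^sub>2 \<Longrightarrow> x \<notin> N\<^sub>2 \<Longrightarrow>
      \<bar>ev g\<^sub>2 x y z - ev g\<^sub>2 x y' z'\<bar> \<le> C\<^sub>2 * (\<bar>y - y'\<bar> + norm (z - z'))"
    by (rule driver_lipschitz[OF drv(2) T0(2)]) (rule that)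
  have cont1: "continuous_on UNIV (\<lambda>c. ev g\<^sub>1 x (fst c) (snd c))"
    if "x \<in> space MT" "0 < snd x" "snd x \<le> T\<^sub>1" "x \<notin> N\<^sub>1" for x
    by (rule lipschitz_imp_continuous_pair[OF less_imp_le[OF C1] lip1[OF that]])
  have cont2: "continuous_on UNIV (\<lambda>c. ev g\<^sub>2 x (fst c) (snd c))"
    if "x \<in> space MT" "0 < snd x" "snd x \<le> T\<^sub>2" "x \<notin> N\<^sub>2" for x
    by (rule lipschitz_imp_continuous_pair[OF less_imp_le[OF C2] lip2[OF that]])
  have g1m: "slab 0 T\<^sub>1 (\<lambda>s \<omega>. g\<^sub>1 s \<omega> y z) \<in> borel_measurable MT" for y z
    using drv(1) by (intro slab_measurable T0) (simp add: standard_driver_def)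
  have g2m: "slab 0 T\<^sub>2 (\<lambda>s \<omega>. g\<^sub>2 s \<omega> y z) \<in> borel_measurable MT" for y z
    using drv(2) by (intro slab_measurable T0) (simp add: standard_driver_def)
  have nonneg2: "AE x in MT. T\<^sub>1 < snd x \<and> snd x \<le> T\<^sub>2 \<longrightarrow> (\<forall>c. 0 \<le> ev g\<^sub>2 x (fst c) (snd c))"
  proof (rule AE_MT_nonneg_continuous[where h="\<lambda>c s \<omega>. g\<^sub>2 s \<omega> (fst c) (snd c)"])
    show "slab T\<^sub>1 T\<^sub>2 (\<lambda>s \<omega>. g\<^sub>2 s \<omega> (fst c) (snd c)) \<in> borel_measurable MT" for c
      by (rule slab_measurable_sub[OF g2m]) (use T in auto)
    show "AE \<omega> in M. 0 \<le> g\<^sub>2 s \<omega> (fst c) (snd c)" if "T\<^sub>1 < s" "s \<le> T\<^sub>2" for s c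
      using g2[of s "fst c" "snd c"] that by simp
    show "AE x in MT. T\<^sub>1 < snd x \<and> snd x \<le> T\<^sub>2 \<longrightarrow> continuous_on UNIV (\<lambda>c. ev g\<^sub>2 x (fst c) (snd c))"
      using AE_not_in[OF N2] AE_space
    proof eventually_elim
      fix x assume "x \<notin> N\<^sub>2" "x \<in> space MT"
      then show "T\<^sub>1 < snd x \<and> snd x \<le> T\<^sub>2 \<longrightarrow> continuous_on UNIV (\<lambda>c. ev g\<^sub>2 x (fst c) (snd c))"
        using cont2[of x] T by simp
    qed
  qed
  have nonneg12: "AE x in MT. 0 < snd x \<and> snd x \<le> T\<^sub>1 \<longrightarrow>
      (\<forall>c. 0 \<le> ev g\<^sub>2 x (fst c) (snd c) - ev g\<^sub>1 x (fst c) (snd c))"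
  proof (rule AE_MT_nonneg_continuous[where h="\<lambda>c s \<omega>. g\<^sub>2 s \<omega> (fst c) (snd c) - g\<^sub>1 s \<omega> (fst c) (snd c)"])
    show "slab 0 T\<^sub>1 (\<lambda>s \<omega>. g\<^sub>2 s \<omega> (fst c) (snd c) - g\<^sub>1 s \<omega> (fst c) (snd c)) \<in> borel_measurable MT" for c
      unfolding slab_diff[abs_def]
      by (intro borel_measurable_diff g1m slab_measurable_sub[OF g2m]) (use T in auto)
    show "AE \<omega> in M. 0 \<le> g\<^sub>2 s \<omega> (fst c) (snd c) - g\<^sub>1 s \<omega> (fst c) (snd c)" if "0 < s" "s \<le> T\<^sub>1" for s c
      using g12[of s "fst c" "snd c"] that by simp
    show "AE x in MT. 0 < snd x \<and> snd x \<le> T\<^sub>1 \<longrightarrow> continuous_on UNIV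
        (\<lambda>c. ev g\<^sub>2 x (fst c) (snd c) - ev g\<^sub>1 x (fst c) (snd c))"
      using AE_not_in[OF N1] AE_not_in[OF N2] AE_space
    proof eventually_elim
      fix x assume "x \<notin> N\<^sub>1" "x \<notin> N\<^sub>2" "x \<in> space MT"
      then show "0 < snd x \<and> snd x \<le> T\<^sub>1 \<longrightarrow> continuous_on UNIV
          (\<lambda>c. ev g\<^sub>2 x (fst c) (snd c) - ev g\<^sub>1 x (fst c) (snd c))"
        using cont1[of x] cont2[of x] T by (intro impI continuous_on_diff) auto
    qed
  qed
  have \<xi>F: "\<xi>\<^sub>1 \<in> borel_measurable (F T\<^sub>1)" and \<xi>2: "sq_integrable M \<xi>\<^sub>1"
    using \<xi>(1) measurable_F_M by (auto simp: L2_rv_def sq_integrable_def)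
  have appr2: "approximable 0 T\<^sub>2 Z\<^sub>2" by (rule bsde_approximable[OF sol(2) T0(2) Z2s])
  have appr1: "approximable 0 T\<^sub>1 Z\<^sub>1" by (rule bsde_approximable[OF sol(1) T0(1) Z1s])

  \<comment> \<open>The constant process \<open>\<xi>\<^sub>1\<close> has neither drift nor
    martingale part, so subtracting it leaves \<open>f\<^sub>2\<close> and \<open>Z\<^sub>2\<close>
    unchanged; it is adapted from time \<open>T\<^sub>1\<close> on.\<close>
  interpret late: bsde_supersolution M B T\<^sub>1 T\<^sub>2 C\<^sub>2 "\<lambda>t \<omega>. Y\<^sub>2 t \<omega> - \<xi>\<^sub>1 \<omega>" f\<^sub>2 "\<lambda>s \<omega>. (norm (Z\<^sub>2 s \<omega>))\<^sup>2" Z\<^sub>2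
  proof (intro bsde_supersolution.intro bsde_supersolution_axioms.intro brownian_space_axioms)
    show "0 \<le> T\<^sub>1" "0 \<le> C\<^sub>2" using T C2 by auto
    show "(\<lambda>\<omega>. Y\<^sub>2 t \<omega> - \<xi>\<^sub>1 \<omega>) \<in> borel_measurable (F t)" if "T\<^sub>1 \<le> t" "t \<le> T\<^sub>2" for t
      by (intro borel_measurable_diff Y2F measurable_F_mono[OF \<xi>F]) (use that T in auto)
    show "sq_integrable M (\<lambda>\<omega>. Y\<^sub>2 t \<omega> - \<xi>\<^sub>1 \<omega>)" if "T\<^sub>1 \<le> t" "t \<le> T\<^sub>2" for t
      by (intro sq_integrable_diff Y2 \<xi>2) (use that T in auto)
    show "sq_integrable MT (slab T\<^sub>1 T\<^sub>2 (\<lambda>t \<omega>. Y\<^sub>2 t \<omega> - \<xi>\<^sub>1 \<omega>))"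
      unfolding slab_diff[abs_def]
      by (intro sq_integrable_diff slab_const_sq_integrable \<xi>2 slab_sq_integrable_sub[OF Y2s]) (use T in auto)
    show "sq_integrable MT (slab T\<^sub>1 T\<^sub>2 f\<^sub>2)" "sq_integrable MT (slab T\<^sub>1 T\<^sub>2 Z\<^sub>2)"
      by (rule slab_sq_integrable_sub[OF f2(1)] slab_sq_integrable_sub[OF Z2s]; use T in simp)+
    then show "integrable MT (slab T\<^sub>1 T\<^sub>2 (\<lambda>s \<omega>. (norm (Z\<^sub>2 s \<omega>))\<^sup>2))" by (intro slab_norm_sq_integrable)
    show "approximable T\<^sub>1 T\<^sub>2 Z\<^sub>2" by (rule approximable_sub[OF appr2 Z2s]) (use T in auto)
    show "\<exists>L. ito_increment p q Z\<^sub>2 (\<lambda>s \<omega>. (norm (Z\<^sub>2 s \<omega>))\<^sup>2) L \<and>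
        (AE \<omega> in M. Y\<^sub>2 p \<omega> - \<xi>\<^sub>1 \<omega> = Y\<^sub>2 q \<omega> - \<xi>\<^sub>1 \<omega> + (\<integral>s. slab p q f\<^sub>2 (\<omega>, s) \<partial>lborel) - L \<omega>)"
      if "T\<^sub>1 \<le> p" "p \<le> q" "q \<le> T\<^sub>2" for p q
    proof -
      have p0: "0 \<le> p" using that T by simp
      obtain L where L: "ito_increment p q Z\<^sub>2 (\<lambda>s \<omega>. (norm (Z\<^sub>2 s \<omega>))\<^sup>2) L"
        and eq: "AE \<omega> in M. Y\<^sub>2 p \<omega> = Y\<^sub>2 q \<omega> + (\<integral>s. slab p q f\<^sub>2 (\<omega>, s) \<partial>lborel) - L \<omega>"
        using dyn2[OF p0 \<open>p \<le> q\<close> \<open>q \<le> T\<^sub>2\<close>] by (elim exE conjE)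
      from eq have "AE \<omega> in M. Y\<^sub>2 p \<omega> - \<xi>\<^sub>1 \<omega> = Y\<^sub>2 q \<omega> - \<xi>\<^sub>1 \<omega> + (\<integral>s. slab p q f\<^sub>2 (\<omega>, s) \<partial>lborel) - L \<omega>"
        by eventually_elim simp
      with L show ?thesis by blast
    qed
    show "AE x in MT. T\<^sub>1 < snd x \<and> snd x \<le> T\<^sub>2 \<longrightarrow>
      ev f\<^sub>2 x \<ge> - C\<^sub>2 * (\<bar>ev Y\<^sub>2 x - \<xi>\<^sub>1 (fst x)\<bar> + norm (ev Z\<^sub>2 x))"
      using f2(2) nonneg2 AE_not_in[OF N2] AE_space
    proof eventually_elim
      fix x assume f: "0 < snd x \<and> snd x \<le> T\<^sub>2 \<longrightarrow>
          ev f\<^sub>2 x = ev g\<^sub>2 x (ev Y\<^sub>2 x) (ev Z\<^sub>2 x)"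
        and nn: "T\<^sub>1 < snd x \<and> snd x \<le> T\<^sub>2 \<longrightarrow> (\<forall>c. 0 \<le> ev g\<^sub>2 x (fst c) (snd c))"
        and x: "x \<notin> N\<^sub>2" "x \<in> space MT"
      show "T\<^sub>1 < snd x \<and> snd x \<le> T\<^sub>2 \<longrightarrow>
        ev f\<^sub>2 x \<ge> - C\<^sub>2 * (\<bar>ev Y\<^sub>2 x - \<xi>\<^sub>1 (fst x)\<bar> + norm (ev Z\<^sub>2 x))"
      proof
        assume s: "T\<^sub>1 < snd x \<and> snd x \<le> T\<^sub>2"
        \<comment> \<open>The reference point is \<open>\<xi>\<^sub>1\<close> with vanishing z:
          there the driver is nonnegative, and the Lipschitz bound accounts for the distance from
          it.\<close>
        have "0 \<le> ev g\<^sub>2 x (\<xi>\<^sub>1 (fst x)) 0"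
          using nn[rule_format, OF s, of "(\<xi>\<^sub>1 (fst x), 0)"] by simp
        moreover have "\<bar>ev g\<^sub>2 x (ev Y\<^sub>2 x) (ev Z\<^sub>2 x) - ev g\<^sub>2 x (\<xi>\<^sub>1 (fst x)) 0\<bar>
            \<le> C\<^sub>2 * (\<bar>ev Y\<^sub>2 x - \<xi>\<^sub>1 (fst x)\<bar> + norm (ev Z\<^sub>2 x))"
          using lip2[OF x(2) _ _ x(1), of "ev Y\<^sub>2 x" "ev Z\<^sub>2 x" "\<xi>\<^sub>1 (fst x)" 0] s T by simp
        ultimately show "ev f\<^sub>2 x \<ge> - C\<^sub>2 * (\<bar>ev Y\<^sub>2 x - \<xi>\<^sub>1 (fst x)\<bar> + norm (ev Z\<^sub>2 x))"
          using f s T by simp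
      qed
    qed
  qed simp
  have "AE \<omega> in M. 0 \<le> Y\<^sub>2 T\<^sub>2 \<omega> - \<xi>\<^sub>1 \<omega>" using end2 \<xi>12 by eventually_elim simp
  then have late: "AE \<omega> in M. Y\<^sub>2 t \<omega> \<ge> \<xi>\<^sub>1 \<omega>" if "T\<^sub>1 \<le> t" "t \<le> T\<^sub>2" for t
    using late.nonneg[OF _ that] by simp

  interpret early: bsde_supersolution M B 0 T\<^sub>1 C\<^sub>2 "\<lambda>t \<omega>. Y\<^sub>2 t \<omega> - Y\<^sub>1 t \<omega>" "\<lambda>t \<omega>. f\<^sub>2 t \<omega> - f\<^sub>1 t \<omega>"
    "\<lambda>s \<omega>. 2 * (norm (Z\<^sub>2 s \<omega>))\<^sup>2 + 2 * (norm (Z\<^sub>1 s \<omega>))\<^sup>2" "\<lambda>t \<omega>. Z\<^sub>2 t \<omega> - Z\<^sub>1 t \<omega>"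
  proof (intro bsde_supersolution.intro bsde_supersolution_axioms.intro brownian_space_axioms)
    show "0 \<le> C\<^sub>2" using C2 by simp
    show "(\<lambda>\<omega>. Y\<^sub>2 t \<omega> - Y\<^sub>1 t \<omega>) \<in> borel_measurable (F t)" if "0 \<le> t" "t \<le> T\<^sub>1" for t
      by (intro borel_measurable_diff Y1F Y2F) (use that T in auto)
    show "sq_integrable M (\<lambda>\<omega>. Y\<^sub>2 t \<omega> - Y\<^sub>1 t \<omega>)" if "0 \<le> t" "t \<le> T\<^sub>1" for t
      by (intro sq_integrable_diff Y1 Y2) (use that T in auto)
    have s: "sq_integrable MT (slab 0 T\<^sub>1 Y\<^sub>2)" "sq_integrable MT (slab 0 T\<^sub>1 f\<^sub>2)" "sq_integrable MT (slab 0 T\<^sub>1 Z\<^sub>2)"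
      using T by (auto intro!: slab_sq_integrable_sub[OF Y2s] slab_sq_integrable_sub[OF f2(1)]
          slab_sq_integrable_sub[OF Z2s])
    show "sq_integrable MT (slab 0 T\<^sub>1 (\<lambda>t \<omega>. Y\<^sub>2 t \<omega> - Y\<^sub>1 t \<omega>))"
      "sq_integrable MT (slab 0 T\<^sub>1 (\<lambda>t \<omega>. f\<^sub>2 t \<omega> - f\<^sub>1 t \<omega>))"
      "sq_integrable MT (slab 0 T\<^sub>1 (\<lambda>t \<omega>. Z\<^sub>2 t \<omega> - Z\<^sub>1 t \<omega>))"
      unfolding slab_diff[abs_def] by (intro sq_integrable_diff s Y1s f1(1) Z1s)+
    have m: "integrable MT (slab 0 T\<^sub>1 (\<lambda>s \<omega>. (norm (Z\<^sub>2 s \<omega>))\<^sup>2))" "integrable MT (slab 0 T\<^sub>1 (\<lambda>s \<omega>. (norm (Z\<^sub>1 s \<omega>))\<^sup>2))"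
      by (intro slab_norm_sq_integrable s Z1s)+
    have "slab 0 T\<^sub>1 (\<lambda>s \<omega>. 2 * (norm (Z\<^sub>2 s \<omega>))\<^sup>2 + 2 * (norm (Z\<^sub>1 s \<omega>))\<^sup>2)
        = (\<lambda>x. 2 * slab 0 T\<^sub>1 (\<lambda>s \<omega>. (norm (Z\<^sub>2 s \<omega>))\<^sup>2) x + 2 * slab 0 T\<^sub>1 (\<lambda>s \<omega>. (norm (Z\<^sub>1 s \<omega>))\<^sup>2) x)"
      by (simp add: fun_eq_iff slab_def algebra_simps)
    then show "integrable MT (slab 0 T\<^sub>1 (\<lambda>s \<omega>. 2 * (norm (Z\<^sub>2 s \<omega>))\<^sup>2 + 2 * (norm (Z\<^sub>1 s \<omega>))\<^sup>2))"
      using m by simp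
    show "approximable 0 T\<^sub>1 (\<lambda>t \<omega>. Z\<^sub>2 t \<omega> - Z\<^sub>1 t \<omega>)"
      by (intro approximable_diff approximable_sub[OF appr2 Z2s] appr1 s Z1s) (use T in auto)
    show "\<exists>L. ito_increment p q (\<lambda>t \<omega>. Z\<^sub>2 t \<omega> - Z\<^sub>1 t \<omega>) (\<lambda>s \<omega>. 2 * (norm (Z\<^sub>2 s \<omega>))\<^sup>2 + 2 * (norm (Z\<^sub>1 s \<omega>))\<^sup>2) L \<and>
        (AE \<omega> in M. Y\<^sub>2 p \<omega> - Y\<^sub>1 p \<omega> = Y\<^sub>2 q \<omega> - Y\<^sub>1 q \<omega> + (\<integral>s. slab p q (\<lambda>t \<omega>. f\<^sub>2 t \<omega> - f\<^sub>1 t \<omega>) (\<omega>, s) \<partial>lborel) - L \<omega>)"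
      if pq: "0 \<le> p" "p \<le> q" "q \<le> T\<^sub>1" for p q
    proof -
      obtain L\<^sub>1 where L1: "ito_increment p q Z\<^sub>1 (\<lambda>s \<omega>. (norm (Z\<^sub>1 s \<omega>))\<^sup>2) L\<^sub>1"
        and eq1: "AE \<omega> in M. Y\<^sub>1 p \<omega> = Y\<^sub>1 q \<omega> + (\<integral>s. slab p q f\<^sub>1 (\<omega>, s) \<partial>lborel) - L\<^sub>1 \<omega>"
        using dyn1[OF pq] by (elim exE conjE)
      have q2: "q \<le> T\<^sub>2" using pq T by simp
      obtain L\<^sub>2 where L2: "ito_increment p q Z\<^sub>2 (\<lambda>s \<omega>. (norm (Z\<^sub>2 s \<omega>))\<^sup>2) L\<^sub>2"
        and eq2: "AE \<omega> in M. Y\<^sub>2 p \<omega> = Y\<^sub>2 q \<omega> + (\<integral>s. slab p q f\<^sub>2 (\<omega>, s) \<partial>lborel) - L\<^sub>2 \<omega>"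
        using dyn2[OF pq(1,2) q2] by (elim exE conjE)
      have "ito_increment p q (\<lambda>t \<omega>. Z\<^sub>2 t \<omega> - Z\<^sub>1 t \<omega>) (\<lambda>s \<omega>. 2 * (norm (Z\<^sub>2 s \<omega>))\<^sup>2 + 2 * (norm (Z\<^sub>1 s \<omega>))\<^sup>2) (\<lambda>\<omega>. L\<^sub>2 \<omega> - L\<^sub>1 \<omega>)"
        by (intro ito_increment_diff L1 L2 pq slab_norm_sq_integrable
            slab_sq_integrable_sub[OF Z1s pq(1,3)] slab_sq_integrable_sub[OF Z2s pq(1) q2])
      moreover have "AE \<omega> in M. Y\<^sub>2 p \<omega> - Y\<^sub>1 p \<omega> = Y\<^sub>2 q \<omega> - Y\<^sub>1 q \<omega>
          + (\<integral>s. slab p q (\<lambda>t \<omega>. f\<^sub>2 t \<omega> - f\<^sub>1 t \<omega>) (\<omega>, s) \<partial>lborel) - (L\<^sub>2 \<omega> - L\<^sub>1 \<omega>)"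
        using eq1 eq2 slab_section_integral(1)[OF slab_sq_integrable_sub[OF f1(1) pq(1,3)] pq(2)]
          slab_section_integral(1)[OF slab_sq_integrable_sub[OF f2(1) pq(1) q2] pq(2)]
        by eventually_elim (simp add: slab_diff)
      ultimately show ?thesis by blast
    qed
    show "AE x in MT. 0 < snd x \<and> snd x \<le> T\<^sub>1 \<longrightarrow>
      ev f\<^sub>2 x - ev f\<^sub>1 x \<ge>
        - C\<^sub>2 * (\<bar>ev Y\<^sub>2 x - ev Y\<^sub>1 x\<bar> + norm (ev Z\<^sub>2 x - ev Z\<^sub>1 x))"
      using f1(2) f2(2) nonneg12 AE_not_in[OF N2] AE_space
    proof eventually_elim
      fix x assume f: "0 < snd x \<and> snd x \<le> T\<^sub>1 \<longrightarrow>
          ev f\<^sub>1 x = ev g\<^sub>1 x (ev Y\<^sub>1 x) (ev Z\<^sub>1 x)"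
          "0 < snd x \<and> snd x \<le> T\<^sub>2 \<longrightarrow>
          ev f\<^sub>2 x = ev g\<^sub>2 x (ev Y\<^sub>2 x) (ev Z\<^sub>2 x)"
        and nn: "0 < snd x \<and> snd x \<le> T\<^sub>1 \<longrightarrow>
          (\<forall>c. 0 \<le> ev g\<^sub>2 x (fst c) (snd c) - ev g\<^sub>1 x (fst c) (snd c))"
        and x: "x \<notin> N\<^sub>2" "x \<in> space MT"
      let ?\<omega> = "fst x" and ?s = "snd x"
      show "0 < snd x \<and> snd x \<le> T\<^sub>1 \<longrightarrow> f\<^sub>2 ?s ?\<omega> - f\<^sub>1 ?s ?\<omega> \<ge>
        - C\<^sub>2 * (\<bar>Y\<^sub>2 ?s ?\<omega> - Y\<^sub>1 ?s ?\<omega>\<bar> + norm (Z\<^sub>2 ?s ?\<omega> - Z\<^sub>1 ?s ?\<omega>))"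
      proof
        assume s: "0 < snd x \<and> snd x \<le> T\<^sub>1"
        \<comment> \<open>Both drivers are compared at \<open>Y\<^sub>1\<close>,
          \<open>Z\<^sub>1\<close>. The difference then splits into a nonnegative part and a
          Lipschitz remainder of \<open>g\<^sub>2\<close> alone, hence the constant
          \<open>C\<^sub>2\<close>.\<close>
        have "0 \<le> g\<^sub>2 ?s ?\<omega> (Y\<^sub>1 ?s ?\<omega>) (Z\<^sub>1 ?s ?\<omega>) - g\<^sub>1 ?s ?\<omega> (Y\<^sub>1 ?s ?\<omega>) (Z\<^sub>1 ?s ?\<omega>)"
          using nn[rule_format, OF s, of "(Y\<^sub>1 ?s ?\<omega>, Z\<^sub>1 ?s ?\<omega>)"] by simp
        moreover have "\<bar>g\<^sub>2 ?s ?\<omega> (Y\<^sub>2 ?s ?\<omega>) (Z\<^sub>2 ?s ?\<omega>) - g\<^sub>2 ?s ?\<omega> (Y\<^sub>1 ?s ?\<omega>) (Z\<^sub>1 ?s ?\<omega>)\<bar>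
            \<le> C\<^sub>2 * (\<bar>Y\<^sub>2 ?s ?\<omega> - Y\<^sub>1 ?s ?\<omega>\<bar> + norm (Z\<^sub>2 ?s ?\<omega> - Z\<^sub>1 ?s ?\<omega>))"
          using s T by (intro lip2[OF x(2) _ _ x(1)]) auto
        ultimately show "f\<^sub>2 ?s ?\<omega> - f\<^sub>1 ?s ?\<omega> \<ge>
            - C\<^sub>2 * (\<bar>Y\<^sub>2 ?s ?\<omega> - Y\<^sub>1 ?s ?\<omega>\<bar> + norm (Z\<^sub>2 ?s ?\<omega> - Z\<^sub>1 ?s ?\<omega>))"
          using f s T by simp
      qed
    qed
  qed simp_all
  \<comment> \<open>The late comparison at its left end point is the terminal condition of the early
    one.\<close>
  have "AE \<omega> in M. 0 \<le> Y\<^sub>2 T\<^sub>1 \<omega> - Y\<^sub>1 T\<^sub>1 \<omega>"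
    using late[OF order_refl less_imp_le[OF T(2)]] end1 by eventually_elim simp
  then have "AE \<omega> in M. Y\<^sub>2 t \<omega> \<ge> Y\<^sub>1 t \<omega>" if "0 \<le> t" "t \<le> T\<^sub>1" for t
    using early.nonneg[OF _ that] by simp
  with late show ?thesis by simp
qed

end

theorem theorem16:
  fixes M :: "'w measure"
    and B :: "real \<Rightarrow> 'w \<Rightarrow> real ^ 'd"
    and F :: "real \<Rightarrow> 'w measure"
    and T\<^sub>1 T\<^sub>2 :: real
    and \<xi>\<^sub>1 \<xi>\<^sub>2 :: "'w \<Rightarrow> real"
    and g\<^sub>1 g\<^sub>2 :: "real \<Rightarrow> 'w \<Rightarrow> real \<Rightarrow> real ^ 'd \<Rightarrow> real"
    and Y\<^sub>1 Y\<^sub>2 :: "real \<Rightarrow> 'w \<Rightarrow> real"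
    and Z\<^sub>1 Z\<^sub>2 :: "real \<Rightarrow> 'w \<Rightarrow> real ^ 'd"
  assumes "prob_space M"
    and "brownian_motion M B"
    and F: "F = augmented_filtration M B"
    and "0 < T\<^sub>1" and "T\<^sub>1 < T\<^sub>2"
    and "L2_rv M (F T\<^sub>1) \<xi>\<^sub>1" and "L2_rv M (F T\<^sub>2) \<xi>\<^sub>2"
    and "standard_driver M F T\<^sub>1 g\<^sub>1" and "standard_driver M F T\<^sub>2 g\<^sub>2"
    and "bsde_solution M F B T\<^sub>1 \<xi>\<^sub>1 g\<^sub>1 Y\<^sub>1 Z\<^sub>1" and "bsde_solution M F B T\<^sub>2 \<xi>\<^sub>2 g\<^sub>2 Y\<^sub>2 Z\<^sub>2"
    and "\<And>s y z. s \<in> {0..T\<^sub>1} \<Longrightarrow> AE \<omega> in M. g\<^sub>2 s \<omega> y z \<ge> g\<^sub>1 s \<omega> y z"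
    and "\<And>s y z. s \<in> {T\<^sub>1..T\<^sub>2} \<Longrightarrow> AE \<omega> in M. g\<^sub>2 s \<omega> y z \<ge> 0"
    and "AE \<omega> in M. \<xi>\<^sub>2 \<omega> \<ge> \<xi>\<^sub>1 \<omega>"
  shows "(\<forall>t\<in>{0..T\<^sub>1}. AE \<omega> in M. Y\<^sub>2 t \<omega> \<ge> Y\<^sub>1 t \<omega>) \<and>
         (\<forall>t\<in>{T\<^sub>1..T\<^sub>2}. AE \<omega> in M. Y\<^sub>2 t \<omega> \<ge> \<xi>\<^sub>1 \<omega>)"
proof -
  interpret brownian_space M B
    using assms(1,2) by (simp add: brownian_space_def brownian_space_axioms_def)
  show ?thesis by (rule horizon_comparison[OF assms(4-14)[unfolded F]])
qed

end
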